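(* Let $\Gamma_1,\Gamma_2$ be two (centred) point-wise defined Gaussian fields on a bounded domain $D\subset\mathbb{C}$ whose covariance kernels satisfy $\mathcal{C}_1(z,w)\le\mathcal{C}_2(z,w)$ for any $z,w\in D$. Then for any convex function $f$ defined on $\mathbb{R}^+$ we have $$\mathbb{E}\big[f(M(\Gamma_1,D))\big]\le\mathbb{E}\big[f(M(\Gamma_2,D))\big].$$ Moreover, the opposite inequality holds for concave functions $f$ on $\mathbb{R}^+$.
   Context: For a centred pointwise-defined Gaussian field $\Gamma_i$ on $D$ (jointly measurable, e.g. continuous) with covariance $\mathcal{C}_i(z,w)=\mathbb{E}[\Gamma_i(z)\Gamma_i(w)]$ and a fixed parameter $\gamma\in\mathbb{R}$, $M(\Gamma_i,D)=\int_D\exp\big(\gamma\Gamma_i(z)-\frac{\gamma^2}{2}\mathcal{C}_i(z,z)\big)\,dz$, where $dz$ is Lebesgue measure. $\mathbb{R}^+=(0,\infty)$; functions $f$ are real-valued. Since $\mathbb{E}[M(\Gamma_i,D)]<\infty$, the expectations are well defined in $(-\infty,\infty]$ for convex $f$ (in $[-\infty,\infty)$ for concave $f$). *)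

theory Defs
  imports "HOL-Probability.Probability"
begin

(* The point mass at 0 counts as a centred Gaussian law (variance 0). *)
definition centred_gaussian_rv :: "'a measure \<Rightarrow> ('a \<Rightarrow> real) \<Rightarrow> bool" where
  "centred_gaussian_rv P X \<longleftrightarrow>
     X \<in> borel_measurable P \<and>
     (distr P borel X = return borel 0 \<or>
      (\<exists>\<sigma>>0. distributed P lborel X (normal_density 0 \<sigma>)))"

(* A field is a total function of the point; only its values on D matter. *)
definition centred_gaussian_field ::
    "'a measure \<Rightarrow> complex set \<Rightarrow> (complex \<Rightarrow> 'a \<Rightarrow> real) \<Rightarrow> bool" where
  "centred_gaussian_field P D \<Gamma> \<longleftrightarrow>
     prob_space P \<and>
     (\<lambda>(z, \<omega>). \<Gamma> z \<omega>) \<in> borel_measurable (restrict_space borel D \<Otimes>\<^sub>M P) \<and>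
     (\<forall>F a. finite F \<and> F \<subseteq> D \<longrightarrow> centred_gaussian_rv P (\<lambda>\<omega>. \<Sum>z\<in>F. a z * \<Gamma> z \<omega>))"

definition covariance_kernel ::
    "'a measure \<Rightarrow> (complex \<Rightarrow> 'a \<Rightarrow> real) \<Rightarrow> complex \<Rightarrow> complex \<Rightarrow> real" where
  "covariance_kernel P \<Gamma> z w = (LINT \<omega>|P. \<Gamma> z \<omega> * \<Gamma> w \<omega>)"

(* The integrand is positive with expectation 1 at each point of D, so for bounded D it is
   almost surely integrable; on the exceptional null event the integral takes the value 0. *)
definition chaos_mass ::
    "real \<Rightarrow> 'a measure \<Rightarrow> (complex \<Rightarrow> 'a \<Rightarrow> real) \<Rightarrow> complex set \<Rightarrow> 'a \<Rightarrow> real" where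
  "chaos_mass \<gamma> P \<Gamma> D \<omega> =
     (LINT z:D|lborel. exp (\<gamma> * \<Gamma> z \<omega> - \<gamma>\<^sup>2 / 2 * covariance_kernel P \<Gamma> z z))"

(* Expectation with values in [-\<infinity>, \<infinity>]: integral of the positive part minus integral of
   the negative part. It is meaningful when at least one of the two is finite: for a convex
   (concave) function of an integrable positive variable the negative (positive) part is
   dominated by an affine function, hence has finite integral. *)
definition extended_expectation :: "'a measure \<Rightarrow> ('a \<Rightarrow> real) \<Rightarrow> ereal" where
  "extended_expectation P X =
     enn2ereal (\<integral>\<^sup>+ \<omega>. ennreal (X \<omega>) \<partial>P) - enn2ereal (\<integral>\<^sup>+ \<omega>. ennreal (- X \<omega>) \<partial>P)"

end

theory Submission imports Defs begin

text \<open>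
  Finite sums of exponentials of Gaussian vectors are compared by a Lindeberg exchange argument:
  a Gaussian vector is a sum of independent copies of itself, scaled by \<open>1 / \<surd>m\<close>, and these copies
  are exchanged one at a time. Writing the normalised exponentials as \<open>1 + h\<^sub>i\<close>, the first
  order Taylor term has mean zero and the second order term is
  \<open>f'' / 2 \<cdot> \<Sum> q\<^sub>i q\<^sub>j (exp (A\<^sub>i\<^sub>j / m) - 1)\<close>, which is monotone in the covariance because
  \<open>f'' \<ge> 0\<close>. The equality in law of Gaussian vectors with the same covariance comes from uniqueness
  of multivariate characteristic functions.

  As the fields are only measurable, the integral over \<open>D\<close> is approximated by Monte Carlo sums: for
  independent uniform points \<open>u\<^sub>1, \<dots>, u\<^sub>n\<close> in \<open>D\<close> the sample means of the density converge to the
  normalised mass in \<open>L\<^sup>1\<close>, and for fixed points the finite comparison applies. This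
  gives the inequality for smooth Lipschitz convex functions, hence for Lipschitz convex functions.
  For a general \<open>f\<close>, subtract its tangent at \<open>1\<close>, whose expectation is the same for both masses,
  and apply Fatou's lemma to Lipschitz convex minorants of the nonnegative remainder.
\<close>

section \<open>Uniqueness of multivariate characteristic functions\<close>

text \<open>The normalisation is what makes a comparison of covariances sufficient. Each factor
  \<open>exp (X i - A i i / 2)\<close> has mean one whatever the variance, so the variances leave no
  first order effect, and a product of two factors has mean \<open>exp (A i j)\<close>, which
  increases with the covariance on the diagonal as well. Only exponential moments enter; the
  exchange takes the place of differentiation along an interpolation and Gaussian integration by
  parts. An intermediate vector is read in two ways, with a piece of X or a piece of Y split off,
  and these readings live on different product spaces; hence the need for equality in law. The
  kernel may be unbounded on the domain, so the exchange error is not uniform in the sampled points.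
  It is removed at each fixed sample, by letting the number of exchanges grow, before the sample
  size grows. Both masses have the area of the domain as their mean. This is why a tangent can be
  subtracted although the expectation of f itself may be infinite.\<close>

text \<open>The weights may be negative, so Levy's theorem is applied to the probability densities
  \<open>(2 + U) / c\<close> and \<open>(2 + V) / c\<close>.\<close>

lemma weighted_Levy_uniqueness:
  fixes X U :: "'a \<Rightarrow> real" and Y V :: "'b \<Rightarrow> real"
  assumes "prob_space P" "prob_space Q"
    and [measurable]: "X \<in> borel_measurable P" "U \<in> borel_measurable P"
      "Y \<in> borel_measurable Q" "V \<in> borel_measurable Q"
    and bU: "\<And>\<omega>. \<bar>U \<omega>\<bar> \<le> 1" and bV: "\<And>\<omega>. \<bar>V \<omega>\<bar> \<le> 1"
    and ch: "\<And>s. (CLINT \<omega>|P. iexp (s * X \<omega>)) = (CLINT \<omega>|Q. iexp (s * Y \<omega>))"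
    and wch: "\<And>s. (CLINT \<omega>|P. of_real (U \<omega>) * iexp (s * X \<omega>))
                = (CLINT \<omega>|Q. of_real (V \<omega>) * iexp (s * Y \<omega>))"
    and [measurable]: "B \<in> sets borel"
  shows "(LINT \<omega>|P. U \<omega> * indicator B (X \<omega>)) = (LINT \<omega>|Q. V \<omega> * indicator B (Y \<omega>))"
proof -
  interpret P: prob_space P by fact
  interpret Q: prob_space Q by fact
  define c where "c = 2 + (LINT \<omega>|P. U \<omega>)"
  have iU: "integrable P U" by (rule P.integrable_const_bound[of _ 1]) (use bU in auto)
  have iV: "integrable Q V" by (rule Q.integrable_const_bound[of _ 1]) (use bV in auto)
  \<comment> \<open>At frequency zero the weighted transform is the total weight, so the same
    \<open>c\<close> normalises both densities.\<close>
  have UV: "(LINT \<omega>|P. U \<omega>) = (LINT \<omega>|Q. V \<omega>)"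
    using wch[of 0] by simp
  have "\<bar>LINT \<omega>|P. U \<omega>\<bar> \<le> 1"
    using P.integral_le_const[OF iU, of 1] P.integral_ge_const[OF iU, of "-1"] bU
    by (auto simp: abs_le_iff minus_le_iff)
  then have c: "c \<ge> 1" by (auto simp: c_def)
  define p where "p = (\<lambda>\<omega>. (2 + U \<omega>) / c)"
  define q where "q = (\<lambda>\<omega>. (2 + V \<omega>) / c)"
  have [measurable]: "p \<in> borel_measurable P" "q \<in> borel_measurable Q" by (auto simp: p_def q_def)
  have p0: "p \<omega> \<ge> 0" for \<omega> using bU[of \<omega>] c by (auto simp: p_def)
  have q0: "q \<omega> \<ge> 0" for \<omega> using bV[of \<omega>] c by (auto simp: q_def)
  have ip: "integrable P p" using iU by (simp add: p_def)
  have iq: "integrable Q q" using iV by (simp add: q_def)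
  have p1: "(LINT \<omega>|P. p \<omega>) = 1" using iU c by (simp add: p_def c_def P.prob_space)
  have q1: "(LINT \<omega>|Q. q \<omega>) = 1" using iV c by (simp add: q_def c_def UV Q.prob_space)
  have prP: "prob_space (density P p)"
    by (rule prob_spaceI) (simp add: emeasure_density nn_integral_eq_integral ip p0 p1 cong: nn_integral_cong_simp)
  have prQ: "prob_space (density Q q)"
    by (rule prob_spaceI) (simp add: emeasure_density nn_integral_eq_integral iq q0 q1 cong: nn_integral_cong_simp)
  have iexpP: "integrable P (\<lambda>\<omega>. iexp (s * X \<omega>))" for s
    by (rule P.integrable_const_bound[of _ 1]) auto
  have iexpQ: "integrable Q (\<lambda>\<omega>. iexp (s * Y \<omega>))" for s
    by (rule Q.integrable_const_bound[of _ 1]) auto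
  have iUexp: "integrable P (\<lambda>\<omega>. of_real (U \<omega>) * iexp (s * X \<omega>))" for s
    by (rule P.integrable_const_bound[of _ 1]) (use bU in \<open>auto simp: norm_mult\<close>)
  have iVexp: "integrable Q (\<lambda>\<omega>. of_real (V \<omega>) * iexp (s * Y \<omega>))" for s
    by (rule Q.integrable_const_bound[of _ 1]) (use bV in \<open>auto simp: norm_mult\<close>)
  have "distr (density P p) borel X = distr (density Q q) borel Y"
  proof (rule Levy_uniqueness)
    show "real_distribution (distr (density P p) borel X)"
      by (rule prob_space.real_distribution_distr[OF prP]) simp
    show "real_distribution (distr (density Q q) borel Y)"
      by (rule prob_space.real_distribution_distr[OF prQ]) simp
    have "char (distr (density P p) borel X) s = (2 * (CLINT \<omega>|P. iexp (s * X \<omega>))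
       + (CLINT \<omega>|P. of_real (U \<omega>) * iexp (s * X \<omega>))) / c" for s
    proof -
      have "char (distr (density P p) borel X) s = (CLINT \<omega>|P. p \<omega> *\<^sub>R iexp (s * X \<omega>))"
        unfolding char_def by (subst integral_distr) (auto simp: integral_density p0)
      also have "\<dots> = (CLINT \<omega>|P. (2 * iexp (s * X \<omega>) + of_real (U \<omega>) * iexp (s * X \<omega>)) / c)"
        by (intro Bochner_Integration.integral_cong refl) (simp add: p_def scaleR_conv_of_real field_simps)
      also have "\<dots> = (2 * (CLINT \<omega>|P. iexp (s * X \<omega>)) + (CLINT \<omega>|P. of_real (U \<omega>) * iexp (s * X \<omega>))) / c"
        using iexpP[of s] iUexp[of s] by simp
      finally show ?thesis .
    qed
    moreover have "char (distr (density Q q) borel Y) s = (2 * (CLINT \<omega>|Q. iexp (s * Y \<omega>))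
       + (CLINT \<omega>|Q. of_real (V \<omega>) * iexp (s * Y \<omega>))) / c" for s
    proof -
      have "char (distr (density Q q) borel Y) s = (CLINT \<omega>|Q. q \<omega> *\<^sub>R iexp (s * Y \<omega>))"
        unfolding char_def by (subst integral_distr) (auto simp: integral_density q0)
      also have "\<dots> = (CLINT \<omega>|Q. (2 * iexp (s * Y \<omega>) + of_real (V \<omega>) * iexp (s * Y \<omega>)) / c)"
        by (intro Bochner_Integration.integral_cong refl) (simp add: q_def scaleR_conv_of_real field_simps)
      also have "\<dots> = (2 * (CLINT \<omega>|Q. iexp (s * Y \<omega>)) + (CLINT \<omega>|Q. of_real (V \<omega>) * iexp (s * Y \<omega>))) / c"
        using iexpQ[of s] iVexp[of s] by simp
      finally show ?thesis .
    qed
    ultimately show "char (distr (density P p) borel X) = char (distr (density Q q) borel Y)"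
      using ch wch by auto
  qed
  then have "(LINT x|distr (density P p) borel X. indicator B x :: real)
      = (LINT x|distr (density Q q) borel Y. indicator B x)" by simp
  then have 1: "(LINT \<omega>|P. p \<omega> * indicator B (X \<omega>)) = (LINT \<omega>|Q. q \<omega> * indicator B (Y \<omega>))"
    by (subst (asm) (1 2) integral_distr) (auto simp: integral_density p0 q0)
  \<comment> \<open>The offset 2 in the densities contributes twice the unweighted probability of
    \<open>B\<close>. That part must be known to agree as well before it can be subtracted.\<close>
  have "distr P borel X = distr Q borel Y"
  proof (rule Levy_uniqueness)
    show "char (distr P borel X) = char (distr Q borel Y)"
      using ch by (auto simp: char_def integral_distr)
  qed auto
  then have "(LINT x|distr P borel X. indicator B x :: real) = (LINT x|distr Q borel Y. indicator B x)" by simp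
  then have 2: "(LINT \<omega>|P. indicator B (X \<omega>) :: real) = (LINT \<omega>|Q. indicator B (Y \<omega>))"
    by (subst (asm) (1 2) integral_distr) auto
  have i1: "integrable P (\<lambda>\<omega>. indicator B (X \<omega>) :: real)" "integrable P (\<lambda>\<omega>. p \<omega> * indicator B (X \<omega>))"
    by (rule P.integrable_const_bound[of _ 1], auto simp: indicator_def)
       (rule Bochner_Integration.integrable_bound[OF ip], auto simp: indicator_def)
  have i2: "integrable Q (\<lambda>\<omega>. indicator B (Y \<omega>) :: real)" "integrable Q (\<lambda>\<omega>. q \<omega> * indicator B (Y \<omega>))"
    by (rule Q.integrable_const_bound[of _ 1], auto simp: indicator_def)
       (rule Bochner_Integration.integrable_bound[OF iq], auto simp: indicator_def)
  have "(LINT \<omega>|P. U \<omega> * indicator B (X \<omega>))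
      = (LINT \<omega>|P. c * (p \<omega> * indicator B (X \<omega>)) - 2 * indicator B (X \<omega>))"
    using c by (intro Bochner_Integration.integral_cong refl) (simp add: p_def field_simps)
  also have "\<dots> = (LINT \<omega>|Q. c * (q \<omega> * indicator B (Y \<omega>)) - 2 * indicator B (Y \<omega>))"
    using i1 i2 1 2 by simp
  also have "\<dots> = (LINT \<omega>|Q. V \<omega> * indicator B (Y \<omega>))"
    using c by (intro Bochner_Integration.integral_cong refl) (simp add: q_def field_simps)
  finally show ?thesis .
qed

lemma iexp_add: "iexp (x + y) = iexp x * iexp y"
  by (simp add: exp_add[symmetric] algebra_simps)

lemma iexp_cos_sin: "iexp x = of_real (cos x) + \<i> * of_real (sin x)"
  by (simp add: exp_Euler cos_of_real sin_of_real)

text \<open>Frequencies are traded for indicators one coordinate at a time.\<close>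

lemma mixed_char_eq:
  fixes X :: "'i \<Rightarrow> 'a \<Rightarrow> real" and Y :: "'i \<Rightarrow> 'b \<Rightarrow> real"
  assumes "prob_space P" "prob_space Q" "finite I"
    and X: "\<And>i. i \<in> I \<Longrightarrow> X i \<in> borel_measurable P"
    and Y: "\<And>i. i \<in> I \<Longrightarrow> Y i \<in> borel_measurable Q"
    and ch: "\<And>a. (CLINT \<omega>|P. iexp (\<Sum>i\<in>I. a i * X i \<omega>)) = (CLINT \<omega>|Q. iexp (\<Sum>i\<in>I. a i * Y i \<omega>))"
    and B: "\<And>i. i \<in> I \<Longrightarrow> B i \<in> sets borel"
    and "J \<subseteq> I"
  shows "(CLINT \<omega>|P. of_real (\<Prod>j\<in>J. indicator (B j) (X j \<omega>)) * iexp (\<Sum>i\<in>I - J. a i * X i \<omega>))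
       = (CLINT \<omega>|Q. of_real (\<Prod>j\<in>J. indicator (B j) (Y j \<omega>)) * iexp (\<Sum>i\<in>I - J. a i * Y i \<omega>))"
proof -
  interpret P: prob_space P by fact
  interpret Q: prob_space Q by fact
  have "finite J" using \<open>J \<subseteq> I\<close> \<open>finite I\<close> by (rule finite_subset)
  then show ?thesis using \<open>J \<subseteq> I\<close>
  proof (induction J arbitrary: a rule: finite_induct)
    case empty
    then show ?case using ch[of a] by simp
  next
    case (insert k J)
    then have k: "k \<in> I" and J: "J \<subseteq> I" by auto
    have [measurable]: "X k \<in> borel_measurable P" "Y k \<in> borel_measurable Q" "B k \<in> sets borel"
      using X Y B k by auto
    have [measurable]: "j \<in> J \<Longrightarrow> X j \<in> borel_measurable P" "j \<in> J \<Longrightarrow> Y j \<in> borel_measurable Q" 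
       "j \<in> J \<Longrightarrow> B j \<in> sets borel" for j
      using X Y B J by auto
    define D where "D = (\<lambda>\<omega>. \<Prod>j\<in>J. indicator (B j) (X j \<omega>) :: real)"
    define E where "E = (\<lambda>\<omega>. \<Prod>j\<in>J. indicator (B j) (Y j \<omega>) :: real)"
    define t where "t = (\<lambda>\<omega>. \<Sum>i\<in>I - insert k J. a i * X i \<omega>)"
    define u where "u = (\<lambda>\<omega>. \<Sum>i\<in>I - insert k J. a i * Y i \<omega>)"
    have [measurable]: "D \<in> borel_measurable P" "E \<in> borel_measurable Q"
      unfolding D_def E_def by (auto intro!: borel_measurable_prod simp del: borel_measurable_indicator_iff)
    have [measurable]: "t \<in> borel_measurable P" "u \<in> borel_measurable Q"
      unfolding t_def u_def using X Y by (auto intro!: borel_measurable_sum)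
    have D: "\<bar>D \<omega>\<bar> \<le> 1" for \<omega> unfolding D_def abs_prod
      by (rule prod_le_1) (auto simp: indicator_def)
    have E: "\<bar>E \<omega>\<bar> \<le> 1" for \<omega> unfolding E_def abs_prod
      by (rule prod_le_1) (auto simp: indicator_def)
    have split: "I - J = insert k (I - insert k J)" "k \<notin> I - insert k J" using insert k by auto
    have sumX: "(\<Sum>i\<in>I - J. (a'(k := s)) i * X i \<omega>) = s * X k \<omega> + (\<Sum>i\<in>I - insert k J. a' i * X i \<omega>)" for a' s \<omega>
      unfolding split(1) using \<open>finite I\<close> by (subst sum.insert) (auto intro!: sum.cong)
    have sumY: "(\<Sum>i\<in>I - J. (a'(k := s)) i * Y i \<omega>) = s * Y k \<omega> + (\<Sum>i\<in>I - insert k J. a' i * Y i \<omega>)" for a' s \<omega>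
      unfolding split(1) using \<open>finite I\<close> by (subst sum.insert) (auto intro!: sum.cong)
    \<comment> \<open>The frequencies off \<open>k\<close> are taken once with each sign. Half-sum
      and half-difference replace the complex factor \<open>iexp (t \<omega>)\<close> by the weights
      \<open>D * cos t\<close> and \<open>D * sin t\<close>, which are real and bounded by one, as
      weighted uniqueness requires.\<close>
    have pos: "(CLINT \<omega>|P. of_real (D \<omega>) * iexp (s * X k \<omega> + t \<omega>))
        = (CLINT \<omega>|Q. of_real (E \<omega>) * iexp (s * Y k \<omega> + u \<omega>))" for s
      using insert.IH[OF J, of "a(k := s)"] unfolding sumX sumY D_def E_def t_def u_def .
    have neg: "(CLINT \<omega>|P. of_real (D \<omega>) * iexp (s * X k \<omega> - t \<omega>))
        = (CLINT \<omega>|Q. of_real (E \<omega>) * iexp (s * Y k \<omega> - u \<omega>))" for s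
      using insert.IH[OF J, of "(\<lambda>i. - a i)(k := s)"]
      unfolding sumX sumY D_def E_def t_def u_def by (simp add: sum_negf)
    have ch1: "(CLINT \<omega>|P. iexp (s * X k \<omega>)) = (CLINT \<omega>|Q. iexp (s * Y k \<omega>))" for s
    proof -
      have *: "(\<Sum>i\<in>I. (if i = k then s else 0) * Z i) = s * Z k" for Z :: "'i \<Rightarrow> real"
        using \<open>finite I\<close> k by (simp add: if_distrib[where f="\<lambda>x. x * _"] sum.delta' cong: if_cong)
      show ?thesis using ch[of "\<lambda>i. if i = k then s else 0"] unfolding * .
    qed
    have iP: "integrable P (\<lambda>\<omega>. of_real (D \<omega>) * iexp (s * X k \<omega> + t \<omega>))"
      "integrable P (\<lambda>\<omega>. of_real (D \<omega>) * iexp (s * X k \<omega> - t \<omega>))" for s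
      by (rule P.integrable_const_bound[of _ 1], use D in \<open>auto simp: norm_mult\<close>)+
    have iQ: "integrable Q (\<lambda>\<omega>. of_real (E \<omega>) * iexp (s * Y k \<omega> + u \<omega>))"
      "integrable Q (\<lambda>\<omega>. of_real (E \<omega>) * iexp (s * Y k \<omega> - u \<omega>))" for s
      by (rule Q.integrable_const_bound[of _ 1], use E in \<open>auto simp: norm_mult\<close>)+
    have cosid: "of_real (d * cos v) * iexp x = (of_real d * iexp (x + v) + of_real d * iexp (x - v)) / 2" for d v x
    proof -
      have "iexp (x + v) + iexp (x - v) = 2 * of_real (cos v) * iexp x"
        unfolding diff_conv_add_uminus iexp_add iexp_cos_sin[of v] iexp_cos_sin[of "-v"]
        by (simp add: algebra_simps)
      then show ?thesis by (simp add: distrib_left[symmetric])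
    qed
    have sinid: "of_real (d * sin v) * iexp x = (of_real d * iexp (x + v) - of_real d * iexp (x - v)) / (2 * \<i>)" for d v x
    proof -
      have "iexp (x + v) - iexp (x - v) = 2 * \<i> * of_real (sin v) * iexp x"
        unfolding diff_conv_add_uminus iexp_add iexp_cos_sin[of v] iexp_cos_sin[of "-v"]
        by (simp add: algebra_simps)
      then have "of_real d * iexp (x + v) - of_real d * iexp (x - v) = (2 * \<i>) * (of_real (d * sin v) * iexp x)"
        unfolding right_diff_distrib[symmetric] by simp
      then show ?thesis by (simp only:) simp
    qed
    have 1: "(LINT \<omega>|P. (D \<omega> * cos (t \<omega>)) * indicator (B k) (X k \<omega>))
        = (LINT \<omega>|Q. (E \<omega> * cos (u \<omega>)) * indicator (B k) (Y k \<omega>))"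
    proof (rule weighted_Levy_uniqueness[OF \<open>prob_space P\<close> \<open>prob_space Q\<close>])
      show "\<bar>D \<omega> * cos (t \<omega>)\<bar> \<le> 1" for \<omega> 
        using mult_le_one[OF D _ abs_cos_le_one] by (simp add: abs_mult)
      show "\<bar>E \<omega> * cos (u \<omega>)\<bar> \<le> 1" for \<omega> 
        using mult_le_one[OF E _ abs_cos_le_one] by (simp add: abs_mult)
      show "(CLINT \<omega>|P. of_real (D \<omega> * cos (t \<omega>)) * iexp (s * X k \<omega>))
          = (CLINT \<omega>|Q. of_real (E \<omega> * cos (u \<omega>)) * iexp (s * Y k \<omega>))" for s
        unfolding cosid using pos[of s] neg[of s] iP iQ by (simp del: of_real_add of_real_mult of_real_diff)
    qed (use ch1 in auto)
    have 2: "(LINT \<omega>|P. (D \<omega> * sin (t \<omega>)) * indicator (B k) (X k \<omega>))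
        = (LINT \<omega>|Q. (E \<omega> * sin (u \<omega>)) * indicator (B k) (Y k \<omega>))"
    proof (rule weighted_Levy_uniqueness[OF \<open>prob_space P\<close> \<open>prob_space Q\<close>])
      show "\<bar>D \<omega> * sin (t \<omega>)\<bar> \<le> 1" for \<omega> 
        using mult_le_one[OF D _ abs_sin_le_one] by (simp add: abs_mult)
      show "\<bar>E \<omega> * sin (u \<omega>)\<bar> \<le> 1" for \<omega> 
        using mult_le_one[OF E _ abs_sin_le_one] by (simp add: abs_mult)
      show "(CLINT \<omega>|P. of_real (D \<omega> * sin (t \<omega>)) * iexp (s * X k \<omega>))
          = (CLINT \<omega>|Q. of_real (E \<omega> * sin (u \<omega>)) * iexp (s * Y k \<omega>))" for s
        unfolding sinid using pos[of s] neg[of s] iP iQ by (simp del: of_real_add of_real_mult of_real_diff)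
    qed (use ch1 in auto)
    \<comment> \<open>The cosine and sine integrals reassemble the complex integral, now with
      \<open>k\<close> among the indicators. The space is arbitrary because the identity is used on
      \<open>P\<close> and on \<open>Q\<close>.\<close>
    have fin: "(CLINT \<omega>|M. of_real (\<Prod>j\<in>insert k J. indicator (B j) (Z j \<omega>)) * iexp (v \<omega>))
       = of_real (LINT \<omega>|M. (F \<omega> * cos (v \<omega>)) * indicator (B k) (Z k \<omega>))
        + \<i> * of_real (LINT \<omega>|M. (F \<omega> * sin (v \<omega>)) * indicator (B k) (Z k \<omega>))"
      if [measurable]: "F \<in> borel_measurable M" "v \<in> borel_measurable M" "Z k \<in> borel_measurable M"
       and "prob_space M" and Feq: "F = (\<lambda>\<omega>. \<Prod>j\<in>J. indicator (B j) (Z j \<omega>))" and F: "\<And>\<omega>. \<bar>F \<omega>\<bar> \<le> 1"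
      for M :: "'z measure" and Z F v
    proof -
      interpret M: prob_space M by fact
      have i1: "integrable M (\<lambda>\<omega>. F \<omega> * cos (v \<omega>) * indicator (B k) (Z k \<omega>))"
        by (rule M.integrable_const_bound[of _ 1], use mult_le_one[OF F _ abs_cos_le_one] in \<open>auto simp: indicator_def abs_mult\<close>)
      have i2: "integrable M (\<lambda>\<omega>. F \<omega> * sin (v \<omega>) * indicator (B k) (Z k \<omega>))"
        by (rule M.integrable_const_bound[of _ 1], use mult_le_one[OF F _ abs_sin_le_one] in \<open>auto simp: indicator_def abs_mult\<close>)
      have "(CLINT \<omega>|M. of_real (\<Prod>j\<in>insert k J. indicator (B j) (Z j \<omega>)) * iexp (v \<omega>))
        = (CLINT \<omega>|M. of_real (F \<omega> * cos (v \<omega>) * indicator (B k) (Z k \<omega>))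
            + \<i> * of_real (F \<omega> * sin (v \<omega>) * indicator (B k) (Z k \<omega>)))"
        unfolding iexp_cos_sin using insert(1,2)
        by (intro Bochner_Integration.integral_cong refl) (simp add: Feq algebra_simps)
      also have "\<dots> = of_real (LINT \<omega>|M. (F \<omega> * cos (v \<omega>)) * indicator (B k) (Z k \<omega>))
        + \<i> * of_real (LINT \<omega>|M. (F \<omega> * sin (v \<omega>)) * indicator (B k) (Z k \<omega>))"
        using i1 i2 by (simp del: of_real_mult)
      finally show ?thesis .
    qed
    have "(CLINT \<omega>|P. of_real (\<Prod>j\<in>insert k J. indicator (B j) (X j \<omega>)) * iexp (t \<omega>))
        = (CLINT \<omega>|Q. of_real (\<Prod>j\<in>insert k J. indicator (B j) (Y j \<omega>)) * iexp (u \<omega>))"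
      using fin[of D P t X, OF _ _ _ \<open>prob_space P\<close> D_def D] fin[of E Q u Y, OF _ _ _ \<open>prob_space Q\<close> E_def E] 1 2
      by simp
    then show ?case unfolding t_def u_def .
  qed
qed

text \<open>With \<open>J = I\<close> no frequency is left in \<open>mixed_char_eq\<close>: it
  equates the probabilities of all measurable boxes, which are stable under intersection and
  generate the product sigma-algebra.\<close>

theorem char_determines_distr:
  fixes X :: "'i \<Rightarrow> 'a \<Rightarrow> real" and Y :: "'i \<Rightarrow> 'b \<Rightarrow> real"
  assumes "prob_space P" "prob_space Q" "finite I"
    and X: "\<And>i. i \<in> I \<Longrightarrow> X i \<in> borel_measurable P"
    and Y: "\<And>i. i \<in> I \<Longrightarrow> Y i \<in> borel_measurable Q"
    and ch: "\<And>a. (CLINT \<omega>|P. iexp (\<Sum>i\<in>I. a i * X i \<omega>)) = (CLINT \<omega>|Q. iexp (\<Sum>i\<in>I. a i * Y i \<omega>))"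
  shows "distr P (Pi\<^sub>M I (\<lambda>_. borel)) (\<lambda>\<omega>. \<lambda>i\<in>I. X i \<omega>) = distr Q (Pi\<^sub>M I (\<lambda>_. borel)) (\<lambda>\<omega>. \<lambda>i\<in>I. Y i \<omega>)"
    (is "?L = ?R")
proof -
  interpret P: prob_space P by fact
  interpret Q: prob_space Q by fact
  have [measurable]: "(\<lambda>\<omega>. \<lambda>i\<in>I. X i \<omega>) \<in> measurable P (Pi\<^sub>M I (\<lambda>_. borel))"
    "(\<lambda>\<omega>. \<lambda>i\<in>I. Y i \<omega>) \<in> measurable Q (Pi\<^sub>M I (\<lambda>_. borel))"
    using X Y by (auto intro!: measurable_restrict)
  interpret L: prob_space ?L by (rule P.prob_space_distr) simp
  interpret R: prob_space ?R by (rule Q.prob_space_distr) simp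
  show ?thesis
  proof (rule measure_eqI_PiM_finite[where A="\<lambda>_. space (Pi\<^sub>M I (\<lambda>_. borel))", OF \<open>finite I\<close>])
    fix B :: "'i \<Rightarrow> real set" assume B: "\<And>i. i \<in> I \<Longrightarrow> B i \<in> sets borel"
    have box: "measure (distr M (Pi\<^sub>M I (\<lambda>_. borel)) (\<lambda>\<omega>. \<lambda>i\<in>I. Z i \<omega>)) (Pi\<^sub>E I B)
       = (LINT \<omega>|M. (\<Prod>j\<in>I. indicator (B j) (Z j \<omega>)))"
      if "prob_space M" and Z: "\<And>i. i \<in> I \<Longrightarrow> Z i \<in> borel_measurable M" for M :: "'z measure" and Z
    proof -
      interpret M: prob_space M by fact
      have [measurable]: "(\<lambda>\<omega>. \<lambda>i\<in>I. Z i \<omega>) \<in> measurable M (Pi\<^sub>M I (\<lambda>_. borel))"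
        using Z by (auto intro!: measurable_restrict)
      have [measurable]: "Pi\<^sub>E I B \<in> sets (Pi\<^sub>M I (\<lambda>_. borel))"
        using B \<open>finite I\<close> by (auto intro!: sets_PiM_I_finite)
      have "measure (distr M (Pi\<^sub>M I (\<lambda>_. borel)) (\<lambda>\<omega>. \<lambda>i\<in>I. Z i \<omega>)) (Pi\<^sub>E I B)
        = (LINT x|distr M (Pi\<^sub>M I (\<lambda>_. borel)) (\<lambda>\<omega>. \<lambda>i\<in>I. Z i \<omega>). indicator (Pi\<^sub>E I B) x)"
        by (subst Bochner_Integration.integral_indicator)
           (auto simp: space_PiM Int_absorb2 PiE_mono)
      also have "\<dots> = (LINT \<omega>|M. indicator (Pi\<^sub>E I B) (\<lambda>i\<in>I. Z i \<omega>))"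
        by (subst integral_distr) auto
      also have "\<dots> = (LINT \<omega>|M. (\<Prod>j\<in>I. indicator (B j) (Z j \<omega>)))"
        using \<open>finite I\<close> by (intro Bochner_Integration.integral_cong refl) (auto simp: indicator_def PiE_iff prod_zero_iff)
      finally show ?thesis .
    qed
    have "complex_of_real (LINT \<omega>|P. (\<Prod>j\<in>I. indicator (B j) (X j \<omega>)))
        = complex_of_real (LINT \<omega>|Q. (\<Prod>j\<in>I. indicator (B j) (Y j \<omega>)))"
      using mixed_char_eq[OF assms(1-3) X Y ch B subset_refl] 
      by (simp add: integral_complex_of_real[symmetric] del: of_real_prod integral_complex_of_real)
    then have "measure ?L (Pi\<^sub>E I B) = measure ?R (Pi\<^sub>E I B)"
      using box[OF \<open>prob_space P\<close> X] box[OF \<open>prob_space Q\<close> Y] by simp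
    then show "emeasure ?L (Pi\<^sub>E I B) = emeasure ?R (Pi\<^sub>E I B)"
      by (simp add: L.emeasure_eq_measure R.emeasure_eq_measure)
  next
    show "range (\<lambda>_::nat. space (Pi\<^sub>M I (\<lambda>_. borel))) \<subseteq> prod_algebra I (\<lambda>_. borel :: real measure)"
      by (auto simp: space_PiM intro!: prod_algebraI_finite \<open>finite I\<close>)
    show "emeasure ?L (space (Pi\<^sub>M I (\<lambda>_. borel))) \<noteq> \<infinity>" for i :: nat
      using L.emeasure_finite by auto
  qed auto
qed

section \<open>Gaussian vectors\<close>

text \<open>Parametrised by the variance and defined as an image measure, so that
  \<open>v = 0\<close> is the point mass at 0 and degenerate vectors need no separate treatment. For
  negative \<open>v\<close> the root is negative and the law has variance \<open>- v\<close>, hence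
  the hypothesis \<open>0 \<le> v\<close> below.\<close>

definition gauss_law :: "real \<Rightarrow> real measure" where
  "gauss_law v = distr std_normal_distribution borel (\<lambda>x. sqrt v * x)"

lemma real_distribution_gauss_law: "real_distribution (gauss_law v)"
proof -
  interpret real_distribution std_normal_distribution by (rule real_dist_normal_dist)
  show ?thesis unfolding gauss_law_def by (rule real_distribution_distr) simp
qed

text \<open>Completing the square turns the tilted density into \<open>exp (t\<^sup>2 / 2)\<close>
  times the normal density with mean \<open>t\<close>.\<close>

lemma std_normal_exp:
  "has_bochner_integral std_normal_distribution (\<lambda>x. exp (t * x)) (exp (t\<^sup>2 / 2))"
proof -
  have eq: "std_normal_density x *\<^sub>R exp (t * x) = exp (t\<^sup>2 / 2) * normal_density t 1 x" for x
    by (simp add: normal_density_def exp_add[symmetric] power2_eq_square field_simps)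
  have "has_bochner_integral lborel (normal_density t 1) 1"
    by (simp add: has_bochner_integral_iff integrable_normal_density integral_normal_density)
  then have "has_bochner_integral lborel (\<lambda>x. exp (t\<^sup>2 / 2) * normal_density t 1 x) (exp (t\<^sup>2 / 2) * 1)"
    by (rule has_bochner_integral_mult_right)
  then have "has_bochner_integral lborel (\<lambda>x. std_normal_density x *\<^sub>R exp (t * x)) (exp (t\<^sup>2 / 2))"
    by (simp only: eq mult_1_right)
  then show ?thesis
    by (subst has_bochner_integral_density) auto
qed

lemma gauss_law_exp:
  assumes "0 \<le> v"
  shows "has_bochner_integral (gauss_law v) (\<lambda>x. exp (t * x)) (exp (t\<^sup>2 * v / 2))"
  using std_normal_exp[of "t * sqrt v"] assms
  by (simp add: gauss_law_def has_bochner_integral_iff integrable_distr_eq integral_distr mult.assoc power_mult_distrib)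

lemma char_gauss_law:
  assumes "0 \<le> v"
  shows "char (gauss_law v) s = of_real (exp (- (s\<^sup>2 * v / 2)))"
proof -
  have "char (gauss_law v) s = char std_normal_distribution (s * sqrt v)"
    by (simp add: gauss_law_def char_def integral_distr mult.assoc)
  then show ?thesis
    using assms by (simp add: char_std_normal_distribution power_mult_distrib)
qed

lemma gauss_law_square:
  assumes "0 \<le> v"
  shows "has_bochner_integral (gauss_law v) (\<lambda>x. x\<^sup>2) v"
proof -
  have "has_bochner_integral std_normal_distribution (\<lambda>x. v * x\<^sup>2) (v * 1)"
    using std_normal_distribution_even_moments[of 1]
    by (intro has_bochner_integral_mult_right) (simp add: has_bochner_integral_iff)
  then show ?thesis
    using assms
    by (simp add: gauss_law_def has_bochner_integral_iff integrable_distr_eq integral_distr power_mult_distrib)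
qed

text \<open>Both alternatives in the definition of a centred Gaussian variable are some
  \<open>gauss_law v\<close>, with \<open>v\<close> zero or the square of \<sigma>. The second
  moment then identifies \<open>v\<close>, which links the law to the covariance kernel.\<close>

lemma centred_gaussian_rv_law:
  assumes "prob_space P" "centred_gaussian_rv P X"
  shows "integrable P (\<lambda>\<omega>. (X \<omega>)\<^sup>2)"
    and "distr P borel X = gauss_law (LINT \<omega>|P. (X \<omega>)\<^sup>2)"
proof -
  interpret prob_space P by fact
  have [measurable]: "X \<in> borel_measurable P"
    using assms by (simp add: centred_gaussian_rv_def)
  have "\<exists>v\<ge>0. distr P borel X = gauss_law v"
    using assms(2) unfolding centred_gaussian_rv_def
  proof (elim conjE disjE exE)
    assume 0: "distr P borel X = return borel 0"
    interpret N: real_distribution std_normal_distribution by (rule real_dist_normal_dist)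
    have "gauss_law 0 = return borel 0"
      unfolding gauss_law_def real_sqrt_zero mult_zero_left by (rule N.distr_const) simp
    then show ?thesis using 0 by (intro exI[of _ 0]) simp
  next
    fix \<sigma> :: real assume \<sigma>: "\<sigma> > 0" and d: "distributed P lborel X (normal_density 0 \<sigma>)"
    interpret N: prob_space std_normal_distribution by (rule prob_space_normal_density) simp
    have "distributed std_normal_distribution lborel (\<lambda>x. x) std_normal_density"
      by (auto simp: distributed_def distr_id2)
    then have "distributed std_normal_distribution lborel (\<lambda>x. 0 + \<sigma> * x) (normal_density (0 + \<sigma> * 0) (\<bar>\<sigma>\<bar> * 1))"
      using \<sigma> by (intro N.normal_density_affine) auto
    then have "distr std_normal_distribution lborel (\<lambda>x. \<sigma> * x) = density lborel (normal_density 0 \<sigma>)"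
      using \<sigma> by (simp add: distributed_def)
    moreover have "distr P lborel X = density lborel (normal_density 0 \<sigma>)"
      using d by (simp add: distributed_def)
    moreover have "distr P lborel X = distr P borel X"
      "distr std_normal_distribution lborel (\<lambda>x. \<sigma> * x) = distr std_normal_distribution borel (\<lambda>x. \<sigma> * x)"
      by (auto intro!: distr_cong)
    ultimately have "distr P borel X = gauss_law (\<sigma>\<^sup>2)"
      using \<sigma> by (simp add: gauss_law_def)
    then show ?thesis by (intro exI[of _ "\<sigma>\<^sup>2"]) simp
  qed
  then obtain v where v: "v \<ge> 0" "distr P borel X = gauss_law v" by blast
  have h: "has_bochner_integral (distr P borel X) (\<lambda>x. x\<^sup>2) v"
    using gauss_law_square[OF v(1)] v(2) by simp
  then show "integrable P (\<lambda>\<omega>. (X \<omega>)\<^sup>2)"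
    by (simp add: has_bochner_integral_iff integrable_distr_eq)
  show "distr P borel X = gauss_law (LINT \<omega>|P. (X \<omega>)\<^sup>2)"
  proof -
    have "v = (LINT x|distr P borel X. x\<^sup>2)" using h by (simp add: has_bochner_integral_iff)
    also have "\<dots> = (LINT \<omega>|P. (X \<omega>)\<^sup>2)" by (rule integral_distr) auto
    finally show ?thesis using v(2) by simp
  qed
qed

section \<open>Gaussian vectors described by their linear combinations\<close>

definition quad_form :: "'i set \<Rightarrow> ('i \<Rightarrow> 'i \<Rightarrow> real) \<Rightarrow> ('i \<Rightarrow> real) \<Rightarrow> real" where
  "quad_form I A a = (\<Sum>i\<in>I. \<Sum>j\<in>I. a i * a j * A i j)"

text \<open>Joint normality is expressed by the laws of all linear combinations. Only the symmetric
  part of \<open>A\<close> is determined in this way, so symmetry is a separate hypothesis where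
  single off-diagonal entries matter. Nonnegativity of the form is recorded so that
  \<open>gauss_law\<close> has the intended variance.\<close>

definition gaussian_vector ::
    "'a measure \<Rightarrow> 'i set \<Rightarrow> ('i \<Rightarrow> 'a \<Rightarrow> real) \<Rightarrow> ('i \<Rightarrow> 'i \<Rightarrow> real) \<Rightarrow> bool" where
  "gaussian_vector P I X A \<longleftrightarrow> prob_space P \<and> finite I \<and> (\<forall>i\<in>I. X i \<in> borel_measurable P) \<and>
     (\<forall>a. 0 \<le> quad_form I A a \<and> distr P borel (\<lambda>\<omega>. \<Sum>i\<in>I. a i * X i \<omega>) = gauss_law (quad_form I A a))"

lemma gaussian_vectorD:
  assumes "gaussian_vector P I X A"
  shows "prob_space P" "finite I" "i \<in> I \<Longrightarrow> X i \<in> borel_measurable P"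
    "0 \<le> quad_form I A a" "distr P borel (\<lambda>\<omega>. \<Sum>i\<in>I. a i * X i \<omega>) = gauss_law (quad_form I A a)"
  using assms by (auto simp: gaussian_vector_def)

lemma gaussian_vector_measurable_sum:
  assumes "gaussian_vector P I X A"
  shows "(\<lambda>\<omega>. \<Sum>i\<in>I. a i * X i \<omega>) \<in> borel_measurable P"
  using gaussian_vectorD(3)[OF assms] by (intro borel_measurable_sum) auto

lemma gaussian_vector_exp:
  assumes "gaussian_vector P I X A"
  shows "has_bochner_integral P (\<lambda>\<omega>. exp (\<Sum>i\<in>I. a i * X i \<omega>)) (exp (quad_form I A a / 2))"
proof -
  note [measurable] = gaussian_vector_measurable_sum[OF assms]
  show ?thesis
    using gauss_law_exp[OF gaussian_vectorD(4)[OF assms], of a 1]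
    unfolding gaussian_vectorD(5)[OF assms, symmetric]
    by (simp add: has_bochner_integral_iff integrable_distr_eq integral_distr)
qed

lemma gaussian_vector_char:
  assumes "gaussian_vector P I X A"
  shows "(CLINT \<omega>|P. iexp (\<Sum>i\<in>I. a i * X i \<omega>)) = of_real (exp (- (quad_form I A a / 2)))"
proof -
  note [measurable] = gaussian_vector_measurable_sum[OF assms]
  show ?thesis
    using char_gauss_law[OF gaussian_vectorD(4)[OF assms], of a 1]
    unfolding gaussian_vectorD(5)[OF assms, symmetric] char_def
    by (subst (asm) integral_distr) auto
qed

lemma quad_form_scale: "quad_form I A (\<lambda>i. s * a i) = s\<^sup>2 * quad_form I A a"
  by (simp add: quad_form_def sum_distrib_left power2_eq_square mult_ac)

text \<open>Frequency one suffices: any other frequency is absorbed into the coefficients, and the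
  quadratic form scales by its square.\<close>

lemma gaussian_vectorI_char:
  assumes "prob_space P" "finite I" and X: "\<And>i. i \<in> I \<Longrightarrow> X i \<in> borel_measurable P"
    and q: "\<And>a. 0 \<le> quad_form I A a"
    and ch: "\<And>a. (CLINT \<omega>|P. iexp (\<Sum>i\<in>I. a i * X i \<omega>)) = of_real (exp (- (quad_form I A a / 2)))"
  shows "gaussian_vector P I X A"
proof -
  interpret prob_space P by fact
  have "distr P borel (\<lambda>\<omega>. \<Sum>i\<in>I. a i * X i \<omega>) = gauss_law (quad_form I A a)" for a
  proof (rule Levy_uniqueness[OF _ real_distribution_gauss_law])
    have [measurable]: "(\<lambda>\<omega>. \<Sum>i\<in>I. a i * X i \<omega>) \<in> borel_measurable P"
      using X by (intro borel_measurable_sum) auto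
    show "real_distribution (distr P borel (\<lambda>\<omega>. \<Sum>i\<in>I. a i * X i \<omega>))" by simp
    show "char (distr P borel (\<lambda>\<omega>. \<Sum>i\<in>I. a i * X i \<omega>)) = char (gauss_law (quad_form I A a))"
    proof
      fix s :: real
      have "char (distr P borel (\<lambda>\<omega>. \<Sum>i\<in>I. a i * X i \<omega>)) s = (CLINT \<omega>|P. iexp (s * (\<Sum>i\<in>I. a i * X i \<omega>)))"
        unfolding char_def by (subst integral_distr) auto
      also have "\<dots> = (CLINT \<omega>|P. iexp (\<Sum>i\<in>I. (s * a i) * X i \<omega>))"
        by (simp add: sum_distrib_left mult.assoc)
      also have "\<dots> = char (gauss_law (quad_form I A a)) s"
        unfolding ch char_gauss_law[OF q] quad_form_scale ..
      finally show "char (distr P borel (\<lambda>\<omega>. \<Sum>i\<in>I. a i * X i \<omega>)) s = char (gauss_law (quad_form I A a)) s" .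
    qed
  qed
  then show ?thesis using assms by (auto simp: gaussian_vector_def)
qed

lemma gaussian_vector_scale:
  assumes "gaussian_vector P I X A"
  shows "gaussian_vector P I (\<lambda>i \<omega>. c * X i \<omega>) (\<lambda>i j. c\<^sup>2 * A i j)"
proof -
  have "quad_form I (\<lambda>i j. c\<^sup>2 * A i j) a = quad_form I A (\<lambda>i. a i * c)" for a
    by (simp add: quad_form_def power2_eq_square mult_ac)
  moreover have "(\<lambda>\<omega>. \<Sum>i\<in>I. a i * (c * X i \<omega>)) = (\<lambda>\<omega>. \<Sum>i\<in>I. (a i * c) * X i \<omega>)" for a
    by (simp add: mult_ac)
  ultimately show ?thesis
    using gaussian_vectorD[OF assms] by (auto simp: gaussian_vector_def)
qed

text \<open>Independence is realised by the product space, on which Fubini factorises the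
  characteristic function, so the quadratic forms add up.\<close>

lemma gaussian_vector_add:
  assumes gX: "gaussian_vector P I X A" and gY: "gaussian_vector Q I Y B"
  shows "gaussian_vector (P \<Otimes>\<^sub>M Q) I (\<lambda>i (\<omega>, \<omega>'). X i \<omega> + Y i \<omega>') (\<lambda>i j. A i j + B i j)"
proof (rule gaussian_vectorI_char)
  interpret P: prob_space P by (rule gaussian_vectorD[OF gX])
  interpret Q: prob_space Q by (rule gaussian_vectorD[OF gY])
  interpret PQ: pair_prob_space P Q ..
  show "prob_space (P \<Otimes>\<^sub>M Q)" by (rule PQ.prob_space_axioms)
  show "finite I" by (rule gaussian_vectorD[OF gX])
  show "(\<lambda>(\<omega>, \<omega>'). X i \<omega> + Y i \<omega>') \<in> borel_measurable (P \<Otimes>\<^sub>M Q)" if "i \<in> I" for i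
  proof -
    have [measurable]: "X i \<in> borel_measurable P" "Y i \<in> borel_measurable Q"
      using gaussian_vectorD[OF gX] gaussian_vectorD[OF gY] that by auto
    show ?thesis by measurable
  qed
  have q: "quad_form I (\<lambda>i j. A i j + B i j) a = quad_form I A a + quad_form I B a" for a
    by (simp add: quad_form_def sum.distrib distrib_left)
  show "0 \<le> quad_form I (\<lambda>i j. A i j + B i j) a" for a
    unfolding q using gaussian_vectorD(4)[OF gX] gaussian_vectorD(4)[OF gY] by (intro add_nonneg_nonneg)
  show "(CLINT \<omega>|P \<Otimes>\<^sub>M Q. iexp (\<Sum>i\<in>I. a i * (case \<omega> of (\<omega>, \<omega>') \<Rightarrow> X i \<omega> + Y i \<omega>')))
      = of_real (exp (- (quad_form I (\<lambda>i j. A i j + B i j) a / 2)))" for a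
  proof -
    note [measurable] = gaussian_vector_measurable_sum[OF gX, of a] gaussian_vector_measurable_sum[OF gY, of a]
    let ?f = "\<lambda>\<omega>. iexp (\<Sum>i\<in>I. a i * X i \<omega>)" and ?g = "\<lambda>\<omega>. iexp (\<Sum>i\<in>I. a i * Y i \<omega>)"
    have int: "integrable (P \<Otimes>\<^sub>M Q) (\<lambda>(\<omega>, \<omega>'). ?f \<omega> * ?g \<omega>')"
      by (rule PQ.integrable_const_bound[of _ 1]) (auto simp: norm_mult simp del: of_real_sum of_real_mult)
    have "(CLINT \<omega>|P \<Otimes>\<^sub>M Q. iexp (\<Sum>i\<in>I. a i * (case \<omega> of (\<omega>, \<omega>') \<Rightarrow> X i \<omega> + Y i \<omega>')))
      = (CLINT \<omega>|P \<Otimes>\<^sub>M Q. (case \<omega> of (\<omega>, \<omega>') \<Rightarrow> ?f \<omega> * ?g \<omega>'))"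
      unfolding iexp_add[symmetric]
      by (intro Bochner_Integration.integral_cong refl) (auto simp: sum.distrib distrib_left)
    also have "\<dots> = (CLINT \<omega>|P. CLINT \<omega>'|Q. ?f \<omega> * ?g \<omega>')"
      using PQ.integral_fst'[OF int] by simp
    also have "\<dots> = (CLINT \<omega>|P. ?f \<omega>) * (CLINT \<omega>'|Q. ?g \<omega>')"
      by simp
    also have "\<dots> = of_real (exp (- (quad_form I (\<lambda>i j. A i j + B i j) a / 2)))"
      unfolding gaussian_vector_char[OF gX] gaussian_vector_char[OF gY] q of_real_mult[symmetric] exp_add[symmetric]
      by (rule arg_cong[where f="\<lambda>x. of_real (exp x)"]) (simp add: field_simps)
    finally show ?thesis .
  qed
qed

text \<open>Equal covariances give equal characteristic functions, hence equal joint laws. This is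
  the means of changing the probability space during the exchange.\<close>

lemma gaussian_vector_integral_eq:
  fixes \<phi> :: "('i \<Rightarrow> real) \<Rightarrow> real"
  assumes gX: "gaussian_vector P I X A" and gY: "gaussian_vector Q I Y B"
    and AB: "\<And>i j. i \<in> I \<Longrightarrow> j \<in> I \<Longrightarrow> A i j = B i j"
    and [measurable]: "\<phi> \<in> borel_measurable (Pi\<^sub>M I (\<lambda>_. borel))"
  shows "(LINT \<omega>|P. \<phi> (\<lambda>i\<in>I. X i \<omega>)) = (LINT \<omega>|Q. \<phi> (\<lambda>i\<in>I. Y i \<omega>))"
proof -
  have [measurable]: "(\<lambda>\<omega>. \<lambda>i\<in>I. X i \<omega>) \<in> measurable P (Pi\<^sub>M I (\<lambda>_. borel))"
    "(\<lambda>\<omega>. \<lambda>i\<in>I. Y i \<omega>) \<in> measurable Q (Pi\<^sub>M I (\<lambda>_. borel))"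
    using gaussian_vectorD(3)[OF gX] gaussian_vectorD(3)[OF gY] by (auto intro!: measurable_restrict)
  have "quad_form I A a = quad_form I B a" for a
    by (simp add: quad_form_def AB)
  then have "distr P (Pi\<^sub>M I (\<lambda>_. borel)) (\<lambda>\<omega>. \<lambda>i\<in>I. X i \<omega>) = distr Q (Pi\<^sub>M I (\<lambda>_. borel)) (\<lambda>\<omega>. \<lambda>i\<in>I. Y i \<omega>)"
    using gaussian_vectorD(1-3)[OF gX] gaussian_vectorD(1-3)[OF gY]
    by (intro char_determines_distr) (simp_all only: gaussian_vector_char[OF gX] gaussian_vector_char[OF gY])
  then have "(LINT x|distr P (Pi\<^sub>M I (\<lambda>_. borel)) (\<lambda>\<omega>. \<lambda>i\<in>I. X i \<omega>). \<phi> x)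
     = (LINT x|distr Q (Pi\<^sub>M I (\<lambda>_. borel)) (\<lambda>\<omega>. \<lambda>i\<in>I. Y i \<omega>). \<phi> x)" by simp
  then show ?thesis by (simp add: integral_distr)
qed

lemma sum_mult_single:
  fixes t :: real
  assumes "finite I" "i \<in> I"
  shows "(\<Sum>j\<in>I. (if j = i then t else 0) * z j) = t * z i"
proof -
  have "(\<Sum>j\<in>I. (if j = i then t else 0) * z j) = (\<Sum>j\<in>I. if j = i then t * z j else 0)"
    by (intro sum.cong) auto
  then show ?thesis using assms by simp
qed

lemma gaussian_vector_exp_component:
  assumes g: "gaussian_vector P I X A" and i: "i \<in> I"
  shows "has_bochner_integral P (\<lambda>\<omega>. exp (t * X i \<omega>)) (exp (t\<^sup>2 * A i i / 2))"
    and "0 \<le> A i i" and "distr P borel (X i) = gauss_law (A i i)"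
proof -
  have s: "(\<Sum>j\<in>I. (if j = i then t else 0) * z j) = t * z i" for z and t :: real
    using gaussian_vectorD(2)[OF g] i by (rule sum_mult_single)
  have q: "quad_form I A (\<lambda>j. if j = i then t else 0) = t\<^sup>2 * A i i" for t
    unfolding quad_form_def mult.assoc sum_distrib_left[symmetric] s
    by (simp add: power2_eq_square)
  show "has_bochner_integral P (\<lambda>\<omega>. exp (t * X i \<omega>)) (exp (t\<^sup>2 * A i i / 2))"
    using gaussian_vector_exp[OF g, of "\<lambda>j. if j = i then t else 0"] unfolding q s .
  show "0 \<le> A i i" using gaussian_vectorD(4)[OF g, of "\<lambda>j. if j = i then 1 else 0"] q[of 1] by simp
  show "distr P borel (X i) = gauss_law (A i i)"
    using gaussian_vectorD(5)[OF g, of "\<lambda>j. if j = i then 1 else 0"] unfolding q s by simp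
qed

text \<open>The sum of the two components has variance \<open>A i i + 2 * A i j + A j j\<close>, and
  the normalisation cancels the diagonal terms. Adding two indicators in the coefficient vector
  covers \<open>i = j\<close> too.\<close>

lemma gaussian_vector_exp_pair:
  assumes g: "gaussian_vector P I X A" and i: "i \<in> I" and j: "j \<in> I" and sym: "A i j = A j i"
  shows "has_bochner_integral P (\<lambda>\<omega>. exp (X i \<omega> - A i i / 2) * exp (X j \<omega> - A j j / 2)) (exp (A i j))"
proof -
  let ?a = "\<lambda>k. (if k = i then 1 else 0) + (if k = j then 1 else 0) :: real"
  have s: "(\<Sum>k\<in>I. ?a k * z k) = z i + z j" for z
    using gaussian_vectorD(2)[OF g] i j
    by (simp only: distrib_right sum.distrib sum_mult_single mult_1)
  have q: "quad_form I A ?a = A i i + A i j + A j i + A j j"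
    unfolding quad_form_def mult.assoc sum_distrib_left[symmetric] s by simp
  have "has_bochner_integral P (\<lambda>\<omega>. exp (- (A i i + A j j) / 2) * exp (X i \<omega> + X j \<omega>))
     (exp (- (A i i + A j j) / 2) * exp ((A i i + A i j + A j i + A j j) / 2))"
    using gaussian_vector_exp[OF g, of ?a] unfolding q s by (rule has_bochner_integral_mult_right)
  moreover have "exp (- (A i i + A j j) / 2) * exp (x + y) = exp (x - A i i / 2) * exp (y - A j j / 2)" for x y
    unfolding exp_add[symmetric] by (rule arg_cong[where f=exp]) (simp add: field_simps)
  moreover have "exp (- (A i i + A j j) / 2) * exp ((A i i + A i j + A j i + A j j) / 2) = exp (A i j)"
    unfolding exp_add[symmetric] by (rule arg_cong[where f=exp]) (simp add: sym field_simps)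
  ultimately show ?thesis by simp
qed

text \<open>Sampled points may coincide, whereas the field is specified on finite sets of points;
  the coefficients of equal points are therefore collected over the fibres of
  \<open>u\<close>.\<close>

lemma gaussian_field_sample:
  assumes f: "centred_gaussian_field P D \<Gamma>" and "finite I" and u: "\<And>i. i \<in> I \<Longrightarrow> u i \<in> D"
  shows "gaussian_vector P I (\<lambda>i \<omega>. \<gamma> * \<Gamma> (u i) \<omega>) (\<lambda>i j. \<gamma>\<^sup>2 * covariance_kernel P \<Gamma> (u i) (u j))"
proof (rule gaussian_vector_scale)
  interpret prob_space P using f by (simp add: centred_gaussian_field_def)
  have rv: "centred_gaussian_rv P (\<lambda>\<omega>. \<Sum>i\<in>I. a i * \<Gamma> (u i) \<omega>)" for a
  proof -
    have "(\<Sum>i\<in>I. a i * \<Gamma> (u i) \<omega>) = (\<Sum>z\<in>u ` I. (\<Sum>i\<in>{i\<in>I. u i = z}. a i) * \<Gamma> z \<omega>)" for \<omega>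
      by (subst sum.image_gen[OF \<open>finite I\<close>, of _ u]) (auto intro!: sum.cong simp: sum_distrib_right)
    then have "(\<lambda>\<omega>. \<Sum>i\<in>I. a i * \<Gamma> (u i) \<omega>)
        = (\<lambda>\<omega>. \<Sum>z\<in>u ` I. (\<lambda>z. \<Sum>i\<in>{i\<in>I. u i = z}. a i) z * \<Gamma> z \<omega>)"
      by (rule ext)
    moreover have "finite (u ` I) \<and> u ` I \<subseteq> D" using u \<open>finite I\<close> by auto
    then have "centred_gaussian_rv P (\<lambda>\<omega>. \<Sum>z\<in>u ` I. b z * \<Gamma> z \<omega>)" for b
      using f unfolding centred_gaussian_field_def by blast
    ultimately show ?thesis by (simp only:)
  qed
  have rv1: "centred_gaussian_rv P (\<lambda>\<omega>. \<Gamma> (u i) \<omega>)" if "i \<in> I" for i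
    using rv[of "\<lambda>j. if j = i then 1 else 0"] that \<open>finite I\<close>
    by (simp add: sum_mult_single)
  have m: "i \<in> I \<Longrightarrow> \<Gamma> (u i) \<in> borel_measurable P" for i
    using rv1 by (simp add: centred_gaussian_rv_def)
  have prod: "integrable P (\<lambda>\<omega>. \<Gamma> (u i) \<omega> * \<Gamma> (u j) \<omega>)" if "i \<in> I" "j \<in> I" for i j
  proof (rule Bochner_Integration.integrable_bound)
    show "integrable P (\<lambda>\<omega>. (\<Gamma> (u i) \<omega>)\<^sup>2 + (\<Gamma> (u j) \<omega>)\<^sup>2)"
      using centred_gaussian_rv_law(1)[OF prob_space_axioms rv1] that by auto
    have "\<bar>a * b\<bar> \<le> a\<^sup>2 + b\<^sup>2" for a b :: real
    proof -
      have "2 * (\<bar>a\<bar> * \<bar>b\<bar>) \<le> a\<^sup>2 + b\<^sup>2" using sum_squares_bound[of "\<bar>a\<bar>" "\<bar>b\<bar>"] by simp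
      moreover have "0 \<le> \<bar>a\<bar> * \<bar>b\<bar>" by simp
      ultimately show ?thesis unfolding abs_mult by linarith
    qed
    then show "AE \<omega> in P. norm (\<Gamma> (u i) \<omega> * \<Gamma> (u j) \<omega>) \<le> norm ((\<Gamma> (u i) \<omega>)\<^sup>2 + (\<Gamma> (u j) \<omega>)\<^sup>2)"
      by simp
  qed (use m that in measurable)
  have "(LINT \<omega>|P. (\<Sum>i\<in>I. a i * \<Gamma> (u i) \<omega>)\<^sup>2)
     = quad_form I (\<lambda>i j. covariance_kernel P \<Gamma> (u i) (u j)) a" for a
  proof -
    have "(\<Sum>i\<in>I. a i * \<Gamma> (u i) \<omega>)\<^sup>2 = (\<Sum>i\<in>I. \<Sum>j\<in>I. (a i * a j) * (\<Gamma> (u i) \<omega> * \<Gamma> (u j) \<omega>))" for \<omega>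
      by (simp add: power2_eq_square sum_product mult_ac)
    then show ?thesis
      by (simp add: quad_form_def covariance_kernel_def Bochner_Integration.integral_sum prod)
  qed
  then show "gaussian_vector P I (\<lambda>i. \<Gamma> (u i)) (\<lambda>i j. covariance_kernel P \<Gamma> (u i) (u j))"
    using centred_gaussian_rv_law(2)[OF prob_space_axioms rv] m \<open>finite I\<close> prob_space_axioms
    by (auto simp: gaussian_vector_def simp flip: \<open>\<And>a. _ = quad_form _ _ a\<close>)
qed

section \<open>Lindeberg exchange for finite exponential sums\<close>

text \<open>The summands are Wick exponentials, of mean one when \<open>X\<close> is a Gaussian
  vector with covariance \<open>A\<close>; with weights \<open>p\<close> this is a discretised chaos
  mass.\<close>

definition wick_sum :: "'i set \<Rightarrow> ('i \<Rightarrow> real) \<Rightarrow> ('i \<Rightarrow> 'a \<Rightarrow> real) \<Rightarrow> ('i \<Rightarrow> 'i \<Rightarrow> real) \<Rightarrow> 'a \<Rightarrow> real" where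
  "wick_sum I p X A \<omega> = (\<Sum>i\<in>I. p i * exp (X i \<omega> - A i i / 2))"

lemma abs_exp_minus_one_le: "\<bar>exp y - 1\<bar> \<le> \<bar>y\<bar> * exp \<bar>y\<bar>" for y :: real
proof (cases "y \<ge> 0")
  case True
  have "1 - y \<le> exp (- y)" using exp_ge_add_one_self[of "- y"] by simp
  then have "exp y * (1 - y) \<le> exp y * exp (- y)" by (intro mult_left_mono) auto
  then show ?thesis using True by (simp add: exp_minus algebra_simps)
next
  case False
  have "1 + y \<le> exp y" by (rule exp_ge_add_one_self)
  moreover have "\<bar>y\<bar> * 1 \<le> \<bar>y\<bar> * exp \<bar>y\<bar>" by (intro mult_left_mono) auto
  moreover have "\<bar>exp y - 1\<bar> = 1 - exp y" "\<bar>y\<bar> = - y" using False by auto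
  ultimately show ?thesis by linarith
qed

text \<open>A centred Wick exponential of variance \<open>a\<close> is of order
  \<open>sqrt a\<close>, so its third absolute moment is of order \<open>a * sqrt a\<close>,
  uniformly for \<open>a\<close> up to \<open>V\<close>. With \<open>a\<close> replaced by a
  fraction \<open>1/m\<close> of it, this is the gain that beats \<open>m\<close>
  repetitions.\<close>

lemma gauss_law_third_moment:
  assumes "0 \<le> V"
  obtains c where "0 \<le> c"
    "\<And>a. 0 \<le> a \<Longrightarrow> a \<le> V \<Longrightarrow> integrable (gauss_law a) (\<lambda>x. \<bar>exp (x - a / 2) - 1\<bar> ^ 3)"
    "\<And>a. 0 \<le> a \<Longrightarrow> a \<le> V \<Longrightarrow> (LINT x|gauss_law a. \<bar>exp (x - a / 2) - 1\<bar> ^ 3) \<le> c * (a * sqrt a)"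
proof -
  define r where "r = sqrt V"
  \<comment> \<open>Three times \<open>1 + r\<close>: the bound below is the cube of
    \<open>exp t * exp (r * t)\<close>, where \<open>exp t\<close> dominates the factor
    \<open>t\<close> and \<open>exp (r * t)\<close> dominates
    \<open>exp \<bar>y\<bar>\<close>.\<close>
  define k where "k = 3 + 3 * r"
  \<comment> \<open>The factor \<open>exp (k * r)\<close> comes from
    \<open>t = \<bar>x\<bar> + r\<close>; the rest is the standard normal mean of
    \<open>exp (k * x) + exp (- k * x)\<close>.\<close>
  define c where "c = exp (k * r) * (2 * exp (k\<^sup>2 / 2))"
  have r0: "r \<ge> 0" using assms by (simp add: r_def)
  have bd: "\<bar>exp (sqrt a * x - a / 2) - 1\<bar> ^ 3 \<le> (a * sqrt a) * (exp (k * r) * (exp (k * x) + exp (- k * x)))"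
    if a: "0 \<le> a" "a \<le> V" for a x
  proof -
    define y where "y = sqrt a * x - a / 2"
    define t where "t = \<bar>x\<bar> + r"
    have t0: "t \<ge> 0" using r0 by (simp add: t_def)
    have sr: "sqrt a \<le> r" using a by (simp add: r_def)
    have "a = sqrt a * sqrt a" using a by simp
    also have "\<dots> \<le> sqrt a * r" using sr a by (intro mult_left_mono) auto
    finally have "a / 2 \<le> sqrt a * r" using a by linarith
    moreover have "\<bar>y\<bar> \<le> sqrt a * \<bar>x\<bar> + a / 2"
      using a unfolding y_def by (intro order_trans[OF abs_triangle_ineq4]) (simp add: abs_mult)
    ultimately have y1: "\<bar>y\<bar> \<le> sqrt a * t" by (simp add: t_def algebra_simps)
    also have "\<dots> \<le> r * t" using sr t0 by (intro mult_right_mono)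
    finally have y2: "\<bar>y\<bar> \<le> r * t" .
    have "t \<le> exp t" using exp_ge_add_one_self[of t] by linarith
    have "\<bar>exp y - 1\<bar> \<le> \<bar>y\<bar> * exp \<bar>y\<bar>" by (rule abs_exp_minus_one_le)
    also have "\<dots> \<le> (sqrt a * exp t) * exp (r * t)"
      using y1 y2 \<open>t \<le> exp t\<close> a by (intro mult_mono order_trans[OF y1] mult_left_mono) auto
    also have "\<dots> = sqrt a * exp ((1 + r) * t)" by (simp add: exp_add algebra_simps)
    finally have "\<bar>exp y - 1\<bar> ^ 3 \<le> (sqrt a * exp ((1 + r) * t)) ^ 3" by (intro power_mono) auto
    also have "\<dots> = (a * sqrt a) * exp (k * t)"
    proof -
      have "(sqrt a) ^ 3 = a * sqrt a" using a by (simp add: power3_eq_cube)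
      moreover have "exp ((1 + r) * t) ^ 3 = exp (k * t)"
        unfolding exp_of_nat_mult[symmetric] by (rule arg_cong[where f=exp]) (simp add: k_def algebra_simps)
      ultimately show ?thesis by (simp add: power_mult_distrib)
    qed
    also have "exp (k * t) = exp (k * r) * exp (k * \<bar>x\<bar>)" by (simp add: t_def exp_add algebra_simps)
    also have "exp (k * \<bar>x\<bar>) \<le> exp (k * x) + exp (- k * x)"
      by (cases "x \<ge> 0") (auto simp: add_increasing add_increasing2)
    finally show ?thesis using a unfolding y_def by (simp add: mult_left_mono)
  qed
  have hb: "has_bochner_integral std_normal_distribution
      (\<lambda>x. (a * sqrt a) * (exp (k * r) * (exp (k * x) + exp (- k * x))))
      ((a * sqrt a) * (exp (k * r) * (exp (k\<^sup>2 / 2) + exp ((- k)\<^sup>2 / 2))))" for a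
    by (intro has_bochner_integral_mult_right has_bochner_integral_add std_normal_exp)
  have int: "integrable std_normal_distribution (\<lambda>x. \<bar>exp (sqrt a * x - a / 2) - 1\<bar> ^ 3)" if a: "0 \<le> a" "a \<le> V" for a
    by (rule Bochner_Integration.integrable_bound[OF integrable.intros[OF hb[of a]]])
       (use bd[OF a] in \<open>auto intro: order_trans[OF _ abs_ge_self]\<close>)
  show ?thesis
  proof
    show "0 \<le> c" by (simp add: c_def)
    fix a assume a: "0 \<le> a" "a \<le> V"
    show "integrable (gauss_law a) (\<lambda>x. \<bar>exp (x - a / 2) - 1\<bar> ^ 3)"
      using int[OF a] by (simp add: gauss_law_def integrable_distr_eq)
    have "(LINT x|gauss_law a. \<bar>exp (x - a / 2) - 1\<bar> ^ 3)
        = (LINT x|std_normal_distribution. \<bar>exp (sqrt a * x - a / 2) - 1\<bar> ^ 3)"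
      unfolding gauss_law_def by (rule integral_distr) auto
    also have "\<dots> \<le> (LINT x|std_normal_distribution. (a * sqrt a) * (exp (k * r) * (exp (k * x) + exp (- k * x))))"
      by (rule integral_mono[OF int[OF a] integrable.intros[OF hb]]) (rule bd[OF a])
    also have "\<dots> = c * (a * sqrt a)"
      unfolding has_bochner_integral_integral_eq[OF hb] c_def by simp
    finally show "(LINT x|gauss_law a. \<bar>exp (x - a / 2) - 1\<bar> ^ 3) \<le> c * (a * sqrt a)" .
  qed
qed

text \<open>All \<bar>h i\<bar> are bounded by their maximum, whose cube is one of the terms on the
  right. This crude form of Jensen's inequality suffices because the index set stays fixed during
  the exchange.\<close>

lemma abs_weighted_sum_cube_le:
  fixes q h :: "'i \<Rightarrow> real"
  assumes "finite I" and q: "\<And>i. i \<in> I \<Longrightarrow> 0 \<le> q i"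
  shows "\<bar>\<Sum>i\<in>I. q i * h i\<bar> ^ 3 \<le> (\<Sum>i\<in>I. q i) ^ 3 * (\<Sum>i\<in>I. \<bar>h i\<bar> ^ 3)"
proof (cases "I = {}")
  case False
  define m where "m = Max ((\<lambda>i. \<bar>h i\<bar>) ` I)"
  have "m \<in> (\<lambda>i. \<bar>h i\<bar>) ` I" unfolding m_def using False \<open>finite I\<close> by (intro Max_in) auto
  then obtain k where k: "k \<in> I" "m = \<bar>h k\<bar>" by auto
  have m: "\<bar>h i\<bar> \<le> m" if "i \<in> I" for i unfolding m_def using that \<open>finite I\<close> by auto
  have "\<bar>\<Sum>i\<in>I. q i * h i\<bar> \<le> (\<Sum>i\<in>I. q i * \<bar>h i\<bar>)"
    using q by (intro order_trans[OF sum_abs] sum_mono) (simp add: abs_mult)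
  also have "\<dots> \<le> (\<Sum>i\<in>I. q i * m)" using q m by (intro sum_mono mult_left_mono) auto
  finally have "\<bar>\<Sum>i\<in>I. q i * h i\<bar> \<le> (\<Sum>i\<in>I. q i) * m" by (simp add: sum_distrib_right)
  then have "\<bar>\<Sum>i\<in>I. q i * h i\<bar> ^ 3 \<le> ((\<Sum>i\<in>I. q i) * m) ^ 3" by (intro power_mono) auto
  also have "\<dots> = (\<Sum>i\<in>I. q i) ^ 3 * \<bar>h k\<bar> ^ 3" by (simp add: k power_mult_distrib)
  also have "\<dots> \<le> (\<Sum>i\<in>I. q i) ^ 3 * (\<Sum>i\<in>I. \<bar>h i\<bar> ^ 3)"
    using k \<open>finite I\<close> by (intro mult_left_mono member_le_sum zero_le_power sum_nonneg q) auto
  finally show ?thesis .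
qed simp

section \<open>Smooth convex test functions\<close>

lemma lipschitz_comp_integrable:
  fixes h :: "real \<Rightarrow> real"
  assumes "finite_measure M" "integrable M S" and lip: "\<And>x y. \<bar>h x - h y\<bar> \<le> L * \<bar>x - y\<bar>"
    and [measurable]: "h \<in> borel_measurable borel"
  shows "integrable M (\<lambda>\<omega>. h (S \<omega>))"
proof (rule Bochner_Integration.integrable_bound)
  interpret finite_measure M by fact
  have [measurable]: "S \<in> borel_measurable M" using assms by auto
  show "integrable M (\<lambda>\<omega>. \<bar>h 0\<bar> + L * \<bar>S \<omega>\<bar>)" using assms(2) by simp
  show "(\<lambda>\<omega>. h (S \<omega>)) \<in> borel_measurable M" by measurable
  have "\<bar>h x\<bar> \<le> \<bar>\<bar>h 0\<bar> + L * \<bar>x\<bar>\<bar>" for x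
    using lip[of x 0] by simp
  then show "AE \<omega> in M. norm (h (S \<omega>)) \<le> norm (\<bar>h 0\<bar> + L * \<bar>S \<omega>\<bar>)" by simp
qed

text \<open>A bounded \<open>f'\<close> makes \<open>f\<close> Lipschitz, so \<open>f\<close> of an
  integrable variable is integrable. A Lipschitz \<open>f''\<close> gives a cubic Taylor remainder
  without a third derivative, and it is what twofold averaging of a Lipschitz convex function
  provides.\<close>

locale smooth_convex =
  fixes f f' f'' :: "real \<Rightarrow> real" and L C :: real
  assumes f': "\<And>x. (f has_real_derivative f' x) (at x)"
    and f'': "\<And>x. (f' has_real_derivative f'' x) (at x)"
    and f''_nonneg: "\<And>x. 0 \<le> f'' x"
    and f'_bound: "\<And>x. \<bar>f' x\<bar> \<le> L"
    and f''_lipschitz: "\<And>x y. \<bar>f'' x - f'' y\<bar> \<le> C * \<bar>x - y\<bar>"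
begin

lemma C_nonneg: "0 \<le> C" using f''_lipschitz[of 0 1] by simp

lemma measurable_f [measurable]: "f \<in> borel_measurable borel"
  by (rule borel_measurable_continuous_onI) (meson DERIV_continuous f' continuous_at_imp_continuous_on)

lemma f_lipschitz: "\<bar>f x - f y\<bar> \<le> L * \<bar>x - y\<bar>"
  using field_differentiable_bound[of UNIV f f' L x y] f' f'_bound by (auto intro: DERIV_subset)

lemma integrable_f:
  assumes "finite_measure M" "integrable M S"
  shows "integrable M (\<lambda>\<omega>. f (S \<omega>))"
  by (rule lipschitz_comp_integrable[OF assms f_lipschitz]) simp

text \<open>The second order Lagrange form has \<open>f''\<close> at an intermediate point; moving
  it to \<open>s\<close> costs at most \<open>C * \<bar>h\<bar>\<close>.\<close>

lemma taylor: "\<bar>f (s + h) - f s - f' s * h - f'' s / 2 * h\<^sup>2\<bar> \<le> C / 2 * \<bar>h\<bar> ^ 3"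
proof -
  define d where "d = (\<lambda>(m::nat) t. if m = 0 then f (s + t) else if m = 1 then f' (s + t) else f'' (s + t))"
  have D: "DERIV (\<lambda>t. f (s + t)) t :> f' (s + t)" "DERIV (\<lambda>t. f' (s + t)) t :> f'' (s + t)" for t
    using f'[of "s + t"] f''[of "s + t"] by (auto simp: DERIV_shift add.commute[of s])
  have "\<exists>t. \<bar>t\<bar> \<le> \<bar>h\<bar> \<and> f (s + h) = (\<Sum>m<2. d m 0 / fact m * h ^ m) + d 2 t / fact 2 * h ^ 2"
  proof (rule Maclaurin_bi_le)
    show "d 0 = (\<lambda>t. f (s + t))" by (simp add: d_def)
    show "\<forall>m t. m < 2 \<and> \<bar>t\<bar> \<le> \<bar>h\<bar> \<longrightarrow> DERIV (d m) t :> d (Suc m) t"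
    proof (intro allI impI)
      fix m :: nat and t assume "m < 2 \<and> \<bar>t\<bar> \<le> \<bar>h\<bar>"
      then consider "m = 0" | "m = 1" by linarith
      then show "DERIV (d m) t :> d (Suc m) t" using D[of t] by cases (simp_all add: d_def)
    qed
  qed
  then obtain t where t: "\<bar>t\<bar> \<le> \<bar>h\<bar>" and eq: "f (s + h) = f s + f' s * h + f'' (s + t) / 2 * h\<^sup>2"
    by (auto simp: d_def numeral_2_eq_2)
  have "\<bar>f (s + h) - f s - f' s * h - f'' s / 2 * h\<^sup>2\<bar> = \<bar>f'' (s + t) - f'' s\<bar> / 2 * h\<^sup>2"
    unfolding eq by (simp add: abs_mult[symmetric] left_diff_distrib[symmetric] diff_divide_distrib[symmetric] abs_divide)
      (simp add: abs_mult)
  also have "\<dots> \<le> (C * \<bar>h\<bar>) / 2 * h\<^sup>2"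
    using f''_lipschitz[of "s + t" s] t C_nonneg
    by (intro mult_right_mono divide_right_mono order_trans[OF f''_lipschitz] mult_left_mono) auto
  also have "\<dots> = C / 2 * \<bar>h\<bar> ^ 3" by (simp add: power3_eq_cube power2_eq_square abs_if)
  finally show ?thesis .
qed

end

lemma wick_sum_integrable:
  assumes "gaussian_vector P I X A"
  shows "integrable P (wick_sum I p X A)"
proof -
  have "integrable P (\<lambda>\<omega>. exp (X i \<omega> - A i i / 2))" if "i \<in> I" for i
    using gaussian_vector_exp_component(1)[OF assms that, of 1] 
    by (auto simp: exp_diff has_bochner_integral_iff)
  then show ?thesis unfolding wick_sum_def by (intro Bochner_Integration.integrable_sum integrable_mult_right)
qed

text \<open>The first order term of the Taylor expansion has mean zero and the covariance enters
  the second order term monotonically.\<close>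

lemma (in smooth_convex) wick_sum_expansion:
  fixes q :: "'i \<Rightarrow> real" and c :: real
  assumes g: "gaussian_vector P I X A" and sym: "\<And>i j. A i j = A j i"
    and q: "\<And>i. i \<in> I \<Longrightarrow> 0 \<le> q i" and "0 \<le> c"
    and m3: "\<And>i. i \<in> I \<Longrightarrow> integrable (gauss_law (A i i)) (\<lambda>x. \<bar>exp (x - A i i / 2) - 1\<bar> ^ 3)"
      "\<And>i. i \<in> I \<Longrightarrow> (LINT x|gauss_law (A i i). \<bar>exp (x - A i i / 2) - 1\<bar> ^ 3) \<le> c"
  shows "\<bar>(LINT \<omega>|P. f (wick_sum I q X A \<omega>))
      - (f (sum q I) + f'' (sum q I) / 2 * (\<Sum>i\<in>I. \<Sum>j\<in>I. q i * q j * (exp (A i j) - 1)))\<bar>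
      \<le> C / 2 * (sum q I ^ 3 * (card I * c))"
proof -
  interpret prob_space P by (rule gaussian_vectorD[OF g])
  have fin: "finite I" by (rule gaussian_vectorD[OF g])
  define s where "s = sum q I"
  define e where "e = (\<lambda>i \<omega>. exp (X i \<omega> - A i i / 2))"
  \<comment> \<open>These are the centred factors; the mean of \<open>h i * h j\<close> is
    \<open>exp (A i j) - 1\<close>, the only place where off-diagonal covariances enter.\<close>
  define h where "h = (\<lambda>i \<omega>. e i \<omega> - 1)"
  define S where "S = (\<lambda>\<omega>. \<Sum>i\<in>I. q i * h i \<omega>)"
  have [measurable]: "X i \<in> borel_measurable P" if "i \<in> I" for i using gaussian_vectorD[OF g] that by auto
  have e: "integrable P (e i)" "(LINT \<omega>|P. e i \<omega>) = 1" if "i \<in> I" for i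
    using gaussian_vector_exp_component(1)[OF g that, of 1]
    by (auto simp: e_def exp_diff has_bochner_integral_iff)
  have ee: "integrable P (\<lambda>\<omega>. e i \<omega> * e j \<omega>)" "(LINT \<omega>|P. e i \<omega> * e j \<omega>) = exp (A i j)"
    if "i \<in> I" "j \<in> I" for i j
    using gaussian_vector_exp_pair[OF g that sym] by (auto simp: e_def has_bochner_integral_iff)
  have h1: "integrable P (h i)" "(LINT \<omega>|P. h i \<omega>) = 0" if "i \<in> I" for i
    using e[OF that] by (auto simp: h_def prob_space)
  have hh_eq: "h i \<omega> * h j \<omega> = e i \<omega> * e j \<omega> - e i \<omega> - e j \<omega> + 1" for i j \<omega>
    by (simp add: h_def algebra_simps)
  have h2: "integrable P (\<lambda>\<omega>. h i \<omega> * h j \<omega>)" "(LINT \<omega>|P. h i \<omega> * h j \<omega>) = exp (A i j) - 1"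
    if "i \<in> I" "j \<in> I" for i j
    unfolding hh_eq using e[OF that(1)] e[OF that(2)] ee[OF that] by (auto simp: prob_space)
  have h3: "integrable P (\<lambda>\<omega>. \<bar>h i \<omega>\<bar> ^ 3)" "(LINT \<omega>|P. \<bar>h i \<omega>\<bar> ^ 3) \<le> c" if "i \<in> I" for i
    using m3[OF that] that unfolding gaussian_vector_exp_component(3)[OF g that, symmetric] h_def e_def
    by (simp_all add: integrable_distr_eq integral_distr)
  have S1: "integrable P S" "(LINT \<omega>|P. S \<omega>) = 0"
    unfolding S_def using h1 by (auto simp: Bochner_Integration.integral_sum)
  have S2eq: "(S \<omega>)\<^sup>2 = (\<Sum>i\<in>I. \<Sum>j\<in>I. q i * q j * (h i \<omega> * h j \<omega>))" for \<omega>
    by (simp add: S_def power2_eq_square sum_product mult_ac)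
  have S2: "integrable P (\<lambda>\<omega>. (S \<omega>)\<^sup>2)"
    "(LINT \<omega>|P. (S \<omega>)\<^sup>2) = (\<Sum>i\<in>I. \<Sum>j\<in>I. q i * q j * (exp (A i j) - 1))"
    unfolding S2eq using h2 by (auto simp: Bochner_Integration.integral_sum)
  have S3bd: "\<bar>S \<omega>\<bar> ^ 3 \<le> s ^ 3 * (\<Sum>i\<in>I. \<bar>h i \<omega>\<bar> ^ 3)" for \<omega>
    unfolding S_def s_def by (rule abs_weighted_sum_cube_le[OF fin q])
  have ih3: "integrable P (\<lambda>\<omega>. s ^ 3 * (\<Sum>i\<in>I. \<bar>h i \<omega>\<bar> ^ 3))" using h3 by auto
  have [measurable]: "S \<in> borel_measurable P" using S1 by simp
  have wick: "wick_sum I q X A \<omega> = s + S \<omega>" for \<omega>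
    by (simp add: wick_sum_def s_def S_def h_def e_def algebra_simps sum_subtractf)
  have intf: "integrable P (\<lambda>\<omega>. f (s + S \<omega>))"
    by (rule integrable_f) (use S1 in \<open>auto intro: finite_measure_axioms\<close>)
  \<comment> \<open>Since \<open>S\<close> has mean zero, the linear Taylor term can be inserted
    under the integral at no cost.\<close>
  have "(LINT \<omega>|P. f (s + S \<omega>)) - (f s + f'' s / 2 * (LINT \<omega>|P. (S \<omega>)\<^sup>2))
     = (LINT \<omega>|P. f (s + S \<omega>) - f s - f' s * S \<omega> - f'' s / 2 * (S \<omega>)\<^sup>2)"
    using intf S1 S2 by (simp add: prob_space)
  also have "\<bar>\<dots>\<bar> \<le> (LINT \<omega>|P. C / 2 * (s ^ 3 * (\<Sum>i\<in>I. \<bar>h i \<omega>\<bar> ^ 3)))"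
  proof -
    have "norm (LINT \<omega>|P. f (s + S \<omega>) - f s - f' s * S \<omega> - f'' s / 2 * (S \<omega>)\<^sup>2)
      \<le> (LINT \<omega>|P. C / 2 * (s ^ 3 * (\<Sum>i\<in>I. \<bar>h i \<omega>\<bar> ^ 3)))"
    proof (rule order_trans[OF integral_norm_bound integral_mono])
      show "norm (f (s + S \<omega>) - f s - f' s * S \<omega> - f'' s / 2 * (S \<omega>)\<^sup>2) \<le> C / 2 * (s ^ 3 * (\<Sum>i\<in>I. \<bar>h i \<omega>\<bar> ^ 3))" for \<omega>
        using order_trans[OF taylor mult_left_mono[OF S3bd[of \<omega>]]] C_nonneg by simp
    qed (use intf S1 S2 ih3 in auto)
    then show ?thesis unfolding real_norm_def .
  qed
  also have "\<dots> = C / 2 * (s ^ 3 * (\<Sum>i\<in>I. (LINT \<omega>|P. \<bar>h i \<omega>\<bar> ^ 3)))"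
    using h3 by (simp add: Bochner_Integration.integral_sum)
  also have "\<dots> \<le> C / 2 * (s ^ 3 * (\<Sum>i\<in>I. c))"
    using C_nonneg q h3 unfolding s_def
    by (intro mult_left_mono sum_mono zero_le_power sum_nonneg) auto
  finally show ?thesis unfolding S2 wick s_def by simp
qed

text \<open>Both expansions are centred at the same point \<open>sum q I\<close>, so the main parts
  differ only in the second order term, where \<open>q \<ge> 0\<close> and
  \<open>f'' \<ge> 0\<close> fix the sign. The two remainders of size \<open>C / 2\<close> add up to
  \<open>C\<close>.\<close>

lemma (in smooth_convex) wick_sum_compare:
  fixes q :: "'i \<Rightarrow> real" and c :: real
  assumes gX: "gaussian_vector P I X A" and symA: "\<And>i j. A i j = A j i"
    and gY: "gaussian_vector Q I Y B" and symB: "\<And>i j. B i j = B j i"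
    and AB: "\<And>i j. i \<in> I \<Longrightarrow> j \<in> I \<Longrightarrow> A i j \<le> B i j"
    and q: "\<And>i. i \<in> I \<Longrightarrow> 0 \<le> q i" and "0 \<le> c"
    and m3A: "\<And>i. i \<in> I \<Longrightarrow> integrable (gauss_law (A i i)) (\<lambda>x. \<bar>exp (x - A i i / 2) - 1\<bar> ^ 3)"
      "\<And>i. i \<in> I \<Longrightarrow> (LINT x|gauss_law (A i i). \<bar>exp (x - A i i / 2) - 1\<bar> ^ 3) \<le> c"
    and m3B: "\<And>i. i \<in> I \<Longrightarrow> integrable (gauss_law (B i i)) (\<lambda>x. \<bar>exp (x - B i i / 2) - 1\<bar> ^ 3)"
      "\<And>i. i \<in> I \<Longrightarrow> (LINT x|gauss_law (B i i). \<bar>exp (x - B i i / 2) - 1\<bar> ^ 3) \<le> c"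
  shows "(LINT \<omega>|P. f (wick_sum I q X A \<omega>))
      \<le> (LINT \<omega>|Q. f (wick_sum I q Y B \<omega>)) + C * (sum q I ^ 3 * (card I * c))"
proof -
  have "(\<Sum>i\<in>I. \<Sum>j\<in>I. q i * q j * (exp (A i j) - 1)) \<le> (\<Sum>i\<in>I. \<Sum>j\<in>I. q i * q j * (exp (B i j) - 1))"
    using q AB by (intro sum_mono mult_left_mono) auto
  then have "f'' (sum q I) / 2 * (\<Sum>i\<in>I. \<Sum>j\<in>I. q i * q j * (exp (A i j) - 1))
    \<le> f'' (sum q I) / 2 * (\<Sum>i\<in>I. \<Sum>j\<in>I. q i * q j * (exp (B i j) - 1))"
    using f''_nonneg by (intro mult_left_mono) auto
  moreover have "\<bar>(LINT \<omega>|P. f (wick_sum I q X A \<omega>))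
      - (f (sum q I) + f'' (sum q I) / 2 * (\<Sum>i\<in>I. \<Sum>j\<in>I. q i * q j * (exp (A i j) - 1)))\<bar>
      \<le> C / 2 * (sum q I ^ 3 * (card I * c))"
    by (rule wick_sum_expansion) fact+
  moreover have "\<bar>(LINT \<omega>|Q. f (wick_sum I q Y B \<omega>))
      - (f (sum q I) + f'' (sum q I) / 2 * (\<Sum>i\<in>I. \<Sum>j\<in>I. q i * q j * (exp (B i j) - 1)))\<bar>
      \<le> C / 2 * (sum q I ^ 3 * (card I * c))"
    by (rule wick_sum_expansion) fact+
  ultimately show ?thesis
    by (simp only: abs_le_iff) linarith
qed

text \<open>During the exchange the weights are random: they carry the Wick exponentials of the part
  that is kept. The error then contains the cube of their sum, whose mean must be bounded
  independently of the number of steps.\<close>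

lemma wick_sum_cube:
  fixes p :: "'i \<Rightarrow> real"
  assumes g: "gaussian_vector P I X A" and p: "\<And>i. i \<in> I \<Longrightarrow> 0 \<le> p i" and V: "\<And>i. i \<in> I \<Longrightarrow> A i i \<le> V"
  shows "integrable P (\<lambda>\<omega>. (wick_sum I p X A \<omega>) ^ 3)"
    and "(LINT \<omega>|P. (wick_sum I p X A \<omega>) ^ 3) \<le> sum p I ^ 3 * (card I * exp (3 * V))"
proof -
  have fin: "finite I" by (rule gaussian_vectorD[OF g])
  \<comment> \<open>The exponent is 9/2 of the variance from the exponential moment at 3, minus 3/2
    of it from the normalisation.\<close>
  have e3: "has_bochner_integral P (\<lambda>\<omega>. exp (X i \<omega> - A i i / 2) ^ 3) (exp (3 * A i i))" if "i \<in> I" for i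
  proof -
    have "has_bochner_integral P (\<lambda>\<omega>. exp (- (3 / 2 * A i i)) * exp (3 * X i \<omega>)) (exp (- (3 / 2 * A i i)) * exp (3\<^sup>2 * A i i / 2))"
      by (intro has_bochner_integral_mult_right gaussian_vector_exp_component(1)[OF g that])
    moreover have "exp (- (3 / 2 * A i i)) * exp (3\<^sup>2 * A i i / 2) = exp (3 * A i i)"
      unfolding exp_add[symmetric] by (rule arg_cong[where f=exp]) simp
    moreover have "exp (- (3 / 2 * A i i)) * exp (3 * x) = exp (x - A i i / 2) ^ 3" for x
      unfolding exp_add[symmetric] exp_of_nat_mult[symmetric] by (rule arg_cong[where f=exp]) simp
    ultimately show ?thesis by simp
  qed
  have [measurable]: "wick_sum I p X A \<in> borel_measurable P" using wick_sum_integrable[OF g] by auto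
  have w0: "0 \<le> wick_sum I p X A \<omega>" for \<omega> using p by (auto simp: wick_sum_def intro!: sum_nonneg)
  have bd: "(wick_sum I p X A \<omega>) ^ 3 \<le> sum p I ^ 3 * (\<Sum>i\<in>I. exp (X i \<omega> - A i i / 2) ^ 3)" for \<omega>
  proof -
    have "\<bar>\<Sum>i\<in>I. p i * exp (X i \<omega> - A i i / 2)\<bar> ^ 3 \<le> sum p I ^ 3 * (\<Sum>i\<in>I. \<bar>exp (X i \<omega> - A i i / 2)\<bar> ^ 3)"
      by (rule abs_weighted_sum_cube_le[OF fin]) (rule p)
    then show ?thesis using w0[of \<omega>] by (simp add: wick_sum_def)
  qed
  have hb: "has_bochner_integral P (\<lambda>\<omega>. sum p I ^ 3 * (\<Sum>i\<in>I. exp (X i \<omega> - A i i / 2) ^ 3))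
      (sum p I ^ 3 * (\<Sum>i\<in>I. exp (3 * A i i)))"
    by (intro has_bochner_integral_mult_right has_bochner_integral_sum e3)
  show int: "integrable P (\<lambda>\<omega>. (wick_sum I p X A \<omega>) ^ 3)"
    by (rule Bochner_Integration.integrable_bound[OF integrable.intros[OF hb]])
       (use bd w0 in \<open>auto intro: order_trans[OF _ abs_ge_self]\<close>)
  have "(LINT \<omega>|P. (wick_sum I p X A \<omega>) ^ 3) \<le> sum p I ^ 3 * (\<Sum>i\<in>I. exp (3 * A i i))"
    unfolding has_bochner_integral_integral_eq[OF hb, symmetric]
    by (rule integral_mono[OF int integrable.intros[OF hb] bd])
  also have "\<dots> \<le> sum p I ^ 3 * (\<Sum>i\<in>I. exp (3 * V))"
    using V p by (intro mult_left_mono sum_mono zero_le_power sum_nonneg) auto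
  finally show "(LINT \<omega>|P. (wick_sum I p X A \<omega>) ^ 3) \<le> sum p I ^ 3 * (card I * exp (3 * V))" by simp
qed

lemma wick_sum_integral_eq:
  assumes "gaussian_vector P I X A" "gaussian_vector Q I Y B"
    and AB: "\<And>i j. i \<in> I \<Longrightarrow> j \<in> I \<Longrightarrow> A i j = B i j"
    and [measurable]: "f \<in> borel_measurable borel"
  shows "(LINT \<omega>|P. f (wick_sum I p X A \<omega>)) = (LINT \<omega>|Q. f (wick_sum I p Y B \<omega>) :: real)"
proof -
  let ?\<phi> = "\<lambda>x. f (\<Sum>i\<in>I. p i * exp (x i - A i i / 2))"
  have "(LINT \<omega>|P. ?\<phi> (\<lambda>i\<in>I. X i \<omega>)) = (LINT \<omega>|Q. ?\<phi> (\<lambda>i\<in>I. Y i \<omega>))"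
    by (rule gaussian_vector_integral_eq[OF assms(1-3)]) auto
  then show ?thesis by (simp add: wick_sum_def AB)
qed

text \<open>The Wick exponential of an independent sum is the product of the two Wick exponentials.
  With \<open>Z\<close> frozen, the sum is thus a Wick sum of \<open>X\<close> alone with weights
  \<open>q \<omega>\<close>, and Fubini integrates over \<open>Z\<close> afterwards.\<close>

lemma (in smooth_convex) wick_sum_add_integral:
  fixes p :: "'i \<Rightarrow> real"
  assumes gZ: "gaussian_vector N I Z W" and gX: "gaussian_vector P I X A"
  defines "q \<equiv> \<lambda>\<omega> i. p i * exp (Z i \<omega> - W i i / 2)"
  defines "G \<equiv> \<lambda>\<omega>. (LINT \<omega>'|P. f (wick_sum I (q \<omega>) X A \<omega>'))"
  shows "integrable N G"
    and "(LINT \<omega>|(N \<Otimes>\<^sub>M P). f (wick_sum I p (\<lambda>i (\<omega>, \<omega>'). Z i \<omega> + X i \<omega>') (\<lambda>i j. W i j + A i j) \<omega>)) = (LINT \<omega>|N. G \<omega>)"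
proof -
  interpret N: prob_space N by (rule gaussian_vectorD[OF gZ])
  interpret P: prob_space P by (rule gaussian_vectorD[OF gX])
  interpret NP: pair_prob_space N P ..
  have eq: "wick_sum I p (\<lambda>i (\<omega>, \<omega>'). Z i \<omega> + X i \<omega>') (\<lambda>i j. W i j + A i j) (\<omega>, \<omega>') = wick_sum I (q \<omega>) X A \<omega>'" for \<omega> \<omega>'
    unfolding wick_sum_def q_def
    by (intro sum.cong refl) (simp add: mult.assoc exp_add[symmetric] add_divide_distrib algebra_simps)
  have int: "integrable (N \<Otimes>\<^sub>M P) (\<lambda>\<omega>. f (wick_sum I p (\<lambda>i (\<omega>, \<omega>'). Z i \<omega> + X i \<omega>') (\<lambda>i j. W i j + A i j) \<omega>))"
    by (intro integrable_f wick_sum_integrable gaussian_vector_add gZ gX NP.finite_measure_axioms)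
  show "integrable N G"
    using NP.integrable_fst'[OF int] by (simp add: eq G_def)
  show "(LINT \<omega>|(N \<Otimes>\<^sub>M P). f (wick_sum I p (\<lambda>i (\<omega>, \<omega>'). Z i \<omega> + X i \<omega>') (\<lambda>i j. W i j + A i j) \<omega>)) = (LINT \<omega>|N. G \<omega>)"
    using NP.integral_fst'[OF int] by (simp add: eq G_def)
qed

text \<open>With \<open>Z\<close> frozen the weights are deterministic and
  \<open>wick_sum_compare\<close> applies; its error is averaged over \<open>Z\<close> by
  \<open>wick_sum_cube\<close>. One factor \<open>card I\<close> stems from the third moments of the
  exchanged part, the other from the cube of the weights.\<close>

lemma (in smooth_convex) wick_sum_step:
  fixes p :: "'i \<Rightarrow> real" and c :: real
  assumes gZ: "gaussian_vector N I Z W" and V: "\<And>i. i \<in> I \<Longrightarrow> W i i \<le> V"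
    and p: "\<And>i. i \<in> I \<Longrightarrow> 0 \<le> p i"
    and gX: "gaussian_vector P I X A" and symA: "\<And>i j. A i j = A j i"
    and gY: "gaussian_vector Q I Y B" and symB: "\<And>i j. B i j = B j i"
    and AB: "\<And>i j. i \<in> I \<Longrightarrow> j \<in> I \<Longrightarrow> A i j \<le> B i j"
    and "0 \<le> c"
    and m3A: "\<And>i. i \<in> I \<Longrightarrow> integrable (gauss_law (A i i)) (\<lambda>x. \<bar>exp (x - A i i / 2) - 1\<bar> ^ 3)"
      "\<And>i. i \<in> I \<Longrightarrow> (LINT x|gauss_law (A i i). \<bar>exp (x - A i i / 2) - 1\<bar> ^ 3) \<le> c"
    and m3B: "\<And>i. i \<in> I \<Longrightarrow> integrable (gauss_law (B i i)) (\<lambda>x. \<bar>exp (x - B i i / 2) - 1\<bar> ^ 3)"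
      "\<And>i. i \<in> I \<Longrightarrow> (LINT x|gauss_law (B i i). \<bar>exp (x - B i i / 2) - 1\<bar> ^ 3) \<le> c"
  shows "(LINT \<omega>|(N \<Otimes>\<^sub>M P). f (wick_sum I p (\<lambda>i (\<omega>, \<omega>'). Z i \<omega> + X i \<omega>') (\<lambda>i j. W i j + A i j) \<omega>))
      \<le> (LINT \<omega>|(N \<Otimes>\<^sub>M Q). f (wick_sum I p (\<lambda>i (\<omega>, \<omega>'). Z i \<omega> + Y i \<omega>') (\<lambda>i j. W i j + B i j) \<omega>))
        + C * (card I * c) * (sum p I ^ 3 * (card I * exp (3 * V)))"
proof -
  let ?q = "\<lambda>\<omega> i. p i * exp (Z i \<omega> - W i i / 2)"
  let ?G = "\<lambda>\<omega>. (LINT \<omega>'|P. f (wick_sum I (?q \<omega>) X A \<omega>'))"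
  let ?H = "\<lambda>\<omega>. (LINT \<omega>'|Q. f (wick_sum I (?q \<omega>) Y B \<omega>'))"
  note cube = wick_sum_cube[OF gZ p V]
  have "(LINT \<omega>|N. ?G \<omega>) \<le> (LINT \<omega>|N. ?H \<omega> + C * (card I * c) * (wick_sum I p Z W \<omega>) ^ 3)"
  proof (rule integral_mono)
    show "?G \<omega> \<le> ?H \<omega> + C * (card I * c) * (wick_sum I p Z W \<omega>) ^ 3" for \<omega>
      using wick_sum_compare[OF gX symA gY symB AB _ \<open>0 \<le> c\<close> m3A m3B, of "?q \<omega>"] p
      by (simp add: wick_sum_def mult_ac)
  qed (use wick_sum_add_integral(1)[OF gZ gX] wick_sum_add_integral(1)[OF gZ gY] cube(1) in auto)
  also have "\<dots> = (LINT \<omega>|N. ?H \<omega>) + C * (card I * c) * (LINT \<omega>|N. (wick_sum I p Z W \<omega>) ^ 3)"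
    using wick_sum_add_integral(1)[OF gZ gY] cube(1) by simp
  also have "\<dots> \<le> (LINT \<omega>|N. ?H \<omega>) + C * (card I * c) * (sum p I ^ 3 * (card I * exp (3 * V)))"
    using cube(2) C_nonneg \<open>0 \<le> c\<close> by (intro add_left_mono mult_left_mono) auto
  finally show ?thesis
    unfolding wick_sum_add_integral(2)[OF gZ gX] wick_sum_add_integral(2)[OF gZ gY] .
qed

text \<open>The covariance is moved from \<open>A\<close> to \<open>B\<close> in \<open>m\<close> steps along \<open>\<surd>(1 - k/m) X + \<surd>(k/m) Y\<close>.
  In step \<open>k\<close> an independent copy of \<open>X / \<surd>m\<close> is replaced by one of \<open>Y / \<surd>m\<close>, which costs
  at most \<open>O(m\<^sup>-\<^sup>3\<^sup>/\<^sup>2)\<close>.\<close>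

theorem (in smooth_convex) kahane_finite:
  fixes p :: "'i \<Rightarrow> real"
  assumes gX: "gaussian_vector P I X A" and symA: "\<And>i j. A i j = A j i"
    and gY: "gaussian_vector Q I Y B" and symB: "\<And>i j. B i j = B j i"
    and AB: "\<And>i j. i \<in> I \<Longrightarrow> j \<in> I \<Longrightarrow> A i j \<le> B i j"
    and p: "\<And>i. i \<in> I \<Longrightarrow> 0 \<le> p i"
  shows "(LINT \<omega>|P. f (wick_sum I p X A \<omega>)) \<le> (LINT \<omega>|Q. f (wick_sum I p Y B \<omega>))"
proof -
  have fin: "finite I" by (rule gaussian_vectorD[OF gX])
  \<comment> \<open>The trace of \<open>B\<close> bounds every variance occurring below, those of
    \<open>A\<close> included because the comparison also holds on the diagonal.\<close>
  define V where "V = (\<Sum>i\<in>I. B i i)"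
  have A0: "0 \<le> A i i" if "i \<in> I" for i by (rule gaussian_vector_exp_component(2)[OF gX that])
  have B0: "0 \<le> B i i" if "i \<in> I" for i by (rule gaussian_vector_exp_component(2)[OF gY that])
  have BV: "B i i \<le> V" if "i \<in> I" for i
    unfolding V_def using that fin B0 by (intro member_le_sum) auto
  have AV: "A i i \<le> V" if "i \<in> I" for i using AB[OF that that] BV[OF that] by linarith
  have V0: "0 \<le> V" unfolding V_def using B0 by (intro sum_nonneg)
  obtain c where c: "0 \<le> c"
    "\<And>a. 0 \<le> a \<Longrightarrow> a \<le> V \<Longrightarrow> integrable (gauss_law a) (\<lambda>x. \<bar>exp (x - a / 2) - 1\<bar> ^ 3)"
    "\<And>a. 0 \<le> a \<Longrightarrow> a \<le> V \<Longrightarrow> (LINT x|gauss_law a. \<bar>exp (x - a / 2) - 1\<bar> ^ 3) \<le> c * (a * sqrt a)"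
    using gauss_law_third_moment[OF V0] by blast
  \<comment> \<open>One exchange costs \<open>E / (m * sqrt m)\<close>, by the third moment bound at
    variances up to \<open>V / m\<close>.\<close>
  define E where "E = C * (card I * (c * (V * sqrt V))) * (sum p I ^ 3 * (card I * exp (3 * V)))"
  have main: "(LINT \<omega>|P. f (wick_sum I p X A \<omega>)) \<le> (LINT \<omega>|Q. f (wick_sum I p Y B \<omega>)) + E / sqrt (real m)"
    if m: "m > 0" for m :: nat
  proof -
    define Z where "Z = (\<lambda>s t i (\<omega>, \<omega>'). sqrt s * X i \<omega> + sqrt t * Y i \<omega>')"
    define W where "W = (\<lambda>s t i j. (sqrt s)\<^sup>2 * A i j + (sqrt t)\<^sup>2 * B i j)"
    have gZ: "gaussian_vector (P \<Otimes>\<^sub>M Q) I (Z s t) (W s t)" for s t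
      unfolding Z_def W_def by (intro gaussian_vector_add gaussian_vector_scale gX gY)
    define g where "g = (\<lambda>k. (LINT \<omega>|(P \<Otimes>\<^sub>M Q). f (wick_sum I p (Z ((real m - real k) / m) (real k / m)) (W ((real m - real k) / m) (real k / m)) \<omega>)))"
    have g0: "g 0 = (LINT \<omega>|P. f (wick_sum I p X A \<omega>))"
      unfolding g_def by (rule wick_sum_integral_eq[OF gZ gX]) (use m in \<open>auto simp: W_def\<close>)
    have gm: "g m = (LINT \<omega>|Q. f (wick_sum I p Y B \<omega>))"
      unfolding g_def by (rule wick_sum_integral_eq[OF gZ gY]) (use m in \<open>auto simp: W_def\<close>)
    have step: "g k \<le> g (Suc k) + E / (m * sqrt m)" if k: "k < m" for k
    proof -
      \<comment> \<open>These are the shares of \<open>A\<close> and \<open>B\<close> common to the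
        stages \<open>k\<close> and \<open>Suc k\<close>. They sum to \<open>1 - 1/m\<close>; the
        missing share \<open>1/m\<close> is the piece to be exchanged, and \<open>?u\<close> is its
        scaling factor.\<close>
      let ?s = "(real m - real (Suc k)) / m" and ?t = "real k / m" and ?u = "sqrt (1 / real m)"
      have st: "0 \<le> ?s" "0 \<le> ?t" "?s + ?t \<le> 1" using k m by (auto simp: field_simps)
      let ?A = "\<lambda>i j. ?u\<^sup>2 * A i j" and ?B = "\<lambda>i j. ?u\<^sup>2 * B i j"
      have gX': "gaussian_vector P I (\<lambda>i \<omega>. ?u * X i \<omega>) ?A" by (rule gaussian_vector_scale[OF gX])
      have gY': "gaussian_vector Q I (\<lambda>i \<omega>. ?u * Y i \<omega>) ?B" by (rule gaussian_vector_scale[OF gY])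
      have WV: "W ?s ?t i i \<le> V" if i: "i \<in> I" for i
      proof -
        have "W ?s ?t i i \<le> ?s * V + ?t * V"
          unfolding W_def real_sqrt_pow2[OF st(1)] real_sqrt_pow2[OF st(2)]
          by (intro add_mono mult_left_mono AV BV i st)
        also have "\<dots> = (?s + ?t) * V" by (simp only: distrib_right)
        also have "\<dots> \<le> 1 * V" using st V0 by (intro mult_right_mono)
        finally show ?thesis by simp
      qed
      let ?v = "V / m"
      have vm: "a / m \<le> V" if "0 \<le> a" "a \<le> V" for a
      proof -
        have "a / m \<le> a" using m that by (simp add: divide_le_eq mult_le_cancel_left1)
        then show ?thesis using that by linarith
      qed
      have third: "integrable (gauss_law (?u\<^sup>2 * a)) (\<lambda>x. \<bar>exp (x - ?u\<^sup>2 * a / 2) - 1\<bar> ^ 3)"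
          "(LINT x|gauss_law (?u\<^sup>2 * a). \<bar>exp (x - ?u\<^sup>2 * a / 2) - 1\<bar> ^ 3) \<le> c * (?v * sqrt ?v)" if a: "0 \<le> a" "a \<le> V" for a
      proof -
        have eq: "?u\<^sup>2 * a = a / m" by (simp add: real_sqrt_divide power_divide)
        have 0: "0 \<le> a / m" using a by simp
        show "integrable (gauss_law (?u\<^sup>2 * a)) (\<lambda>x. \<bar>exp (x - ?u\<^sup>2 * a / 2) - 1\<bar> ^ 3)"
          unfolding eq by (rule c(2)[OF 0 vm[OF a]])
        have "(LINT x|gauss_law (?u\<^sup>2 * a). \<bar>exp (x - ?u\<^sup>2 * a / 2) - 1\<bar> ^ 3) \<le> c * (a / m * sqrt (a / m))"
          unfolding eq by (rule c(3)[OF 0 vm[OF a]])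
        also have "\<dots> \<le> c * (?v * sqrt ?v)"
          using a \<open>0 \<le> c\<close> V0 by (intro mult_left_mono mult_mono real_sqrt_le_mono divide_right_mono) auto
        finally show "(LINT x|gauss_law (?u\<^sup>2 * a). \<bar>exp (x - ?u\<^sup>2 * a / 2) - 1\<bar> ^ 3) \<le> c * (?v * sqrt ?v)" .
      qed
      \<comment> \<open>Stage \<open>k\<close> lives on two factors, the split form on three. Their
        covariances agree because the common share of \<open>A\<close> plus \<open>1/m\<close> gives
        back \<open>(m - k) / m\<close>.\<close>
      have "g k = (LINT \<omega>|((P \<Otimes>\<^sub>M Q) \<Otimes>\<^sub>M P). f (wick_sum I p (\<lambda>i (\<omega>, \<omega>'). Z ?s ?t i \<omega> + ?u * X i \<omega>') (\<lambda>i j. W ?s ?t i j + ?A i j) \<omega>))"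
        unfolding g_def
      proof (rule wick_sum_integral_eq[OF gZ gaussian_vector_add[OF gZ gX']])
        show "W ((real m - real k) / m) (real k / m) i j = W ?s ?t i j + ?A i j" for i j
          unfolding W_def using k m by (simp add: real_sqrt_divide power_divide) (simp add: field_simps)
      qed simp
      also have "\<dots> \<le> (LINT \<omega>|((P \<Otimes>\<^sub>M Q) \<Otimes>\<^sub>M Q). f (wick_sum I p (\<lambda>i (\<omega>, \<omega>'). Z ?s ?t i \<omega> + ?u * Y i \<omega>') (\<lambda>i j. W ?s ?t i j + ?B i j) \<omega>))
         + C * (card I * (c * (?v * sqrt ?v))) * (sum p I ^ 3 * (card I * exp (3 * V)))"
      proof (rule wick_sum_step[OF gZ WV p gX' _ gY'])
        show "?A i j = ?A j i" "?B i j = ?B j i" for i j by (simp_all only: symA[of i j] symB[of i j])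
        show "?A i j \<le> ?B i j" if "i \<in> I" "j \<in> I" for i j using AB[OF that] by (intro mult_left_mono) auto
        show "0 \<le> c * (?v * sqrt ?v)" using \<open>0 \<le> c\<close> V0 by simp
      qed (assumption | rule third[OF A0 AV] third[OF B0 BV])+
      also have "(LINT \<omega>|((P \<Otimes>\<^sub>M Q) \<Otimes>\<^sub>M Q). f (wick_sum I p (\<lambda>i (\<omega>, \<omega>'). Z ?s ?t i \<omega> + ?u * Y i \<omega>') (\<lambda>i j. W ?s ?t i j + ?B i j) \<omega>)) = g (Suc k)"
        unfolding g_def
      proof (rule wick_sum_integral_eq[OF gaussian_vector_add[OF gZ gY'] gZ])
        show "W ?s ?t i j + ?B i j = W ((real m - real (Suc k)) / m) (real (Suc k) / m) i j" for i j
          unfolding W_def using k m by (simp add: real_sqrt_divide power_divide) (simp add: field_simps)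
      qed simp
      also have "C * (card I * (c * (?v * sqrt ?v))) * (sum p I ^ 3 * (card I * exp (3 * V))) = E / (m * sqrt m)"
        by (simp add: E_def real_sqrt_divide)
      finally show ?thesis .
    qed
    have "k \<le> m \<Longrightarrow> g 0 \<le> g k + real k * (E / (m * sqrt m))" for k
    proof (induction k)
      case (Suc k)
      then show ?case using step[of k] by (simp add: algebra_simps add_divide_distrib)
    qed simp
    from this[of m] show ?thesis using m unfolding g0 gm by simp
  qed
  have "(\<lambda>m. (LINT \<omega>|Q. f (wick_sum I p Y B \<omega>)) + E / sqrt (real m)) \<longlonglongrightarrow> (LINT \<omega>|Q. f (wick_sum I p Y B \<omega>)) + 0"
    by (intro tendsto_add tendsto_const real_tendsto_divide_at_top[OF tendsto_const]
        filterlim_compose[OF sqrt_at_top filterlim_real_sequentially])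
  then show ?thesis
    using main by (intro LIMSEQ_le_const[of _ "(LINT \<omega>|Q. f (wick_sum I p Y B \<omega>))"]) (auto intro!: exI[of _ 1])
qed

section \<open>Approximation of convex functions\<close>

lemma ex_antiderivative:
  fixes F :: "real \<Rightarrow> real"
  assumes "continuous_on UNIV F"
  obtains G where "\<And>x. (G has_real_derivative F x) (at x)"
  using einterval_antiderivative[of "-\<infinity>" "\<infinity>" F] assms
  by (auto simp: continuous_on_eq_continuous_at has_real_derivative_iff_has_vector_derivative)

text \<open>The approximating function is the average of \<open>F (x + s + t)\<close> over \<open>s, t \<in> [0, \<epsilon>]\<close>,
  written as a second difference of a second antiderivative.\<close>

lemma smooth_convex_approximation:
  fixes F :: "real \<Rightarrow> real"
  assumes conv: "convex_on UNIV F" and lip: "\<And>x y. \<bar>F x - F y\<bar> \<le> L * \<bar>x - y\<bar>" and \<epsilon>: "\<epsilon> > 0"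
  obtains f f' f'' C where "smooth_convex f f' f'' L C" "\<And>x. \<bar>f x - F x\<bar> \<le> 2 * L * \<epsilon>"
proof -
  have L: "L \<ge> 0" using lip[of 0 1] by simp
  have contF: "continuous_on UNIV F" by (rule convex_on_continuous[OF open_UNIV conv])
  obtain G1 where G1: "\<And>x. (G1 has_real_derivative F x) (at x)"
    using ex_antiderivative[OF contF] by blast
  have "continuous_on UNIV G1"
    using G1 by (meson DERIV_continuous continuous_at_imp_continuous_on)
  then obtain G where G: "\<And>x. (G has_real_derivative G1 x) (at x)"
    using ex_antiderivative by blast
  define f where "f = (\<lambda>x. (G (x + 2 * \<epsilon>) - 2 * G (x + \<epsilon>) + G x) / \<epsilon>\<^sup>2)"
  define f' where "f' = (\<lambda>x. (G1 (x + 2 * \<epsilon>) - 2 * G1 (x + \<epsilon>) + G1 x) / \<epsilon>\<^sup>2)"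
  define f'' where "f'' = (\<lambda>x. (F (x + 2 * \<epsilon>) - 2 * F (x + \<epsilon>) + F x) / \<epsilon>\<^sup>2)"
  have Gs: "((\<lambda>x. G (x + c)) has_real_derivative G1 (x + c)) (at x)"
    "((\<lambda>x. G1 (x + c)) has_real_derivative F (x + c)) (at x)" for x c
    using G[of "x + c"] G1[of "x + c"] by (simp_all add: DERIV_shift)
  have d1: "(f has_real_derivative f' x) (at x)" for x
    unfolding f_def f'_def
    by (intro DERIV_cdivide DERIV_add DERIV_diff DERIV_cmult Gs G)
  have d2: "(f' has_real_derivative f'' x) (at x)" for x
    unfolding f'_def f''_def
    by (intro DERIV_cdivide DERIV_add DERIV_diff DERIV_cmult Gs G1)
  \<comment> \<open>The mean value theorem for the first difference with step \<epsilon>. It bounds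
    \<open>f'\<close> when applied to \<open>G1\<close>, and applied to \<open>G\<close> it locates
    \<open>f x\<close> among values of \<open>F\<close>.\<close>
  have second_diff: "\<exists>\<xi>. x < \<xi> \<and> \<xi> < x + \<epsilon> \<and> H (x + 2 * \<epsilon>) - 2 * H (x + \<epsilon>) + H x = \<epsilon> * (H' (\<xi> + \<epsilon>) - H' \<xi>)"
    if H: "\<And>x. (H has_real_derivative H' x) (at x)" for H H' :: "real \<Rightarrow> real" and x
  proof -
    have "((\<lambda>y. H (y + \<epsilon>) - H y) has_real_derivative H' (y + \<epsilon>) - H' y) (at y)" for y
      using H[of "y + \<epsilon>"] by (intro DERIV_diff H) (simp add: DERIV_shift)
    then obtain \<xi> where \<xi>: "x < \<xi>" "\<xi> < x + \<epsilon>"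
      "(H ((x + \<epsilon>) + \<epsilon>) - H (x + \<epsilon>)) - (H (x + \<epsilon>) - H x) = (x + \<epsilon> - x) * (H' (\<xi> + \<epsilon>) - H' \<xi>)"
      using MVT2[of x "x + \<epsilon>" "\<lambda>y. H (y + \<epsilon>) - H y" "\<lambda>y. H' (y + \<epsilon>) - H' y"] \<epsilon> by auto
    have two: "x + \<epsilon> + \<epsilon> = x + 2 * \<epsilon>" by simp
    show ?thesis using \<xi>(1,2) \<xi>(3)[unfolded two] by (intro exI[of _ \<xi>]) simp
  qed
  \<comment> \<open>The second difference has coefficients 1, -2, 1, whose absolute values sum to 4,
    hence the Lipschitz constant of \<open>f''\<close>.\<close>
  have "smooth_convex f f' f'' L (4 * L / \<epsilon>\<^sup>2)"
  proof
    fix x y :: real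
    show "(f has_real_derivative f' x) (at x)" "(f' has_real_derivative f'' x) (at x)" by (rule d1 d2)+
    \<comment> \<open>Midpoint convexity at \<open>x\<close> and
      \<open>x + 2 * \<epsilon>\<close>.\<close>
    have "F ((1 - 1 / 2) *\<^sub>R x + (1 / 2) *\<^sub>R (x + 2 * \<epsilon>)) \<le> (1 - 1 / 2) * F x + 1 / 2 * F (x + 2 * \<epsilon>)"
      by (rule convex_onD[OF conv]) auto
    moreover have "(1 - 1 / 2) *\<^sub>R x + (1 / 2) *\<^sub>R (x + 2 * \<epsilon>) = x + \<epsilon>" by (simp add: field_simps)
    ultimately show "0 \<le> f'' x" by (simp add: f''_def)
    obtain \<xi> where \<xi>: "G1 (x + 2 * \<epsilon>) - 2 * G1 (x + \<epsilon>) + G1 x = \<epsilon> * (F (\<xi> + \<epsilon>) - F \<xi>)"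
      using second_diff[OF G1] by blast
    have "\<bar>f' x\<bar> = \<bar>F (\<xi> + \<epsilon>) - F \<xi>\<bar> / \<epsilon>"
      unfolding f'_def \<xi> using \<epsilon> by (simp add: power2_eq_square abs_mult)
    also have "\<dots> \<le> L" using lip[of "\<xi> + \<epsilon>" \<xi>] \<epsilon> by (simp add: divide_le_eq)
    finally show "\<bar>f' x\<bar> \<le> L" .
    have "\<bar>(F (x + 2 * \<epsilon>) - F (y + 2 * \<epsilon>)) - 2 * (F (x + \<epsilon>) - F (y + \<epsilon>)) + (F x - F y)\<bar> \<le> 4 * L * \<bar>x - y\<bar>"
      using lip[of "x + 2 * \<epsilon>" "y + 2 * \<epsilon>"] lip[of "x + \<epsilon>" "y + \<epsilon>"] lip[of x y] by (simp add: abs_le_iff)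
    moreover have "f'' x - f'' y
        = ((F (x + 2 * \<epsilon>) - F (y + 2 * \<epsilon>)) - 2 * (F (x + \<epsilon>) - F (y + \<epsilon>)) + (F x - F y)) / \<epsilon>\<^sup>2"
      by (simp add: f''_def diff_divide_distrib add_divide_distrib algebra_simps)
    ultimately show "\<bar>f'' x - f'' y\<bar> \<le> 4 * L / \<epsilon>\<^sup>2 * \<bar>x - y\<bar>"
      using \<epsilon> by (simp add: abs_divide divide_right_mono)
  qed
  moreover have "\<bar>f x - F x\<bar> \<le> 2 * L * \<epsilon>" for x
  proof -
    obtain \<xi> where \<xi>: "x < \<xi>" "\<xi> < x + \<epsilon>"
      "G (x + 2 * \<epsilon>) - 2 * G (x + \<epsilon>) + G x = \<epsilon> * (G1 (\<xi> + \<epsilon>) - G1 \<xi>)"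
      using second_diff[OF G] by blast
    obtain \<eta> where \<eta>: "\<xi> < \<eta>" "\<eta> < \<xi> + \<epsilon>" "G1 (\<xi> + \<epsilon>) - G1 \<xi> = (\<xi> + \<epsilon> - \<xi>) * F \<eta>"
      using MVT2[of \<xi> "\<xi> + \<epsilon>" G1 F] G1 \<epsilon> by auto
    \<comment> \<open>Two mean values cancel both factors \<epsilon>, so \<open>f x\<close> is a
      value of \<open>F\<close> at distance less than \<open>2 * \<epsilon>\<close> from
      \<open>x\<close>.\<close>
    have "f x = F \<eta>" unfolding f_def \<xi>(3) \<eta>(3) using \<epsilon> by (simp add: power2_eq_square)
    then have "\<bar>f x - F x\<bar> \<le> L * \<bar>\<eta> - x\<bar>" using lip by simp
    also have "\<dots> \<le> L * (2 * \<epsilon>)" using \<xi> \<eta> L by (intro mult_left_mono) auto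
    finally show ?thesis by (simp add: mult_ac)
  qed
  ultimately show thesis by (rule that)
qed

section \<open>Supporting lines and Lipschitz minorants\<close>

lemma convex_on_subgradient:
  fixes F :: "real \<Rightarrow> real"
  assumes "convex_on S F" "t \<in> interior S"
  obtains c where "\<And>y. y \<in> S \<Longrightarrow> F t + c * (y - t) \<le> F y"
  using convex_le_Inf_differential[OF assms] by blast

text \<open>The minorant is the upper envelope of zero and the supporting lines at points of
  \<open>[a, b]\<close>. Restricting the points of contact bounds the slopes, even if
  \<open>F\<close> is steep near 0 or at infinity.\<close>

lemma convex_lipschitz_minorant:
  fixes F :: "real \<Rightarrow> real"
  assumes conv: "convex_on {0<..} F" and nonneg: "\<And>x. 0 < x \<Longrightarrow> 0 \<le> F x" and ab: "0 < a" "a \<le> b"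
  obtains g L where "convex_on UNIV g" "\<And>x y. \<bar>g x - g y\<bar> \<le> L * \<bar>x - y\<bar>"
    "\<And>x. 0 \<le> g x" "\<And>x. 0 < x \<Longrightarrow> g x \<le> F x" "\<And>x. a \<le> x \<Longrightarrow> x \<le> b \<Longrightarrow> g x = F x"
proof -
  have "\<exists>c. \<forall>y>0. F t + c * (y - t) \<le> F y" if "t > 0" for t
    using convex_on_subgradient[OF conv, of t] that by (auto simp: interior_open)
  then obtain \<phi> where \<phi>: "\<And>t y. 0 < t \<Longrightarrow> 0 < y \<Longrightarrow> F t + \<phi> t * (y - t) \<le> F y" by metis
  \<comment> \<open>As \<open>F t \<ge> 0\<close>, the line at \<open>t\<close> read at
    \<open>b + 1\<close>, at distance at least 1, bounds the slope above by
    \<open>F (b + 1)\<close>; read at \<open>a / 2\<close>, at distance at least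
    \<open>a / 2\<close>, it bounds the slope below.\<close>
  define L where "L = F (b + 1) + F (a / 2) / (a / 2)"
  have Fb: "0 \<le> F (b + 1)" "0 \<le> F (a / 2) / (a / 2)" using nonneg ab by auto
  have \<phi>L: "\<bar>\<phi> t\<bar> \<le> L" if t: "a \<le> t" "t \<le> b" for t
  proof -
    have t0: "0 < t" using t ab by linarith
    have "\<phi> t \<le> F (b + 1)"
    proof (cases "\<phi> t \<le> 0")
      case False
      have "\<phi> t * 1 \<le> \<phi> t * (b + 1 - t)" using False t by (intro mult_left_mono) auto
      then show ?thesis using \<phi>[OF t0, of "b + 1"] nonneg[OF t0] ab by linarith
    qed (use Fb in linarith)
    moreover have "- \<phi> t \<le> F (a / 2) / (a / 2)"
    proof (cases "\<phi> t \<ge> 0")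
      case False
      have "- \<phi> t * (a / 2) \<le> - \<phi> t * (t - a / 2)" using False t by (intro mult_left_mono) auto
      also have "\<dots> = \<phi> t * (a / 2 - t)" by (simp add: algebra_simps)
      finally have "- \<phi> t * (a / 2) \<le> F (a / 2)" using \<phi>[OF t0, of "a / 2"] nonneg[OF t0] ab by linarith
      then show ?thesis using ab by (simp add: pos_le_divide_eq)
    qed (use Fb in linarith)
    ultimately show ?thesis using Fb unfolding L_def by linarith
  qed
  define l where "l = (\<lambda>t x. max 0 (F t + \<phi> t * (x - t)))"
  have l_lip: "l t x \<le> l t y + L * \<bar>x - y\<bar>" if t: "a \<le> t" "t \<le> b" for t x y
  proof -
    have "\<phi> t * (x - y) \<le> \<bar>\<phi> t\<bar> * \<bar>x - y\<bar>" by (metis abs_ge_self abs_mult)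
    also have "\<dots> \<le> L * \<bar>x - y\<bar>" using \<phi>L[OF t] by (intro mult_right_mono) auto
    finally have "F t + \<phi> t * (x - t) \<le> F t + \<phi> t * (y - t) + L * \<bar>x - y\<bar>" by (simp add: algebra_simps)
    moreover have "0 \<le> L * \<bar>x - y\<bar>" using Fb unfolding L_def by (intro mult_nonneg_nonneg) auto
    ultimately show ?thesis unfolding l_def by linarith
  qed
  have l_le: "l t x \<le> F x" if "a \<le> t" "0 < x" for t x
    using \<phi>[of t x] nonneg[of x] that ab by (auto simp: l_def)
  define g where "g = (\<lambda>x. SUP t\<in>{a..b}. l t x)"
  have ne: "{a..b} \<noteq> {}" using ab by auto
  have bdd: "bdd_above ((\<lambda>t. l t x) ` {a..b})" for x
  proof (rule bdd_aboveI2)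
    fix t assume "t \<in> {a..b}"
    then show "l t x \<le> F a + L * \<bar>x - a\<bar>" using l_lip[of t x a] l_le[of t a] ab by force
  qed
  have upper: "l t x \<le> g x" if "a \<le> t" "t \<le> b" for t x
    unfolding g_def using that by (intro cSUP_upper bdd) auto
  have least: "g x \<le> u" if "\<And>t. a \<le> t \<Longrightarrow> t \<le> b \<Longrightarrow> l t x \<le> u" for x u
    unfolding g_def using that by (intro cSUP_least ne) auto
  have g_lip: "g x \<le> g y + L * \<bar>x - y\<bar>" for x y
  proof (rule least)
    fix t assume t: "a \<le> t" "t \<le> b"
    show "l t x \<le> g y + L * \<bar>x - y\<bar>" using l_lip[OF t, of x y] upper[OF t, of y] by linarith
  qed
  show thesis
  proof
    show "convex_on UNIV g"
    proof (rule convex_onI)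
      fix s x y :: real assume s: "0 < s" "s < 1"
      show "g ((1 - s) *\<^sub>R x + s *\<^sub>R y) \<le> (1 - s) * g x + s * g y"
      proof (rule least)
        fix t assume t: "a \<le> t" "t \<le> b"
        have "F t + \<phi> t * (((1 - s) *\<^sub>R x + s *\<^sub>R y) - t)
            = (1 - s) * (F t + \<phi> t * (x - t)) + s * (F t + \<phi> t * (y - t))"
          by (simp add: algebra_simps)
        also have "\<dots> \<le> (1 - s) * l t x + s * l t y"
          unfolding l_def using s by (intro add_mono mult_left_mono) auto
        moreover have "0 \<le> (1 - s) * l t x + s * l t y"
          unfolding l_def using s by (intro add_nonneg_nonneg mult_nonneg_nonneg) auto
        ultimately have "l t ((1 - s) *\<^sub>R x + s *\<^sub>R y) \<le> (1 - s) * l t x + s * l t y"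
          unfolding l_def by linarith
        also have "\<dots> \<le> (1 - s) * g x + s * g y"
          using s upper[OF t] by (intro add_mono mult_left_mono) auto
        finally show "l t ((1 - s) *\<^sub>R x + s *\<^sub>R y) \<le> (1 - s) * g x + s * g y" .
      qed
    qed simp
    show "\<bar>g x - g y\<bar> \<le> L * \<bar>x - y\<bar>" for x y
      using g_lip[of x y] g_lip[of y x] by (simp add: abs_le_iff abs_minus_commute)
    show "0 \<le> g x" for x using upper[of a x] ab by (auto simp: l_def)
    show le: "g x \<le> F x" if "0 < x" for x by (rule least) (use l_le that in auto)
    show "g x = F x" if x: "a \<le> x" "x \<le> b" for x
    proof (rule antisym)
      show "g x \<le> F x" using le x ab by auto
      show "F x \<le> g x" using upper[OF x, of x] by (simp add: l_def)
    qed
  qed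
qed

section \<open>The law of large numbers in mean\<close>

abbreviation iid :: "'a measure \<Rightarrow> nat \<Rightarrow> (nat \<Rightarrow> 'a) measure" where
  "iid N n \<equiv> Pi\<^sub>M {..<n} (\<lambda>_. N)"

definition sample_mean :: "nat \<Rightarrow> ('a \<Rightarrow> real) \<Rightarrow> (nat \<Rightarrow> 'a) \<Rightarrow> real" where
  "sample_mean n h u = (\<Sum>i<n. h (u i)) / n"

lemma prob_space_iid: "prob_space N \<Longrightarrow> prob_space (iid N n)"
  by (rule prob_space_PiM)

lemma measurable_sample_mean [measurable]:
  "h \<in> borel_measurable N \<Longrightarrow> sample_mean n h \<in> borel_measurable (iid N n)"
  unfolding sample_mean_def
  by (intro borel_measurable_divide borel_measurable_sum borel_measurable_const
      measurable_compose[OF measurable_component_singleton]) auto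

lemma iid_component_integral:
  fixes h :: "'a \<Rightarrow> real"
  assumes "prob_space N" "i < n" and [measurable]: "h \<in> borel_measurable N"
  shows "(LINT u|iid N n. h (u i)) = (LINT z|N. h z)"
    and "integrable (iid N n) (\<lambda>u. h (u i)) \<longleftrightarrow> integrable N h"
proof -
  have d: "distr (iid N n) N (\<lambda>u. u i) = N"
    using assms by (intro distr_PiM_component) auto
  have [measurable]: "(\<lambda>u. u i) \<in> measurable (iid N n) N" using assms(2) by (intro measurable_component_singleton) auto
  have "(LINT u|iid N n. h (u i)) = (LINT z|distr (iid N n) N (\<lambda>u. u i). h z)"
    by (rule integral_distr[symmetric]) auto
  then show "(LINT u|iid N n. h (u i)) = (LINT z|N. h z)" by (simp only: d)
  have "integrable (distr (iid N n) N (\<lambda>u. u i)) h \<longleftrightarrow> integrable (iid N n) (\<lambda>u. h (u i))"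
    by (rule integrable_distr_eq) auto
  then show "integrable (iid N n) (\<lambda>u. h (u i)) \<longleftrightarrow> integrable N h" by (simp only: d)
qed

lemma sample_mean_integral:
  assumes "prob_space N" "0 < n" and h: "integrable N h"
  shows "integrable (iid N n) (sample_mean n h)" "(LINT u|iid N n. sample_mean n h u) = (LINT z|N. h z)"
proof -
  have [measurable]: "h \<in> borel_measurable N" using h by auto
  have i: "integrable (iid N n) (\<lambda>u. h (u i))" if "i < n" for i
    using iid_component_integral(2)[OF \<open>prob_space N\<close> that] h by simp
  show "integrable (iid N n) (sample_mean n h)"
    unfolding sample_mean_def using i by (intro integrable_divide Bochner_Integration.integrable_sum) auto
  have "(LINT u|iid N n. sample_mean n h u) = (\<Sum>i<n. (LINT u|iid N n. h (u i))) / n"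
    unfolding sample_mean_def using i by (simp add: Bochner_Integration.integral_sum)
  also have "\<dots> = (\<Sum>i<n. (LINT z|N. h z)) / n"
    using iid_component_integral(1)[OF \<open>prob_space N\<close>] by (intro arg_cong2[where f="(/)"] sum.cong) auto
  finally show "(LINT u|iid N n. sample_mean n h u) = (LINT z|N. h z)" using \<open>0 < n\<close> by simp
qed

text \<open>Padding the product with the constant 1 in the other coordinates lets the integral
  factorise over all of them; two of the factors are the vanishing mean.\<close>

lemma iid_product_moment:
  fixes \<phi> :: "'a \<Rightarrow> real"
  assumes "prob_space N" and ij: "i < n" "j < n" "i \<noteq> j" and \<phi>: "integrable N \<phi>" "(LINT z|N. \<phi> z) = 0"
  shows "(LINT u|iid N n. \<phi> (u i) * \<phi> (u j)) = 0"
proof -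
  interpret N: prob_space N by fact
  interpret product_sigma_finite "\<lambda>_::nat. N" by standard
  let ?f = "\<lambda>k z. if k \<in> {i, j} then \<phi> z else 1"
  have "(\<Prod>k<n. ?f k (u k)) = \<phi> (u i) * \<phi> (u j)" for u
  proof -
    have "(\<Prod>k<n. ?f k (u k)) = (\<Prod>k\<in>{i, j}. \<phi> (u k))"
      using ij by (intro prod.mono_neutral_cong_right) auto
    then show ?thesis using ij by simp
  qed
  then have "(LINT u|iid N n. \<phi> (u i) * \<phi> (u j)) = (LINT u|iid N n. (\<Prod>k<n. ?f k (u k)))" by simp
  also have "\<dots> = (\<Prod>k<n. (LINT z|N. ?f k z))"
  proof (rule product_integral_prod)
    show "integrable N (?f k)" for k using \<phi> by (cases "k \<in> {i, j}") simp_all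
  qed simp
  also have "\<dots> = 0" using ij \<phi> by (intro prod_zero bexI[of _ i]) auto
  finally show ?thesis .
qed

text \<open>A variance bound: centred values are at most \<open>2 * K\<close>, and off-diagonal
  products have mean zero, so the square of their sum has mean at most
  \<open>4 * K\<^sup>2 * n\<close>.\<close>

lemma sample_mean_bounded:
  assumes "prob_space N" "0 < n" and [measurable]: "h \<in> borel_measurable N" and K: "\<And>z. \<bar>h z\<bar> \<le> K"
  shows "(LINT u|iid N n. \<bar>sample_mean n h u - (LINT z|N. h z)\<bar>) \<le> (4 * K\<^sup>2 + 1) / sqrt n"
proof -
  interpret N: prob_space N by fact
  interpret U: prob_space "iid N n" by (rule prob_space_iid) fact
  define m where "m = (LINT z|N. h z)"
  define \<phi> where "\<phi> = (\<lambda>z. h z - m)"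
  have ih: "integrable N h" by (rule N.integrable_const_bound[of _ K]) (use K in auto)
  have K0: "0 \<le> K" using K[of undefined] by linarith
  have "\<bar>m\<bar> \<le> K" unfolding m_def
    using N.integral_le_const[OF ih, of K] N.integral_ge_const[OF ih, of "-K"] K by (auto simp: abs_le_iff minus_le_iff)
  then have \<phi>K: "\<bar>\<phi> z\<bar> \<le> 2 * K" for z
    unfolding \<phi>_def using K[of z] by linarith
  have [measurable]: "\<phi> \<in> borel_measurable N" by (simp add: \<phi>_def)
  have i\<phi>: "integrable N \<phi>" by (simp add: \<phi>_def ih)
  have \<phi>0: "(LINT z|N. \<phi> z) = 0" using ih by (simp add: \<phi>_def m_def N.prob_space)
  have [measurable]: "(\<lambda>u. \<phi> (u i)) \<in> borel_measurable (iid N n)" if "i < n" for i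
    using that by (intro measurable_compose[OF measurable_component_singleton]) auto
  have i2: "integrable (iid N n) (\<lambda>u. \<phi> (u i) * \<phi> (u j))" if "i < n" "j < n" for i j
  proof (rule U.integrable_const_bound[of _ "(2 * K) * (2 * K)"])
    show "AE u in iid N n. norm (\<phi> (u i) * \<phi> (u j)) \<le> (2 * K) * (2 * K)"
      using mult_mono[OF \<phi>K \<phi>K] K0 by (auto simp only: real_norm_def abs_mult intro!: AE_I2)
  qed (use that in auto)
  define T where "T = (\<lambda>u. (\<Sum>i<n. \<phi> (u i)))"
  have T2: "(T u)\<^sup>2 = (\<Sum>i<n. \<Sum>j<n. \<phi> (u i) * \<phi> (u j))" for u
    by (simp add: T_def power2_eq_square sum_product)
  have iT2: "integrable (iid N n) (\<lambda>u. (T u)\<^sup>2)" unfolding T2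
    by (intro Bochner_Integration.integrable_sum i2) auto
  have "(LINT u|iid N n. (T u)\<^sup>2) = (\<Sum>i<n. \<Sum>j<n. (LINT u|iid N n. \<phi> (u i) * \<phi> (u j)))"
    unfolding T2
    by (subst Bochner_Integration.integral_sum, (intro Bochner_Integration.integrable_sum i2; simp),
        intro sum.cong refl, subst Bochner_Integration.integral_sum, intro i2, auto)
  also have "\<dots> \<le> (\<Sum>i<n. \<Sum>j<n. if j = i then (2 * K) * (2 * K) else 0)"
  proof (intro sum_mono)
    fix i j assume ij: "i \<in> {..<n}" "j \<in> {..<n}"
    show "(LINT u|iid N n. \<phi> (u i) * \<phi> (u j)) \<le> (if j = i then (2 * K) * (2 * K) else 0)"
    proof (cases "j = i")
      case True
      have "\<phi> z * \<phi> z \<le> (2 * K) * (2 * K)" for z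
        using mult_mono[OF \<phi>K[of z] \<phi>K[of z]] K0 by (simp add: abs_mult[symmetric])
      then show ?thesis using True ij i2 by (auto intro!: U.integral_le_const)
    next
      case False
      then show ?thesis using iid_product_moment[OF \<open>prob_space N\<close> _ _ _ i\<phi> \<phi>0, of i n j] ij by auto
    qed
  qed
  also have "\<dots> = 4 * K\<^sup>2 * n" by (simp add: power2_eq_square)
  finally have ET: "(LINT u|iid N n. (T u)\<^sup>2) \<le> 4 * K\<^sup>2 * n" .
  have bd: "\<bar>sample_mean n h u - m\<bar> \<le> (T u)\<^sup>2 / (n * sqrt n) + 1 / sqrt n" for u
  proof -
    have "sample_mean n h u - m = T u / n"
      using \<open>0 < n\<close> by (simp add: sample_mean_def T_def \<phi>_def sum_subtractf diff_divide_distrib)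
    \<comment> \<open>The arithmetic-geometric mean inequality passes pointwise from the square to
      the absolute value; the term \<open>sqrt n\<close> is the source of the \<open>+ 1\<close> in
      the constant.\<close>
    moreover have "\<bar>T u\<bar> \<le> (T u)\<^sup>2 / sqrt n + sqrt n"
    proof -
      have "\<bar>T u\<bar> * sqrt n \<le> (T u)\<^sup>2 + (sqrt n)\<^sup>2"
      proof -
        have "2 * (\<bar>T u\<bar> * sqrt n) \<le> (T u)\<^sup>2 + (sqrt n)\<^sup>2"
          using sum_squares_bound[of "\<bar>T u\<bar>" "sqrt n"] by (simp add: mult.assoc)
        moreover have "0 \<le> \<bar>T u\<bar> * sqrt n" by simp
        ultimately show ?thesis by linarith
      qed
      then show ?thesis using \<open>0 < n\<close> by (simp add: pos_le_divide_eq field_simps)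
    qed
    then have "\<bar>T u\<bar> / n \<le> ((T u)\<^sup>2 / sqrt n + sqrt n) / n" by (rule divide_right_mono) simp
    moreover have "sqrt n / n = 1 / sqrt n" using \<open>0 < n\<close> by (simp add: real_div_sqrt field_simps)
    ultimately show ?thesis by (simp add: abs_divide add_divide_distrib mult.commute)
  qed
  have "(LINT u|iid N n. \<bar>sample_mean n h u - m\<bar>) \<le> (LINT u|iid N n. (T u)\<^sup>2 / (n * sqrt n) + 1 / sqrt n)"
    using sample_mean_integral(1)[OF \<open>prob_space N\<close> \<open>0 < n\<close> ih] iT2
    by (intro integral_mono bd) auto
  also have "\<dots> = (LINT u|iid N n. (T u)\<^sup>2) / (n * sqrt n) + 1 / sqrt n"
    using iT2 by (simp add: U.prob_space)
  also have "\<dots> \<le> (4 * K\<^sup>2 * n) / (n * sqrt n) + 1 / sqrt n"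
    using ET by (intro add_right_mono divide_right_mono) auto
  also have "\<dots> = (4 * K\<^sup>2 + 1) / sqrt n" using \<open>0 < n\<close> by (simp add: add_divide_distrib)
  finally show ?thesis unfolding m_def .
qed

text \<open>For nonnegative \<open>h\<close> the triangle inequality and unbiasedness give a bound
  free of \<open>n\<close>. It controls truncation remainders and serves as a dominating
  function.\<close>

lemma sample_mean_L1_le:
  assumes "prob_space N" "0 < n" and h: "integrable N h" and h0: "\<And>z. 0 \<le> h z"
  shows "(LINT u|iid N n. \<bar>sample_mean n h u - (LINT z|N. h z)\<bar>) \<le> 2 * (LINT z|N. h z)"
proof -
  interpret U: prob_space "iid N n" by (rule prob_space_iid) fact
  note sm = sample_mean_integral[OF assms(1-3)]
  have m0: "0 \<le> (LINT z|N. h z)" using h0 by (intro integral_nonneg_AE) auto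
  have s0: "0 \<le> sample_mean n h u" for u using h0 by (auto simp: sample_mean_def intro!: sum_nonneg divide_nonneg_nonneg)
  have "(LINT u|iid N n. \<bar>sample_mean n h u - (LINT z|N. h z)\<bar>) \<le> (LINT u|iid N n. sample_mean n h u + (LINT z|N. h z))"
  proof (rule integral_mono)
    show "\<bar>sample_mean n h u - (LINT z|N. h z)\<bar> \<le> sample_mean n h u + (LINT z|N. h z)" for u
      using s0[of u] m0 by linarith
  qed (use sm in auto)
  also have "\<dots> = 2 * (LINT z|N. h z)" using sm by (simp add: U.prob_space)
  finally show ?thesis .
qed

text \<open>An integrable \<open>h\<close> may have infinite variance, so it is cut at a level
  \<open>K\<close>: the bounded part obeys the variance bound, the remainder has small mean.\<close>

theorem sample_mean_L1:
  assumes "prob_space N" and h: "integrable N h" and h0: "\<And>z. 0 \<le> h z"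
  shows "(\<lambda>n. (LINT u|iid N n. \<bar>sample_mean n h u - (LINT z|N. h z)\<bar>)) \<longlonglongrightarrow> 0"
proof -
  interpret N: prob_space N by fact
  have [measurable]: "h \<in> borel_measurable N" using h by auto
  define t where "t = (\<lambda>K z. min (h z) (real K))"
  have [measurable]: "t K \<in> borel_measurable N" for K by (simp add: t_def)
  have t: "0 \<le> t K z" "t K z \<le> h z" "\<bar>t K z\<bar> \<le> real K" for K z using h0[of z] by (auto simp: t_def)
  have it: "integrable N (t K)" for K
    by (rule Bochner_Integration.integrable_bound[OF h]) (use t h0 in auto)
  have "(\<lambda>K. (LINT z|N. h z - t K z)) \<longlonglongrightarrow> (LINT z|N. 0)"
  proof (rule integral_dominated_convergence[where w=h])
    show "AE z in N. (\<lambda>K. h z - t K z) \<longlonglongrightarrow> 0"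
    proof (intro AE_I2)
      fix z
      obtain K0 where "h z \<le> real K0" using real_arch_simple by blast
      then have "\<forall>\<^sub>F K in sequentially. h z - t K z = 0"
        unfolding eventually_sequentially by (intro exI[of _ K0]) (auto simp: t_def min_def)
      then show "(\<lambda>K. h z - t K z) \<longlonglongrightarrow> 0" by (rule tendsto_eventually)
    qed
  qed (use h t in auto)
  then have tail: "(\<lambda>K. (LINT z|N. h z - t K z)) \<longlonglongrightarrow> 0" by simp
  show ?thesis
  proof (rule LIMSEQ_I)
    fix r :: real assume r: "0 < r"
    \<comment> \<open>A quarter, because the mean of the remainder enters twice.\<close>
    obtain K where "\<bar>LINT z|N. h z - t K z\<bar> < r / 4"
      using LIMSEQ_D[OF tail, of "r / 4"] r by auto
    then have K: "(LINT z|N. h z - t K z) < r / 4" by linarith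
    have "(\<lambda>n. (4 * (real K)\<^sup>2 + 1) / sqrt (real n)) \<longlonglongrightarrow> 0"
      by (intro real_tendsto_divide_at_top[OF tendsto_const] filterlim_compose[OF sqrt_at_top filterlim_real_sequentially])
    from LIMSEQ_D[OF this, of "r / 2"] r obtain n0 where
      n0: "\<And>n. n \<ge> n0 \<Longrightarrow> \<bar>(4 * (real K)\<^sup>2 + 1) / sqrt (real n)\<bar> < r / 2" by auto
    show "\<exists>no. \<forall>n\<ge>no. norm ((LINT u|iid N n. \<bar>sample_mean n h u - (LINT z|N. h z)\<bar>) - 0) < r"
    proof (intro exI[of _ "max n0 1"] allI impI)
      fix n assume "n \<ge> max n0 1"
      then have n: "n \<ge> n0" "0 < n" by auto
      interpret U: prob_space "iid N n" by (rule prob_space_iid) fact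
      let ?d = "\<lambda>z. h z - t K z"
      have id: "integrable N ?d" using h it by auto
      have split: "\<bar>sample_mean n h u - (LINT z|N. h z)\<bar>
          \<le> \<bar>sample_mean n (t K) u - (LINT z|N. t K z)\<bar> + \<bar>sample_mean n ?d u - (LINT z|N. ?d z)\<bar>" for u
      proof -
        have "sample_mean n h u = sample_mean n (t K) u + sample_mean n ?d u"
          by (simp add: sample_mean_def sum_subtractf add_divide_distrib[symmetric])
        moreover have "(LINT z|N. h z) = (LINT z|N. t K z) + (LINT z|N. ?d z)" using h it by simp
        ultimately show ?thesis by linarith
      qed
      note sm = sample_mean_integral(1)[OF \<open>prob_space N\<close> \<open>0 < n\<close>]
      have "(LINT u|iid N n. \<bar>sample_mean n h u - (LINT z|N. h z)\<bar>)
          \<le> (LINT u|iid N n. \<bar>sample_mean n (t K) u - (LINT z|N. t K z)\<bar> + \<bar>sample_mean n ?d u - (LINT z|N. ?d z)\<bar>)"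
        using sm[OF h] sm[OF it] sm[OF id] by (intro integral_mono split) auto
      also have "\<dots> = (LINT u|iid N n. \<bar>sample_mean n (t K) u - (LINT z|N. t K z)\<bar>)
          + (LINT u|iid N n. \<bar>sample_mean n ?d u - (LINT z|N. ?d z)\<bar>)"
        using sm[OF it] sm[OF id] by (intro Bochner_Integration.integral_add) auto
      also have "\<dots> \<le> (4 * (real K)\<^sup>2 + 1) / sqrt (real n) + 2 * (LINT z|N. ?d z)"
        using t by (intro add_mono sample_mean_bounded sample_mean_L1_le \<open>prob_space N\<close> n id) auto
      also have "\<dots> < r" using n0[OF n(1)] K by linarith
      finally have "(LINT u|iid N n. \<bar>sample_mean n h u - (LINT z|N. h z)\<bar>) < r" .
      moreover have "0 \<le> (LINT u|iid N n. \<bar>sample_mean n h u - (LINT z|N. h z)\<bar>)"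
        by (intro integral_nonneg_AE) auto
      ultimately show "norm ((LINT u|iid N n. \<bar>sample_mean n h u - (LINT z|N. h z)\<bar>) - 0) < r" by simp
    qed
  qed
qed

theorem sample_mean_L1_random:
  fixes g :: "'a \<Rightarrow> 'b \<Rightarrow> real"
  assumes "prob_space P" "prob_space N" and g: "integrable (P \<Otimes>\<^sub>M N) (\<lambda>(\<omega>, z). g \<omega> z)" and g0: "\<And>\<omega> z. 0 \<le> g \<omega> z"
  shows "(\<lambda>n. (LINT \<omega>|P. LINT u|iid N n. \<bar>sample_mean n (g \<omega>) u - (LINT z|N. g \<omega> z)\<bar>)) \<longlonglongrightarrow> 0"
proof -
  interpret P: prob_space P by fact
  interpret N: prob_space N by fact
  interpret PN: pair_prob_space P N ..
  have [measurable]: "(\<lambda>(\<omega>, z). g \<omega> z) \<in> borel_measurable (P \<Otimes>\<^sub>M N)" using g by auto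
  have ae: "AE \<omega> in P. integrable N (g \<omega>)" using PN.AE_integrable_fst'[OF g] by simp
  have ig: "integrable P (\<lambda>\<omega>. LINT z|N. g \<omega> z)" using PN.integrable_fst'[OF g] by simp
  define H where "H = (\<lambda>n \<omega>. LINT u|iid N n. \<bar>sample_mean n (g \<omega>) u - (LINT z|N. g \<omega> z)\<bar>)"
  have [measurable]: "H n \<in> borel_measurable P" for n
  proof -
    interpret U: prob_space "iid N n" by (rule prob_space_iid) fact
    have "(\<lambda>(\<omega>, u). \<bar>sample_mean n (g \<omega>) u - (LINT z|N. g \<omega> z)\<bar>) \<in> borel_measurable (P \<Otimes>\<^sub>M iid N n)"
      unfolding sample_mean_def by measurable
    then show ?thesis unfolding H_def by (rule U.borel_measurable_lebesgue_integral)
  qed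
  \<comment> \<open>Dominated convergence in \<omega>. The shift to \<open>Suc n\<close> keeps the
    sample nonempty, as the dominating bound asks.\<close>
  have "(\<lambda>n. LINT \<omega>|P. H (Suc n) \<omega>) \<longlonglongrightarrow> (LINT \<omega>|P. 0)"
  proof (rule integral_dominated_convergence[where w="\<lambda>\<omega>. 2 * (LINT z|N. g \<omega> z)"])
    show "AE \<omega> in P. (\<lambda>n. H (Suc n) \<omega>) \<longlonglongrightarrow> 0"
      using ae
    proof eventually_elim
      case (elim \<omega>)
      show ?case unfolding H_def by (rule LIMSEQ_Suc[OF sample_mean_L1[OF \<open>prob_space N\<close> elim g0]])
    qed
    show "AE \<omega> in P. norm (H (Suc n) \<omega>) \<le> 2 * (LINT z|N. g \<omega> z)" for n
      using ae
    proof eventually_elim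
      case (elim \<omega>)
      have "0 \<le> H (Suc n) \<omega>" unfolding H_def by (intro integral_nonneg_AE) auto
      then show ?case using sample_mean_L1_le[OF \<open>prob_space N\<close> _ elim g0, of "Suc n"] unfolding H_def by simp
    qed
  qed (use ig in auto)
  then have "(\<lambda>n. LINT \<omega>|P. H (Suc n) \<omega>) \<longlonglongrightarrow> 0" by simp
  then show ?thesis unfolding H_def by (rule LIMSEQ_imp_Suc)
qed

section \<open>Total mass of the chaos\<close>

lemma sample_mean_pair_integrable:
  fixes g :: "'a \<Rightarrow> 'b \<Rightarrow> real"
  assumes "prob_space P" "prob_space N" "0 < n"
    and g: "integrable (P \<Otimes>\<^sub>M N) (\<lambda>(\<omega>, z). g \<omega> z)" and g0: "\<And>\<omega> z. 0 \<le> g \<omega> z"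
  shows "integrable (P \<Otimes>\<^sub>M iid N n) (\<lambda>(\<omega>, u). sample_mean n (g \<omega>) u)"
proof -
  interpret P: prob_space P by fact
  interpret N: prob_space N by fact
  interpret PN: pair_prob_space P N ..
  interpret U: prob_space "iid N n" by (rule prob_space_iid) fact
  interpret PU: pair_prob_space P "iid N n" ..
  have [measurable]: "(\<lambda>(\<omega>, z). g \<omega> z) \<in> borel_measurable (P \<Otimes>\<^sub>M N)" using g by auto
  have ae: "AE \<omega> in P. integrable N (g \<omega>)" using PN.AE_integrable_fst'[OF g] by simp
  have ig: "integrable P (\<lambda>\<omega>. LINT z|N. g \<omega> z)" using PN.integrable_fst'[OF g] by simp
  have s0: "0 \<le> sample_mean n (g \<omega>) u" for \<omega> u
    using g0 by (auto simp: sample_mean_def intro!: sum_nonneg divide_nonneg_nonneg)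
  show ?thesis
  proof (rule PU.Fubini_integrable)
    show meas: "(\<lambda>(\<omega>, u). sample_mean n (g \<omega>) u) \<in> borel_measurable (P \<Otimes>\<^sub>M iid N n)"
      unfolding sample_mean_def by measurable
    have "AE \<omega> in P. (LINT u|iid N n. norm (sample_mean n (g \<omega>) u)) = (LINT z|N. g \<omega> z)"
      using ae by eventually_elim (simp add: s0 sample_mean_integral(2)[OF assms(2,3)])
    moreover have "(\<lambda>\<omega>. LINT u|iid N n. norm (sample_mean n (g \<omega>) u)) \<in> borel_measurable P"
      using meas by (intro U.borel_measurable_lebesgue_integral) (auto simp: split_def)
    ultimately show "integrable P (\<lambda>\<omega>. LINT u|iid N n. norm (case (\<omega>, u) of (\<omega>, u) \<Rightarrow> sample_mean n (g \<omega>) u))"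
      using ig by (subst integrable_cong_AE[where g="\<lambda>\<omega>. LINT z|N. g \<omega> z"]) auto
    show "AE \<omega> in P. integrable (iid N n) (\<lambda>u. case (\<omega>, u) of (\<omega>, u) \<Rightarrow> sample_mean n (g \<omega>) u)"
      using ae by eventually_elim (simp add: sample_mean_integral(1)[OF assms(2,3)])
  qed
qed

text \<open>The sampled points are made the outer variable: once they are fixed, the inner
  expectation concerns a finite vector and can be compared.\<close>

lemma (in smooth_convex) sample_mean_swap:
  fixes g :: "'a \<Rightarrow> 'b \<Rightarrow> real"
  assumes "prob_space P" "prob_space N" "0 < n"
    and g: "integrable (P \<Otimes>\<^sub>M N) (\<lambda>(\<omega>, z). g \<omega> z)" and g0: "\<And>\<omega> z. 0 \<le> g \<omega> z"
  shows "integrable (iid N n) (\<lambda>u. LINT \<omega>|P. f (m * sample_mean n (g \<omega>) u))"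
    and "(LINT u|iid N n. LINT \<omega>|P. f (m * sample_mean n (g \<omega>) u))
       = (LINT p|(P \<Otimes>\<^sub>M iid N n). f (m * sample_mean n (g (fst p)) (snd p)))"
    and "integrable (P \<Otimes>\<^sub>M iid N n) (\<lambda>p. f (m * sample_mean n (g (fst p)) (snd p)))"
proof -
  interpret P: prob_space P by fact
  interpret U: prob_space "iid N n" by (rule prob_space_iid) fact
  interpret PU: pair_prob_space P "iid N n" ..
  have "integrable (P \<Otimes>\<^sub>M iid N n) (\<lambda>p. m * sample_mean n (g (fst p)) (snd p))"
    using sample_mean_pair_integrable[OF assms] by (simp add: split_def)
  then show i: "integrable (P \<Otimes>\<^sub>M iid N n) (\<lambda>p. f (m * sample_mean n (g (fst p)) (snd p)))"
    by (rule integrable_f[OF PU.finite_measure_axioms])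
  then have i': "integrable (P \<Otimes>\<^sub>M iid N n) (\<lambda>(\<omega>, u). f (m * sample_mean n (g \<omega>) u))"
    by (simp add: split_def)
  show "integrable (iid N n) (\<lambda>u. LINT \<omega>|P. f (m * sample_mean n (g \<omega>) u))"
    by (rule PU.integrable_snd[OF i'])
  show "(LINT u|iid N n. LINT \<omega>|P. f (m * sample_mean n (g \<omega>) u))
       = (LINT p|(P \<Otimes>\<^sub>M iid N n). f (m * sample_mean n (g (fst p)) (snd p)))"
    using PU.integral_snd[OF i'] by (simp add: split_def)
qed

text \<open>Convergence in mean passes through \<open>f\<close> because \<open>f\<close> is
  Lipschitz. The factor \<open>m\<close> will be the area of the domain.\<close>

lemma (in smooth_convex) sample_mean_expectation_tendsto:
  fixes g :: "'a \<Rightarrow> 'b \<Rightarrow> real"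
  assumes "prob_space P" "prob_space N"
    and g: "integrable (P \<Otimes>\<^sub>M N) (\<lambda>(\<omega>, z). g \<omega> z)" and g0: "\<And>\<omega> z. 0 \<le> g \<omega> z"
  shows "(\<lambda>n. LINT u|iid N (Suc n). LINT \<omega>|P. f (m * sample_mean (Suc n) (g \<omega>) u))
      \<longlonglongrightarrow> (LINT \<omega>|P. f (m * (LINT z|N. g \<omega> z)))"
proof -
  interpret P: prob_space P by fact
  interpret N: prob_space N by fact
  interpret PN: pair_prob_space P N ..
  have ig: "integrable P (\<lambda>\<omega>. LINT z|N. g \<omega> z)" using PN.integrable_fst'[OF g] by simp
  have ifg: "integrable P (\<lambda>\<omega>. f (m * (LINT z|N. g \<omega> z)))"
    by (intro integrable_f P.finite_measure_axioms integrable_mult_right ig)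
  define e where "e = (\<lambda>n. LINT \<omega>|P. LINT u|iid N n. \<bar>sample_mean n (g \<omega>) u - (LINT z|N. g \<omega> z)\<bar>)"
  have bound: "\<bar>(LINT u|iid N n. LINT \<omega>|P. f (m * sample_mean n (g \<omega>) u)) - (LINT \<omega>|P. f (m * (LINT z|N. g \<omega> z)))\<bar>
      \<le> L * \<bar>m\<bar> * e n" if n: "0 < n" for n
  proof -
    interpret U: prob_space "iid N n" by (rule prob_space_iid) fact
    interpret PU: pair_prob_space P "iid N n" ..
    let ?s = "\<lambda>p. sample_mean n (g (fst p)) (snd p)" and ?c = "\<lambda>p. LINT z|N. g (fst p) z"
    have fst_int: "integrable (P \<Otimes>\<^sub>M iid N n) (\<lambda>p. h (fst p))"
      "(LINT p|(P \<Otimes>\<^sub>M iid N n). h (fst p)) = (LINT \<omega>|P. h \<omega>)" if h: "integrable P h" for h :: "'a \<Rightarrow> real"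
    proof -
      have [measurable]: "h \<in> borel_measurable P" using h by auto
      show i: "integrable (P \<Otimes>\<^sub>M iid N n) (\<lambda>p. h (fst p))"
        by (rule PU.Fubini_integrable) (use h in \<open>auto simp: U.prob_space\<close>)
      show "(LINT p|(P \<Otimes>\<^sub>M iid N n). h (fst p)) = (LINT \<omega>|P. h \<omega>)"
        using PU.integral_fst'[OF i] by (simp add: U.prob_space)
    qed
    have is_int: "integrable (P \<Otimes>\<^sub>M iid N n) ?s"
      using sample_mean_pair_integrable[OF assms(1,2) n g g0] by (simp add: split_def)
    have id: "integrable (P \<Otimes>\<^sub>M iid N n) (\<lambda>p. \<bar>?s p - ?c p\<bar>)" using is_int fst_int(1)[OF ig] by simp
    note swap = sample_mean_swap[OF assms(1,2) n g g0, of m]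
    have "(LINT u|iid N n. LINT \<omega>|P. f (m * sample_mean n (g \<omega>) u)) - (LINT \<omega>|P. f (m * (LINT z|N. g \<omega> z)))
       = (LINT p|(P \<Otimes>\<^sub>M iid N n). f (m * ?s p) - f (m * ?c p))"
      using swap(3) fst_int[OF ifg] unfolding swap(2) by simp
    also have "\<bar>\<dots>\<bar> \<le> (LINT p|(P \<Otimes>\<^sub>M iid N n). \<bar>f (m * ?s p) - f (m * ?c p)\<bar>)"
      by (rule integral_abs_bound)
    also have "\<dots> \<le> (LINT p|(P \<Otimes>\<^sub>M iid N n). L * \<bar>m\<bar> * \<bar>?s p - ?c p\<bar>)"
    proof (rule integral_mono)
      show "\<bar>f (m * ?s p) - f (m * ?c p)\<bar> \<le> L * \<bar>m\<bar> * \<bar>?s p - ?c p\<bar>" for p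
        using f_lipschitz[of "m * ?s p" "m * ?c p"] by (simp add: right_diff_distrib[symmetric] abs_mult mult.assoc)
    qed (use swap(3) fst_int[OF ifg] id in auto)
    also have "\<dots> = L * \<bar>m\<bar> * e n"
      using PU.integral_fst'[OF id] by (simp add: e_def)
    finally show ?thesis .
  qed
  have "(\<lambda>n. L * \<bar>m\<bar> * e (Suc n)) \<longlonglongrightarrow> L * \<bar>m\<bar> * 0"
    unfolding e_def by (intro tendsto_mult tendsto_const LIMSEQ_Suc[OF sample_mean_L1_random] assms)
  then have "(\<lambda>n. L * \<bar>m\<bar> * e (Suc n)) \<longlonglongrightarrow> 0" by simp
  then have "(\<lambda>n. (LINT u|iid N (Suc n). LINT \<omega>|P. f (m * sample_mean (Suc n) (g \<omega>) u))
      - (LINT \<omega>|P. f (m * (LINT z|N. g \<omega> z)))) \<longlonglongrightarrow> 0"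
    by (rule Lim_null_comparison[rotated]) (use bound in auto)
  then show ?thesis by (rule LIM_zero_cancel)
qed

text \<open>Built on the restricted space, so that its points lie in \<open>D\<close> surely and the
  measurability of the field, given on \<open>restrict_space borel D\<close>, applies
  directly.\<close>

definition uniform_on :: "complex set \<Rightarrow> complex measure" where
  "uniform_on D = density (restrict_space lborel D) (\<lambda>_. ennreal (1 / measure lborel D))"

lemma sets_uniform_on [measurable_cong]: "sets (uniform_on D) = sets (restrict_space borel D)"
  by (simp add: uniform_on_def sets_restrict_space)

lemma space_uniform_on [simp]: "space (uniform_on D) = D"
  by (simp add: uniform_on_def space_restrict_space)

lemma bounded_open_measure_pos:
  fixes D :: "complex set"
  assumes "open D" "bounded D" "D \<noteq> {}"
  shows "0 < measure lborel D" "emeasure lborel D = ennreal (measure lborel D)"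
proof -
  have fin: "emeasure lborel D < \<infinity>"
    using emeasure_bounded_finite[OF \<open>bounded D\<close>] by simp
  then show "emeasure lborel D = ennreal (measure lborel D)" by (simp add: emeasure_eq_ennreal_measure)
  obtain x e where "e > 0" "ball x e \<subseteq> D" using assms(1,3) by (meson all_not_in_conv openE)
  have "0 < measure lborel (ball x e)" using \<open>e > 0\<close> by (simp add: content_ball_pos)
  also have "\<dots> \<le> measure lborel D"
    using fin \<open>ball x e \<subseteq> D\<close> \<open>open D\<close> by (intro measure_mono_fmeasurable) (auto simp: fmeasurable_def)
  finally show "0 < measure lborel D" .
qed

lemma prob_space_uniform_on:
  assumes "open D" "bounded D" "D \<noteq> {}"
  shows "prob_space (uniform_on D)"
proof (rule prob_spaceI)
  have "emeasure (uniform_on D) (space (uniform_on D)) = ennreal (1 / measure lborel D) * emeasure lborel D"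
    using \<open>open D\<close> unfolding uniform_on_def
    by (simp add: emeasure_density space_restrict_space emeasure_restrict_space nn_integral_cmult_indicator
        sets_restrict_space_iff)
  also have "\<dots> = 1"
    using bounded_open_measure_pos[OF assms] by (simp add: ennreal_mult'[symmetric])
  finally show "emeasure (uniform_on D) (space (uniform_on D)) = 1" .
qed

lemma uniform_on_integral:
  fixes h :: "complex \<Rightarrow> real"
  assumes "open D" "bounded D" "D \<noteq> {}" and h: "h \<in> borel_measurable (uniform_on D)"
  shows "(LINT z:D|lborel. h z) = measure lborel D * (LINT z|uniform_on D. h z)"
proof -
  have "h \<in> borel_measurable (restrict_space lborel D)" using h by (simp add: uniform_on_def)
  then have "(LINT z|uniform_on D. h z) = (LINT z|restrict_space lborel D. (1 / measure lborel D) *\<^sub>R h z)"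
    unfolding uniform_on_def by (intro integral_density) auto
  also have "\<dots> = (1 / measure lborel D) * (LINT z:D|lborel. h z)"
    using \<open>open D\<close> by (simp add: integral_restrict_space set_lebesgue_integral_def)
  finally show ?thesis using bounded_open_measure_pos[OF assms(1-3)] by simp
qed

section \<open>Density and total mass over a bounded open domain\<close>

locale gaussian_chaos =
  fixes P :: "'a measure" and D :: "complex set" and \<Gamma> :: "complex \<Rightarrow> 'a \<Rightarrow> real" and \<gamma> :: real
  assumes open_D: "open D" and bounded_D: "bounded D" and nonempty_D: "D \<noteq> {}"
    and field: "centred_gaussian_field P D \<Gamma>"
begin

definition chaos_density :: "'a \<Rightarrow> complex \<Rightarrow> real" where
  "chaos_density \<omega> z = exp (\<gamma> * \<Gamma> z \<omega> - \<gamma>\<^sup>2 / 2 * covariance_kernel P \<Gamma> z z)"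

sublocale P: prob_space P using field by (simp add: centred_gaussian_field_def)

sublocale N: prob_space "uniform_on D"
  by (rule prob_space_uniform_on[OF open_D bounded_D nonempty_D])

sublocale PN: pair_prob_space P "uniform_on D" ..

lemma chaos_density_pos: "0 < chaos_density \<omega> z" by (simp add: chaos_density_def)

lemma chaos_density_nonneg: "0 \<le> chaos_density \<omega> z" by (simp add: chaos_density_def)

lemma chaos_density_measurable [measurable]:
  "(\<lambda>(\<omega>, z). chaos_density \<omega> z) \<in> borel_measurable (P \<Otimes>\<^sub>M uniform_on D)"
proof -
  have [measurable]: "(\<lambda>(z, \<omega>). \<Gamma> z \<omega>) \<in> borel_measurable (uniform_on D \<Otimes>\<^sub>M P)"
    using field unfolding centred_gaussian_field_def
    by (simp add: measurable_cong_sets[OF sets_pair_measure_cong[OF sets_uniform_on refl] refl])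
  have [measurable]: "(\<lambda>z. covariance_kernel P \<Gamma> z z) \<in> borel_measurable (uniform_on D)"
    unfolding covariance_kernel_def by (rule P.borel_measurable_lebesgue_integral) measurable
  show ?thesis unfolding chaos_density_def by measurable
qed

lemma chaos_density_expectation:
  assumes "z \<in> D"
  shows "integrable P (\<lambda>\<omega>. chaos_density \<omega> z)" "(LINT \<omega>|P. chaos_density \<omega> z) = 1"
proof -
  have "gaussian_vector P {()} (\<lambda>_ \<omega>. \<gamma> * \<Gamma> z \<omega>) (\<lambda>_ _. \<gamma>\<^sup>2 * covariance_kernel P \<Gamma> z z)"
    by (rule gaussian_field_sample[OF field, of "{()}" "\<lambda>_. z"]) (use assms in auto)
  from gaussian_vector_exp_component(1)[OF this, of "()" 1]
  show "integrable P (\<lambda>\<omega>. chaos_density \<omega> z)" "(LINT \<omega>|P. chaos_density \<omega> z) = 1"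
    by (auto simp: chaos_density_def exp_diff has_bochner_integral_iff)
qed

text \<open>For each point of \<open>D\<close> the expectation over \<open>P\<close> is 1, so Fubini
  is applied with the point as outer variable and the factors are swapped afterwards.\<close>

lemma chaos_density_integrable: "integrable (P \<Otimes>\<^sub>M uniform_on D) (\<lambda>(\<omega>, z). chaos_density \<omega> z)"
proof -
  interpret NP: pair_prob_space "uniform_on D" P ..
  have "integrable (uniform_on D \<Otimes>\<^sub>M P) (\<lambda>(z, \<omega>). chaos_density \<omega> z)"
  proof (rule NP.Fubini_integrable)
    show "(\<lambda>(z, \<omega>). chaos_density \<omega> z) \<in> borel_measurable (uniform_on D \<Otimes>\<^sub>M P)" by measurable
    have "integrable (uniform_on D) (\<lambda>z. LINT \<omega>|P. norm (case (z, \<omega>) of (z, \<omega>) \<Rightarrow> chaos_density \<omega> z))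
        \<longleftrightarrow> integrable (uniform_on D) (\<lambda>z. 1 :: real)"
      by (intro Bochner_Integration.integrable_cong refl) (simp add: chaos_density_nonneg chaos_density_expectation)
    then show "integrable (uniform_on D) (\<lambda>z. LINT \<omega>|P. norm (case (z, \<omega>) of (z, \<omega>) \<Rightarrow> chaos_density \<omega> z))"
      by simp
    show "AE z in uniform_on D. integrable P (\<lambda>\<omega>. case (z, \<omega>) of (z, \<omega>) \<Rightarrow> chaos_density \<omega> z)"
      by (rule AE_I2) (simp add: chaos_density_expectation)
  qed
  then show ?thesis using NP.integrable_product_swap by fastforce
qed

lemma chaos_mass_eq:
  assumes "\<omega> \<in> space P"
  shows "chaos_mass \<gamma> P \<Gamma> D \<omega> = measure lborel D * (LINT z|uniform_on D. chaos_density \<omega> z)"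
proof -
  have "chaos_density \<omega> \<in> borel_measurable (uniform_on D)"
    using measurable_Pair2[OF chaos_density_measurable assms] by simp
  then show ?thesis
    unfolding chaos_mass_def chaos_density_def[symmetric]
    by (rule uniform_on_integral[OF open_D bounded_D nonempty_D])
qed

text \<open>The mean is the area of \<open>D\<close> for every covariance, which makes affine
  functions of the two masses equal in expectation.\<close>

lemma chaos_mass_integrable: "integrable P (chaos_mass \<gamma> P \<Gamma> D)"
  and chaos_mass_expectation: "(LINT \<omega>|P. chaos_mass \<gamma> P \<Gamma> D \<omega>) = measure lborel D"
proof -
  have i: "integrable P (\<lambda>\<omega>. LINT z|uniform_on D. chaos_density \<omega> z)"
    using PN.integrable_fst'[OF chaos_density_integrable] by simp
  then show "integrable P (chaos_mass \<gamma> P \<Gamma> D)"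
    by (subst Bochner_Integration.integrable_cong[OF refl chaos_mass_eq]) auto
  have "(LINT \<omega>|P. LINT z|uniform_on D. chaos_density \<omega> z) = (LINT z|uniform_on D. LINT \<omega>|P. chaos_density \<omega> z)"
    by (rule PN.Fubini_integral[symmetric, OF chaos_density_integrable])
  also have "\<dots> = (LINT z|uniform_on D. 1)"
    by (intro Bochner_Integration.integral_cong refl) (simp add: chaos_density_expectation)
  also have "\<dots> = 1" using N.prob_space by simp
  finally show "(LINT \<omega>|P. chaos_mass \<gamma> P \<Gamma> D \<omega>) = measure lborel D"
    by (subst Bochner_Integration.integral_cong[OF refl chaos_mass_eq]) auto
qed

text \<open>Needed because \<open>f\<close> is convex on the positive reals only. A positive
  integrable density has a positive integral; where integrability fails the integral is 0 by
  convention, and this happens on a null event.\<close>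

lemma chaos_mass_pos: "AE \<omega> in P. 0 < chaos_mass \<gamma> P \<Gamma> D \<omega>"
proof -
  have "AE \<omega> in P. integrable (uniform_on D) (chaos_density \<omega>)"
    using PN.AE_integrable_fst'[OF chaos_density_integrable] by simp
  then show ?thesis
  proof (rule AE_mp, intro AE_I2 impI)
    fix \<omega> assume \<omega>: "\<omega> \<in> space P" and i: "integrable (uniform_on D) (chaos_density \<omega>)"
    have "(LINT z|uniform_on D. 0) < (LINT z|uniform_on D. chaos_density \<omega> z)"
      by (rule N.integral_less_AE_space) (use i N.emeasure_space_1 in \<open>auto simp: chaos_density_pos\<close>)
    then show "0 < chaos_mass \<gamma> P \<Gamma> D \<omega>"
      unfolding chaos_mass_eq[OF \<omega>]
      using bounded_open_measure_pos[OF open_D bounded_D nonempty_D] by simp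
  qed
qed

lemma sample_gaussian_vector:
  assumes "u \<in> space (iid (uniform_on D) n)"
  shows "gaussian_vector P {..<n} (\<lambda>i \<omega>. \<gamma> * \<Gamma> (u i) \<omega>) (\<lambda>i j. \<gamma>\<^sup>2 * covariance_kernel P \<Gamma> (u i) (u j))"
  using assms by (intro gaussian_field_sample[OF field]) (auto simp: space_PiM PiE_iff)

lemma sample_wick_sum:
  "measure lborel D * sample_mean n (chaos_density \<omega>) u
    = wick_sum {..<n} (\<lambda>_. measure lborel D / n) (\<lambda>i \<omega>. \<gamma> * \<Gamma> (u i) \<omega>)
        (\<lambda>i j. \<gamma>\<^sup>2 * covariance_kernel P \<Gamma> (u i) (u j)) \<omega>"
  by (simp add: sample_mean_def wick_sum_def chaos_density_def sum_distrib_left sum_divide_distrib)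

end

lemma covariance_kernel_sym: "covariance_kernel P \<Gamma> z w = covariance_kernel P \<Gamma> w z"
  by (simp add: covariance_kernel_def mult.commute)

text \<open>At every fixed sample \<open>kahane_finite\<close> compares without error, with weights
  equal to the area divided by the sample size. The inequality survives integration over samples and
  the limit.\<close>

lemma (in smooth_convex) chaos_mass_smooth_le:
  assumes "gaussian_chaos P1 D \<Gamma>1" "gaussian_chaos P2 D \<Gamma>2"
    and cov: "\<And>z w. z \<in> D \<Longrightarrow> w \<in> D \<Longrightarrow> covariance_kernel P1 \<Gamma>1 z w \<le> covariance_kernel P2 \<Gamma>2 z w"
  shows "(LINT \<omega>|P1. f (chaos_mass \<gamma> P1 \<Gamma>1 D \<omega>)) \<le> (LINT \<omega>|P2. f (chaos_mass \<gamma> P2 \<Gamma>2 D \<omega>))"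
proof -
  interpret A: gaussian_chaos P1 D \<Gamma>1 \<gamma> by fact
  interpret B: gaussian_chaos P2 D \<Gamma>2 \<gamma> by fact
  let ?N = "uniform_on D" and ?m = "measure lborel D"
  have le: "(LINT u|iid ?N (Suc n). LINT \<omega>|P1. f (?m * sample_mean (Suc n) (A.chaos_density \<omega>) u))
      \<le> (LINT u|iid ?N (Suc n). LINT \<omega>|P2. f (?m * sample_mean (Suc n) (B.chaos_density \<omega>) u))" for n
  proof (rule integral_mono)
    fix u assume u: "u \<in> space (iid ?N (Suc n))"
    then have uD: "i < Suc n \<Longrightarrow> u i \<in> D" for i by (auto simp: space_PiM PiE_iff)
    show "(LINT \<omega>|P1. f (?m * sample_mean (Suc n) (A.chaos_density \<omega>) u))
      \<le> (LINT \<omega>|P2. f (?m * sample_mean (Suc n) (B.chaos_density \<omega>) u))"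
      unfolding A.sample_wick_sum B.sample_wick_sum
      by (rule kahane_finite[OF A.sample_gaussian_vector[OF u] _ B.sample_gaussian_vector[OF u]])
         (auto intro!: mult_left_mono cov uD simp: covariance_kernel_sym)
  qed (auto intro!: sample_mean_swap(1) A.P.prob_space_axioms B.P.prob_space_axioms A.N.prob_space_axioms
      A.chaos_density_integrable B.chaos_density_integrable A.chaos_density_nonneg B.chaos_density_nonneg)
  have "(LINT \<omega>|P1. f (?m * (LINT z|?N. A.chaos_density \<omega> z))) \<le> (LINT \<omega>|P2. f (?m * (LINT z|?N. B.chaos_density \<omega> z)))"
    by (rule LIMSEQ_le[OF sample_mean_expectation_tendsto sample_mean_expectation_tendsto, where m1="?m" and m2="?m"])
       (auto intro!: le A.P.prob_space_axioms B.P.prob_space_axioms A.N.prob_space_axioms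
      A.chaos_density_integrable B.chaos_density_integrable A.chaos_density_nonneg B.chaos_density_nonneg)
  then show ?thesis
    by (simp add: A.chaos_mass_eq B.chaos_mass_eq cong: Bochner_Integration.integral_cong)
qed

lemma convex_on_UNIV_measurable: "convex_on UNIV h \<Longrightarrow> h \<in> borel_measurable borel" for h :: "real \<Rightarrow> real"
  by (intro borel_measurable_continuous_onI convex_on_continuous) auto

lemma chaos_mass_lipschitz_le:
  assumes A: "gaussian_chaos P1 D \<Gamma>1" and B: "gaussian_chaos P2 D \<Gamma>2"
    and cov: "\<And>z w. z \<in> D \<Longrightarrow> w \<in> D \<Longrightarrow> covariance_kernel P1 \<Gamma>1 z w \<le> covariance_kernel P2 \<Gamma>2 z w"
    and conv: "convex_on UNIV h" and lip: "\<And>x y. \<bar>h x - h y\<bar> \<le> L * \<bar>x - y\<bar>"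
  shows "(LINT \<omega>|P1. h (chaos_mass \<gamma> P1 \<Gamma>1 D \<omega>)) \<le> (LINT \<omega>|P2. h (chaos_mass \<gamma> P2 \<Gamma>2 D \<omega>))"
proof (rule field_le_epsilon)
  interpret A: gaussian_chaos P1 D \<Gamma>1 \<gamma> by fact
  interpret B: gaussian_chaos P2 D \<Gamma>2 \<gamma> by fact
  let ?M1 = "chaos_mass \<gamma> P1 \<Gamma>1 D" and ?M2 = "chaos_mass \<gamma> P2 \<Gamma>2 D"
  note [measurable] = convex_on_UNIV_measurable[OF conv]
  have L: "0 \<le> L" using lip[of 0 1] by simp
  fix e :: real assume "e > 0"
  \<comment> \<open>Smoothing costs \<open>2 * L * \<epsilon>\<close> on either side; the
    \<open>+ 1\<close> covers \<open>L = 0\<close>.\<close>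
  define \<epsilon> where "\<epsilon> = e / (4 * L + 1)"
  have \<epsilon>: "\<epsilon> > 0" "4 * L * \<epsilon> \<le> e" using \<open>e > 0\<close> L by (auto simp: \<epsilon>_def field_simps)
  obtain f f' f'' C where sc: "smooth_convex f f' f'' L C" and fh: "\<And>x. \<bar>f x - h x\<bar> \<le> 2 * L * \<epsilon>"
    using smooth_convex_approximation[OF conv lip \<epsilon>(1)] by blast
  interpret smooth_convex f f' f'' L C by fact
  have i: "integrable P1 (\<lambda>\<omega>. h (?M1 \<omega>))" "integrable P2 (\<lambda>\<omega>. h (?M2 \<omega>))"
    "integrable P1 (\<lambda>\<omega>. f (?M1 \<omega>))" "integrable P2 (\<lambda>\<omega>. f (?M2 \<omega>))"
    by (intro lipschitz_comp_integrable[OF _ _ lip] integrable_f A.P.finite_measure_axioms B.P.finite_measure_axioms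
        A.chaos_mass_integrable B.chaos_mass_integrable; measurable)+
  have "(LINT \<omega>|P1. h (?M1 \<omega>)) \<le> (LINT \<omega>|P1. f (?M1 \<omega>) + 2 * L * \<epsilon>)"
  proof (rule integral_mono)
    show "h (?M1 \<omega>) \<le> f (?M1 \<omega>) + 2 * L * \<epsilon>" for \<omega> using fh[of "?M1 \<omega>"] by linarith
  qed (use i in auto)
  also have "\<dots> = (LINT \<omega>|P1. f (?M1 \<omega>)) + 2 * L * \<epsilon>" using i by (simp add: A.P.prob_space)
  also have "\<dots> \<le> (LINT \<omega>|P2. f (?M2 \<omega>)) + 2 * L * \<epsilon>"
    using chaos_mass_smooth_le[OF A B cov] by simp
  also have "(LINT \<omega>|P2. f (?M2 \<omega>)) \<le> (LINT \<omega>|P2. h (?M2 \<omega>) + 2 * L * \<epsilon>)"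
  proof (rule integral_mono)
    show "f (?M2 \<omega>) \<le> h (?M2 \<omega>) + 2 * L * \<epsilon>" for \<omega> using fh[of "?M2 \<omega>"] by linarith
  qed (use i in auto)
  also have "\<dots> = (LINT \<omega>|P2. h (?M2 \<omega>)) + 2 * L * \<epsilon>" using i by (simp add: B.P.prob_space)
  finally show "(LINT \<omega>|P1. h (?M1 \<omega>)) \<le> (LINT \<omega>|P2. h (?M2 \<omega>)) + e" using \<epsilon>(2) by simp
qed

section \<open>The convex order\<close>

text \<open>The minorants agree with \<open>F\<close> on intervals exhausting the positive reals but
  are not claimed to increase with \<open>n\<close>. Hence Fatou's lemma on the left, while on the
  right each minorant is bounded by \<open>F\<close>.\<close>

lemma convex_order_nn_integral:
  fixes M1 :: "'a \<Rightarrow> real" and M2 :: "'b \<Rightarrow> real" and F :: "real \<Rightarrow> real"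
  assumes "prob_space P1" "prob_space P2" and int: "integrable P1 M1" "integrable P2 M2"
    and pos: "AE \<omega> in P1. 0 < M1 \<omega>" "AE \<omega> in P2. 0 < M2 \<omega>"
    and ord: "\<And>h L. convex_on UNIV h \<Longrightarrow> (\<And>x y. \<bar>h x - h y\<bar> \<le> L * \<bar>x - y\<bar>) \<Longrightarrow>
        (LINT \<omega>|P1. h (M1 \<omega>)) \<le> (LINT \<omega>|P2. h (M2 \<omega>))"
    and conv: "convex_on {0<..} F" and nonneg: "\<And>x. 0 < x \<Longrightarrow> 0 \<le> F x"
  shows "(\<integral>\<^sup>+\<omega>. ennreal (F (M1 \<omega>)) \<partial>P1) \<le> (\<integral>\<^sup>+\<omega>. ennreal (F (M2 \<omega>)) \<partial>P2)"
proof -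
  interpret P1: prob_space P1 by fact
  interpret P2: prob_space P2 by fact
  have [measurable]: "M1 \<in> borel_measurable P1" "M2 \<in> borel_measurable P2" using int by auto
  have "\<exists>g L. convex_on UNIV g \<and> (\<forall>x y. \<bar>g x - g y\<bar> \<le> L * \<bar>x - y\<bar>) \<and> (\<forall>x. 0 \<le> g x)
      \<and> (\<forall>x>0. g x \<le> F x) \<and> (\<forall>x. 1 / real (Suc n) \<le> x \<longrightarrow> x \<le> real (Suc n) \<longrightarrow> g x = F x)" for n
  proof -
    have ab: "0 < 1 / real (Suc n)" "1 / real (Suc n) \<le> real (Suc n)" by (auto simp: field_simps)
    show ?thesis by (rule convex_lipschitz_minorant[OF conv nonneg ab]) blast+
  qed
  then obtain g L where g: "\<And>n. convex_on UNIV (g n)" "\<And>n x y. \<bar>g n x - g n y\<bar> \<le> L n * \<bar>x - y\<bar>"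
    "\<And>n x. 0 \<le> g n x" "\<And>n x. 0 < x \<Longrightarrow> g n x \<le> F x"
    "\<And>n x. 1 / real (Suc n) \<le> x \<Longrightarrow> x \<le> real (Suc n) \<Longrightarrow> g n x = F x"
    by metis
  have [measurable]: "g n \<in> borel_measurable borel" for n by (rule convex_on_UNIV_measurable[OF g(1)])
  have le: "(\<integral>\<^sup>+\<omega>. ennreal (g n (M1 \<omega>)) \<partial>P1) \<le> (\<integral>\<^sup>+\<omega>. ennreal (F (M2 \<omega>)) \<partial>P2)" for n
  proof -
    have i: "integrable P1 (\<lambda>\<omega>. g n (M1 \<omega>))" "integrable P2 (\<lambda>\<omega>. g n (M2 \<omega>))"
      by (intro lipschitz_comp_integrable[OF _ _ g(2)] P1.finite_measure_axioms P2.finite_measure_axioms int; measurable)+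
    have "(\<integral>\<^sup>+\<omega>. ennreal (g n (M1 \<omega>)) \<partial>P1) = ennreal (LINT \<omega>|P1. g n (M1 \<omega>))"
      using i g(3) by (intro nn_integral_eq_integral) auto
    also have "\<dots> \<le> ennreal (LINT \<omega>|P2. g n (M2 \<omega>))"
      by (intro ennreal_leI ord[OF g(1) g(2)])
    also have "\<dots> = (\<integral>\<^sup>+\<omega>. ennreal (g n (M2 \<omega>)) \<partial>P2)"
      using i g(3) by (intro nn_integral_eq_integral[symmetric]) auto
    also have "\<dots> \<le> (\<integral>\<^sup>+\<omega>. ennreal (F (M2 \<omega>)) \<partial>P2)"
      using pos(2) by (intro nn_integral_mono_AE) (auto intro!: ennreal_leI g(4))
    finally show ?thesis .
  qed
  have lim: "liminf (\<lambda>n. ennreal (g n x)) = ennreal (F x)" if x0: "0 < x" for x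
  proof -
    obtain n1 where n1: "x \<le> real n1" using real_arch_simple by blast
    obtain n2 where n2: "1 / real (Suc n2) < x" by (rule nat_approx_posE[OF x0])
    have "g n x = F x" if n: "n \<ge> max n1 n2" for n
    proof (rule g(5))
      show "x \<le> real (Suc n)" using n1 n by linarith
      have "1 / real (Suc n) \<le> 1 / real (Suc n2)" using n by (intro divide_left_mono) auto
      then show "1 / real (Suc n) \<le> x" using n2 by linarith
    qed
    then have "\<forall>\<^sub>F n in sequentially. ennreal (g n x) = ennreal (F x)"
      unfolding eventually_sequentially by (intro exI[of _ "max n1 n2"]) auto
    then have "(\<lambda>n. ennreal (g n x)) \<longlonglongrightarrow> ennreal (F x)" by (rule tendsto_eventually)
    then show ?thesis by (intro lim_imp_Liminf) auto
  qed
  have "(\<integral>\<^sup>+\<omega>. ennreal (F (M1 \<omega>)) \<partial>P1) = (\<integral>\<^sup>+\<omega>. liminf (\<lambda>n. ennreal (g n (M1 \<omega>))) \<partial>P1)"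
    using pos(1) by (intro nn_integral_cong_AE) (auto simp: lim)
  also have "\<dots> \<le> liminf (\<lambda>n. \<integral>\<^sup>+\<omega>. ennreal (g n (M1 \<omega>)) \<partial>P1)"
    by (rule nn_integral_liminf) measurable
  also have "\<dots> \<le> limsup (\<lambda>n. \<integral>\<^sup>+\<omega>. ennreal (g n (M1 \<omega>)) \<partial>P1)"
    by (rule Liminf_le_Limsup) simp
  also have "\<dots> \<le> (\<integral>\<^sup>+\<omega>. ennreal (F (M2 \<omega>)) \<partial>P2)"
    by (rule Limsup_bounded) (simp add: le)
  finally show ?thesis .
qed

section \<open>Expectations with values in the extended reals\<close>

lemma extended_expectation_cong_AE:
  "AE \<omega> in P. X \<omega> = Y \<omega> \<Longrightarrow> extended_expectation P X = extended_expectation P Y"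
  unfolding extended_expectation_def
  by (intro arg_cong2[where f="\<lambda>a b. enn2ereal a - enn2ereal b"] nn_integral_cong_AE) auto

lemma enn2ereal_finite: "x < \<infinity> \<Longrightarrow> enn2ereal x = ereal (enn2real x)"
  by (cases x) (auto simp: enn2ereal_ennreal)

text \<open>Finiteness of the negative part excludes the difference of two infinities, which is
  \<open>\<infinity>\<close> in either order and so does not change sign.\<close>

lemma extended_expectation_uminus:
  assumes "(\<integral>\<^sup>+\<omega>. ennreal (- X \<omega>) \<partial>P) < \<infinity>"
  shows "extended_expectation P (\<lambda>\<omega>. - X \<omega>) = - extended_expectation P X"
  using enn2ereal_finite[OF assms]
  by (cases "enn2ereal (\<integral>\<^sup>+\<omega>. ennreal (X \<omega>) \<partial>P)") (auto simp: extended_expectation_def)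

text \<open>An integrable term can be split off even if the nonnegative one has infinite integral:
  in that case the positive part of the sum is infinite as well, and the negative part stays below
  the integral of \<bar>A\<bar>.\<close>

lemma extended_expectation_nonneg_add:
  assumes [measurable]: "H \<in> borel_measurable P" and H0: "\<And>\<omega>. 0 \<le> H \<omega>" and A: "integrable P A"
  shows "extended_expectation P (\<lambda>\<omega>. H \<omega> + A \<omega>) = enn2ereal (\<integral>\<^sup>+\<omega>. ennreal (H \<omega>) \<partial>P) + ereal (LINT \<omega>|P. A \<omega>)"
    and "(\<integral>\<^sup>+\<omega>. ennreal (- (H \<omega> + A \<omega>)) \<partial>P) < \<infinity>"
proof -
  let ?X = "\<lambda>\<omega>. H \<omega> + A \<omega>"
  have [measurable]: "A \<in> borel_measurable P" using A by auto
  have Afin: "(\<integral>\<^sup>+\<omega>. ennreal \<bar>A \<omega>\<bar> \<partial>P) < \<infinity>" using A by (simp add: integrable_iff_bounded)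
  have "(\<integral>\<^sup>+\<omega>. ennreal (- ?X \<omega>) \<partial>P) \<le> (\<integral>\<^sup>+\<omega>. ennreal \<bar>A \<omega>\<bar> \<partial>P)"
  proof (intro nn_integral_mono ennreal_leI)
    show "- ?X \<omega> \<le> \<bar>A \<omega>\<bar>" for \<omega> using H0[of \<omega>] by linarith
  qed
  then show neg: "(\<integral>\<^sup>+\<omega>. ennreal (- ?X \<omega>) \<partial>P) < \<infinity>" using Afin by (rule le_less_trans)
  show "extended_expectation P ?X = enn2ereal (\<integral>\<^sup>+\<omega>. ennreal (H \<omega>) \<partial>P) + ereal (LINT \<omega>|P. A \<omega>)"
  proof (cases "(\<integral>\<^sup>+\<omega>. ennreal (H \<omega>) \<partial>P) < \<infinity>")
    case True
    then have iH: "integrable P H" using H0 by (intro integrableI_nonneg) auto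
    then have iX: "integrable P ?X" using A by simp
    have posf: "(\<integral>\<^sup>+\<omega>. ennreal (?X \<omega>) \<partial>P) < \<infinity>"
    proof (rule le_less_trans)
      show "(\<integral>\<^sup>+\<omega>. ennreal (?X \<omega>) \<partial>P) \<le> (\<integral>\<^sup>+\<omega>. ennreal \<bar>?X \<omega>\<bar> \<partial>P)"
        by (intro nn_integral_mono ennreal_leI abs_ge_self)
      show "(\<integral>\<^sup>+\<omega>. ennreal \<bar>?X \<omega>\<bar> \<partial>P) < \<infinity>" using iX by (simp add: integrable_iff_bounded)
    qed
    have "extended_expectation P ?X = ereal (LINT \<omega>|P. ?X \<omega>)"
      unfolding extended_expectation_def enn2ereal_finite[OF posf] enn2ereal_finite[OF neg]
        real_lebesgue_integral_def[OF iX] by simp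
    also have "\<dots> = ereal (LINT \<omega>|P. H \<omega>) + ereal (LINT \<omega>|P. A \<omega>)" using iH A by simp
    also have "ereal (LINT \<omega>|P. H \<omega>) = enn2ereal (\<integral>\<^sup>+\<omega>. ennreal (H \<omega>) \<partial>P)"
      using nn_integral_eq_integral[OF iH] H0 by (simp add: enn2ereal_ennreal)
    finally show ?thesis .
  next
    case False
    then have Hinf: "(\<integral>\<^sup>+\<omega>. ennreal (H \<omega>) \<partial>P) = \<infinity>" by (simp add: less_top[symmetric])
    have "(\<integral>\<^sup>+\<omega>. ennreal (H \<omega>) \<partial>P) \<le> (\<integral>\<^sup>+\<omega>. ennreal (?X \<omega>) + ennreal \<bar>A \<omega>\<bar> \<partial>P)"
    proof (rule nn_integral_mono)
      fix \<omega>
      have "ennreal (H \<omega>) \<le> ennreal (max 0 (?X \<omega>) + \<bar>A \<omega>\<bar>)" by (intro ennreal_leI) linarith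
      also have "\<dots> = ennreal (max 0 (?X \<omega>)) + ennreal \<bar>A \<omega>\<bar>" by (intro ennreal_plus) auto
      also have "ennreal (max 0 (?X \<omega>)) = ennreal (?X \<omega>)" by (simp add: max_def ennreal_neg)
      finally show "ennreal (H \<omega>) \<le> ennreal (?X \<omega>) + ennreal \<bar>A \<omega>\<bar>" .
    qed
    also have "\<dots> = (\<integral>\<^sup>+\<omega>. ennreal (?X \<omega>) \<partial>P) + (\<integral>\<^sup>+\<omega>. ennreal \<bar>A \<omega>\<bar> \<partial>P)"
      by (intro nn_integral_add) auto
    finally have "(\<integral>\<^sup>+\<omega>. ennreal (?X \<omega>) \<partial>P) = \<infinity>"
      using Hinf Afin by (auto simp: top_unique)
    then show ?thesis
      unfolding extended_expectation_def Hinf enn2ereal_finite[OF neg] by simp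
  qed
qed

text \<open>The function is its tangent at 1 plus a nonnegative remainder, and the tangent is
  integrable. The second claim shows that the extended expectation never is a difference of
  infinities.\<close>

lemma extended_expectation_convex:
  fixes f :: "real \<Rightarrow> real" and c :: real
  assumes "prob_space P" and int: "integrable P M" and pos: "AE \<omega> in P. 0 < M \<omega>"
    and conv: "convex_on {0<..} f" and c: "\<forall>x>0. f 1 + c * (x - 1) \<le> f x"
  shows "extended_expectation P (\<lambda>\<omega>. f (M \<omega>))
      = enn2ereal (\<integral>\<^sup>+\<omega>. ennreal (f (M \<omega>) - (f 1 + c * (M \<omega> - 1))) \<partial>P)
        + ereal (f 1 + c * ((LINT \<omega>|P. M \<omega>) - 1))"
    and "(\<integral>\<^sup>+\<omega>. ennreal (- f (M \<omega>)) \<partial>P) < \<infinity>"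
proof -
  interpret prob_space P by fact
  define A where "A = (\<lambda>\<omega>. f 1 + c * (M \<omega> - 1))"
  \<comment> \<open>The values of \<open>f\<close> off the positive reals are arbitrary. Cutting
    them away makes \<open>H\<close> measurable and nonnegative everywhere, at the price of an
    almost sure identity.\<close>
  define H where "H = (\<lambda>\<omega>. indicator {0<..} (M \<omega>) *\<^sub>R f (M \<omega>) - indicator {0<..} (M \<omega>) *\<^sub>R A \<omega>)"
  have [measurable]: "M \<in> borel_measurable P" using int by auto
  have "continuous_on {0<..} f" by (rule convex_on_continuous[OF _ conv]) simp
  then have [measurable]: "(\<lambda>x. indicator {0<..} x *\<^sub>R f x) \<in> borel_measurable borel"
    by (intro borel_measurable_continuous_on_indicator) auto
  have Hm: "H \<in> borel_measurable P"
    unfolding H_def A_def by measurable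
  have H0: "0 \<le> H \<omega>" for \<omega>
    using c by (auto simp: H_def A_def indicator_def)
  have iA: "integrable P A" using int by (simp add: A_def)
  have EA: "(LINT \<omega>|P. A \<omega>) = f 1 + c * ((LINT \<omega>|P. M \<omega>) - 1)" using int by (simp add: A_def prob_space)
  have eq: "AE \<omega> in P. f (M \<omega>) = H \<omega> + A \<omega>" "AE \<omega> in P. H \<omega> = f (M \<omega>) - (f 1 + c * (M \<omega> - 1))"
    using pos by (auto simp: H_def A_def)
  have "extended_expectation P (\<lambda>\<omega>. f (M \<omega>)) = extended_expectation P (\<lambda>\<omega>. H \<omega> + A \<omega>)"
    by (rule extended_expectation_cong_AE[OF eq(1)])
  also have "\<dots> = enn2ereal (\<integral>\<^sup>+\<omega>. ennreal (H \<omega>) \<partial>P) + ereal (LINT \<omega>|P. A \<omega>)"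
    by (rule extended_expectation_nonneg_add[OF Hm H0 iA])
  also have "(\<integral>\<^sup>+\<omega>. ennreal (H \<omega>) \<partial>P) = (\<integral>\<^sup>+\<omega>. ennreal (f (M \<omega>) - (f 1 + c * (M \<omega> - 1))) \<partial>P)"
    using eq(2) by (intro nn_integral_cong_AE) auto
  finally show "extended_expectation P (\<lambda>\<omega>. f (M \<omega>))
      = enn2ereal (\<integral>\<^sup>+\<omega>. ennreal (f (M \<omega>) - (f 1 + c * (M \<omega> - 1))) \<partial>P)
        + ereal (f 1 + c * ((LINT \<omega>|P. M \<omega>) - 1))" unfolding EA .
  have "(\<integral>\<^sup>+\<omega>. ennreal (- f (M \<omega>)) \<partial>P) = (\<integral>\<^sup>+\<omega>. ennreal (- (H \<omega> + A \<omega>)) \<partial>P)"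
    using eq(1) by (intro nn_integral_cong_AE) auto
  then show "(\<integral>\<^sup>+\<omega>. ennreal (- f (M \<omega>)) \<partial>P) < \<infinity>"
    using extended_expectation_nonneg_add(2)[OF Hm H0 iA] by simp
qed

text \<open>Equal means give equal expectations of the tangent, so only the nonnegative remainders
  are compared. The negated form serves concave functions; it follows because both negative parts
  are finite.\<close>

lemma convex_order_extended_expectation:
  fixes M1 :: "'a \<Rightarrow> real" and M2 :: "'b \<Rightarrow> real" and f :: "real \<Rightarrow> real"
  assumes P: "prob_space P1" "prob_space P2" and int: "integrable P1 M1" "integrable P2 M2"
    and pos: "AE \<omega> in P1. 0 < M1 \<omega>" "AE \<omega> in P2. 0 < M2 \<omega>"
    and mean: "(LINT \<omega>|P1. M1 \<omega>) = (LINT \<omega>|P2. M2 \<omega>)"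
    and ord: "\<And>h L. convex_on UNIV h \<Longrightarrow> (\<And>x y. \<bar>h x - h y\<bar> \<le> L * \<bar>x - y\<bar>) \<Longrightarrow>
        (LINT \<omega>|P1. h (M1 \<omega>)) \<le> (LINT \<omega>|P2. h (M2 \<omega>))"
    and conv: "convex_on {0<..} f"
  shows "extended_expectation P1 (\<lambda>\<omega>. f (M1 \<omega>)) \<le> extended_expectation P2 (\<lambda>\<omega>. f (M2 \<omega>))"
    and "extended_expectation P2 (\<lambda>\<omega>. - f (M2 \<omega>)) \<le> extended_expectation P1 (\<lambda>\<omega>. - f (M1 \<omega>))"
proof -
  obtain c where c: "\<forall>x>0. f 1 + c * (x - 1) \<le> f x"
    using convex_on_subgradient[OF conv, of 1] by (auto simp: interior_open)
  define F where "F = (\<lambda>x. f x - (f 1 + c * (x - 1)))"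
  have "convex_on {0<..} (\<lambda>x. - (f 1 + c * (x - 1)))"
    by (intro convex_onI) (auto simp: algebra_simps)
  from convex_on_add[OF conv this] have convF: "convex_on {0<..} F"
    by (simp only: F_def diff_conv_add_uminus)
  have "(\<integral>\<^sup>+\<omega>. ennreal (F (M1 \<omega>)) \<partial>P1) \<le> (\<integral>\<^sup>+\<omega>. ennreal (F (M2 \<omega>)) \<partial>P2)"
  proof (rule convex_order_nn_integral[OF P int pos _ convF])
    show "0 \<le> F x" if "0 < x" for x using c that by (simp add: F_def)
  qed (rule ord)
  then show le: "extended_expectation P1 (\<lambda>\<omega>. f (M1 \<omega>)) \<le> extended_expectation P2 (\<lambda>\<omega>. f (M2 \<omega>))"
    unfolding extended_expectation_convex(1)[OF P(1) int(1) pos(1) conv c]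
      extended_expectation_convex(1)[OF P(2) int(2) pos(2) conv c] mean F_def
    by (intro add_right_mono) (simp add: less_eq_ennreal.rep_eq)
  show "extended_expectation P2 (\<lambda>\<omega>. - f (M2 \<omega>)) \<le> extended_expectation P1 (\<lambda>\<omega>. - f (M1 \<omega>))"
    using le
    by (simp add: extended_expectation_uminus[OF extended_expectation_convex(2)[OF P(1) int(1) pos(1) conv c]]
        extended_expectation_uminus[OF extended_expectation_convex(2)[OF P(2) int(2) pos(2) conv c]])
qed

theorem proposition6p1:
  fixes P1 :: "'a measure" and P2 :: "'b measure"
    and D :: "complex set"
    and \<Gamma>1 :: "complex \<Rightarrow> 'a \<Rightarrow> real" and \<Gamma>2 :: "complex \<Rightarrow> 'b \<Rightarrow> real"
    and \<gamma> :: real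
  assumes "open D" and "connected D" and "D \<noteq> {}" and "bounded D"
    and "centred_gaussian_field P1 D \<Gamma>1"
    and "centred_gaussian_field P2 D \<Gamma>2"
    and "\<And>z w. z \<in> D \<Longrightarrow> w \<in> D \<Longrightarrow> covariance_kernel P1 \<Gamma>1 z w \<le> covariance_kernel P2 \<Gamma>2 z w"
  shows "(\<forall>f :: real \<Rightarrow> real. convex_on {0<..} f \<longrightarrow>
            extended_expectation P1 (\<lambda>\<omega>. f (chaos_mass \<gamma> P1 \<Gamma>1 D \<omega>))
              \<le> extended_expectation P2 (\<lambda>\<omega>. f (chaos_mass \<gamma> P2 \<Gamma>2 D \<omega>)))
       \<and> (\<forall>f :: real \<Rightarrow> real. concave_on {0<..} f \<longrightarrow>
            extended_expectation P2 (\<lambda>\<omega>. f (chaos_mass \<gamma> P2 \<Gamma>2 D \<omega>))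
              \<le> extended_expectation P1 (\<lambda>\<omega>. f (chaos_mass \<gamma> P1 \<Gamma>1 D \<omega>)))"
proof -
  interpret A: gaussian_chaos P1 D \<Gamma>1 \<gamma> by standard fact+
  interpret B: gaussian_chaos P2 D \<Gamma>2 \<gamma> by standard fact+
  let ?M1 = "chaos_mass \<gamma> P1 \<Gamma>1 D" and ?M2 = "chaos_mass \<gamma> P2 \<Gamma>2 D"
  have ord: "(LINT \<omega>|P1. h (?M1 \<omega>)) \<le> (LINT \<omega>|P2. h (?M2 \<omega>))"
    if "convex_on UNIV h" "\<And>x y. \<bar>h x - h y\<bar> \<le> L * \<bar>x - y\<bar>" for h L
    by (rule chaos_mass_lipschitz_le[OF A.gaussian_chaos_axioms B.gaussian_chaos_axioms assms(7) that])
  note order = convex_order_extended_expectation[OF A.P.prob_space_axioms B.P.prob_space_axioms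
      A.chaos_mass_integrable B.chaos_mass_integrable A.chaos_mass_pos B.chaos_mass_pos
      A.chaos_mass_expectation[folded B.chaos_mass_expectation]]
  show ?thesis
  proof (intro conjI allI impI)
    fix f :: "real \<Rightarrow> real" assume f: "convex_on {0<..} f"
    show "extended_expectation P1 (\<lambda>\<omega>. f (?M1 \<omega>)) \<le> extended_expectation P2 (\<lambda>\<omega>. f (?M2 \<omega>))"
      by (rule order(1)[OF _ f]) (rule ord)
  next
    fix f :: "real \<Rightarrow> real" assume "concave_on {0<..} f"
    then have f: "convex_on {0<..} (\<lambda>x. - f x)" by (simp add: concave_on_def)
    have "extended_expectation P2 (\<lambda>\<omega>. - (- f (?M2 \<omega>))) \<le> extended_expectation P1 (\<lambda>\<omega>. - (- f (?M1 \<omega>)))"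
      by (rule order(2)[OF _ f]) (rule ord)
    then show "extended_expectation P2 (\<lambda>\<omega>. f (?M2 \<omega>)) \<le> extended_expectation P1 (\<lambda>\<omega>. f (?M1 \<omega>))"
      by simp
  qed
qed

end
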